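(* Suppose that $\mathbf{A}^\#$ is a computable presentation of a unital $\mathrm{C}^*$-algebra $\mathbf{A}$ and that the unit of $\mathbf{A}$ is a computable point of $\mathbf{A}^\#$. Let $a$ be a normal element of $\mathbf{A}$ that is a computable point of $\mathbf{A}^\#$. Then $\sigma(a)$, the spectrum of $a$, is a computably compact subset of $\mathbb{C}$, and the continuous functional calculus $f \mapsto f(a)$ is a computable map from $C(\sigma(a))$ (with its standard presentation) to $\mathbf{A}^\#$.
   Context: A presentation $\mathbf{A}^\#$ of a (separable) $\mathrm{C}^*$-algebra $\mathbf{A}$ is $\mathbf{A}$ together with a finite or infinite sequence $(a_n)$ of elements of $\mathbf{A}$, called special points, that generate a dense $*$-subalgebra. The generated points of $\mathbf{A}^\#$ are the elements $p(a_0,\dots,a_m)$ with $p$ a rational $*$-polynomial (a noncommutative polynomial in $x_0,\dots,x_m,x_0^*,\dots,x_m^*$ with coefficients in $\mathbb{Q}(i)$ and no constant term); a code of a generated point is a natural-number code of such a $p$. $\mathbf{A}^\#$ is computable if from a code of a generated point $\rho$ and $k\in\mathbb{N}$ one can compute a rational $q$ with $|\,\|\rho\|-q\,|<2^{-k}$. A point $x$ is a computable point of $\mathbf{A}^\#$ if there is an algorithm which from $k$ computes a code of a generated point $\rho$ with $\|x-\rho\|<2^{-k}$. A name of $x$ is a sequence of (codes of) generated points $(\rho_k)_k$ with $\|x-\rho_k\|<2^{-k}$; a map between presented structures is computable if there is an algorithm (oracle machine) converting any name of an input $x$ into a name of its image. $\mathbb{C}$ carries its standard presentation, with special point $1$ and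 generated points $\mathbb{Q}(i)$. A compact set $K\subseteq\mathbb{C}$ is computably compact if from $k\in\mathbb{N}$ one can compute a finite tuple of open balls with centres in $\mathbb{Q}(i)$ and radius $2^{-k}$ that cover $K$ and each of which meets $K$. For compact $K\subseteq\mathbb{C}$, the standard presentation of $C(K)$ has as special points the constant function $1$ and the identity function $z:K\to\mathbb{C}$. For $a$ normal in unital $\mathbf{A}$, the continuous functional calculus is the unique $*$-homomorphism $C(\sigma(a))\to\mathbf{A}$ with $1\mapsto 1_{\mathbf{A}}$ and $z\mapsto a$; the image of $f$ is written $f(a)$. *)

theory Defs
  imports
    "HOL-Analysis.Analysis"
    "HOL-Library.Function_Algebras"
    "HOL-Library.Nat_Bijection"
    "HOL-Library.Countable"
    "HOL-Library.Extended_Nat"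
begin

section \<open>Relative computability\<close>

datatype prog =
    Zero
  | Succ
  | Proj nat
  | Query
  | Comp prog "prog list"
  | PrimRec prog prog
  | Mu prog

text \<open>Kleene's \<open>\<mu>\<close>-recursive functions relative to a function: \<open>computes \<alpha> p xs y\<close> says
  that \<open>p\<close>, allowed to query \<open>\<alpha>\<close>, halts on the arguments \<open>xs\<close> with output \<open>y\<close>.\<close>

inductive computes :: "(nat \<Rightarrow> nat) \<Rightarrow> prog \<Rightarrow> nat list \<Rightarrow> nat \<Rightarrow> bool" for \<alpha> where
  zero: "computes \<alpha> Zero xs 0"
| succ: "computes \<alpha> Succ [x] (Suc x)"
| proj: "i < length xs \<Longrightarrow> computes \<alpha> (Proj i) xs (xs ! i)"
| query: "computes \<alpha> Query [x] (\<alpha> x)"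
| comp: "list_all2 (\<lambda>g y. computes \<alpha> g xs y) gs ys \<Longrightarrow> computes \<alpha> f ys z
    \<Longrightarrow> computes \<alpha> (Comp f gs) xs z"
| primrec_0: "computes \<alpha> f xs y \<Longrightarrow> computes \<alpha> (PrimRec f g) (0 # xs) y"
| primrec_Suc: "computes \<alpha> (PrimRec f g) (n # xs) y \<Longrightarrow> computes \<alpha> g (n # y # xs) z
    \<Longrightarrow> computes \<alpha> (PrimRec f g) (Suc n # xs) z"
| mu: "computes \<alpha> f (n # xs) 0 \<Longrightarrow> (\<And>m. m < n \<Longrightarrow> \<exists>y. computes \<alpha> f (m # xs) (Suc y))
    \<Longrightarrow> computes \<alpha> (Mu f) xs n"

text \<open>Absolute computability: the zero function is itself computable and gives no information.\<close>

abbreviation computes0 :: "prog \<Rightarrow> nat list \<Rightarrow> nat \<Rightarrow> bool" where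
  "computes0 \<equiv> computes (\<lambda>_. 0)"


section \<open>Complex *-algebras and unital C*-algebras\<close>

class complex_star_algebra = ring +
  fixes scaleC :: "complex \<Rightarrow> 'a \<Rightarrow> 'a"
    and star :: "'a \<Rightarrow> 'a"
  assumes scaleC_add_right: "scaleC c (x + y) = scaleC c x + scaleC c y"
    and scaleC_add_left: "scaleC (c + d) x = scaleC c x + scaleC d x"
    and scaleC_scaleC: "scaleC c (scaleC d x) = scaleC (c * d) x"
    and scaleC_one: "scaleC 1 x = x"
    and mult_scaleC_left: "scaleC c x * y = scaleC c (x * y)"
    and mult_scaleC_right: "x * scaleC c y = scaleC c (x * y)"
    and star_star: "star (star x) = x"
    and star_add: "star (x + y) = star x + star y"
    and star_mult: "star (x * y) = star y * star x"
    and star_scaleC: "star (scaleC c x) = scaleC (cnj c) (star x)"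

class unital_cstar_algebra = complex_star_algebra + real_normed_algebra_1 + banach +
  assumes scaleR_scaleC: "scaleR r x = scaleC (complex_of_real r) x"
    and norm_scaleC: "norm (scaleC c x) = cmod c * norm x"
    and cstar_identity: "norm (star x * x) = norm x ^ 2"

instantiation complex :: unital_cstar_algebra
begin

definition scaleC_complex :: "complex \<Rightarrow> complex \<Rightarrow> complex" where
  "scaleC_complex c x = c * x"

definition star_complex :: "complex \<Rightarrow> complex" where
  "star_complex = cnj"

instance
  by standard
    (auto simp: scaleC_complex_def star_complex_def algebra_simps scaleR_conv_of_real
      norm_mult power2_eq_square)

end

text \<open>Pointwise operations; the ring structure comes from \<^theory>\<open>HOL-Library.Function_Algebras\<close>.\<close>

instantiation "fun" :: (type, complex_star_algebra) complex_star_algebra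
begin

definition scaleC_fun :: "complex \<Rightarrow> ('a \<Rightarrow> 'b) \<Rightarrow> 'a \<Rightarrow> 'b" where
  "scaleC_fun c f = (\<lambda>t. scaleC c (f t))"

definition star_fun :: "('a \<Rightarrow> 'b) \<Rightarrow> 'a \<Rightarrow> 'b" where
  "star_fun f = (\<lambda>t. star (f t))"

instance
  by standard
    (auto simp: scaleC_fun_def star_fun_def fun_eq_iff scaleC_add_right scaleC_add_left
      scaleC_scaleC scaleC_one mult_scaleC_left mult_scaleC_right star_star star_add star_mult
      star_scaleC)

end

definition normal_element :: "'a::complex_star_algebra \<Rightarrow> bool" where
  "normal_element a \<longleftrightarrow> star a * a = a * star a"

definition spectrum :: "'a::unital_cstar_algebra \<Rightarrow> complex set" where
  "spectrum a = {l. \<not> (\<exists>b. b * (a - scaleC l 1) = 1 \<and> (a - scaleC l 1) * b = 1)}"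

inductive_set generated_star_subalgebra :: "'a::complex_star_algebra set \<Rightarrow> 'a set" for S where
  base: "x \<in> S \<Longrightarrow> x \<in> generated_star_subalgebra S"
| zero: "0 \<in> generated_star_subalgebra S"
| add: "x \<in> generated_star_subalgebra S \<Longrightarrow> y \<in> generated_star_subalgebra S
    \<Longrightarrow> x + y \<in> generated_star_subalgebra S"
| mult: "x \<in> generated_star_subalgebra S \<Longrightarrow> y \<in> generated_star_subalgebra S
    \<Longrightarrow> x * y \<in> generated_star_subalgebra S"
| scaleC: "x \<in> generated_star_subalgebra S \<Longrightarrow> scaleC c x \<in> generated_star_subalgebra S"
| star: "x \<in> generated_star_subalgebra S \<Longrightarrow> star x \<in> generated_star_subalgebra S"


section \<open>Rational *-polynomials and their codes\<close>

datatype letter = X nat | Xstar nat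

fun letter_index :: "letter \<Rightarrow> nat" where
  "letter_index (X i) = i"
| "letter_index (Xstar i) = i"

text \<open>A monomial \<open>((r, s), l, ls)\<close> has coefficient \<open>r + i s\<close> and the nonempty word \<open>l # ls\<close>
  (so there are no constant terms); a list of monomials stands for their formal sum.\<close>

type_synonym monomial = "(rat \<times> rat) \<times> letter \<times> letter list"
type_synonym rational_star_poly = "monomial list"

definition gaussian :: "rat \<times> rat \<Rightarrow> complex" where
  "gaussian = (\<lambda>(r, s). Complex (of_rat r) (of_rat s))"

fun letter_value :: "(nat \<Rightarrow> 'a::complex_star_algebra) \<Rightarrow> letter \<Rightarrow> 'a" where
  "letter_value v (X i) = v i"
| "letter_value v (Xstar i) = star (v i)"

fun monomial_value :: "(nat \<Rightarrow> 'a::complex_star_algebra) \<Rightarrow> monomial \<Rightarrow> 'a" where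
  "monomial_value v (c, l, ls) =
     scaleC (gaussian c) (foldl (\<lambda>x m. x * letter_value v m) (letter_value v l) ls)"

definition poly_value :: "(nat \<Rightarrow> 'a::complex_star_algebra) \<Rightarrow> rational_star_poly \<Rightarrow> 'a" where
  "poly_value v p = (\<Sum>m\<leftarrow>p. monomial_value v m)"

definition poly_indices :: "rational_star_poly \<Rightarrow> nat set" where
  "poly_indices p = (\<Union>(c, l, ls)\<in>set p. letter_index ` set (l # ls))"

text \<open>All decoding functions are total and onto; an object may have several codes.\<close>

definition gaussian_decode :: "nat \<Rightarrow> rat \<times> rat" where
  "gaussian_decode n = (case prod_decode n of (a, b) \<Rightarrow> (nat_to_rat_surj a, nat_to_rat_surj b))"

definition letter_decode :: "nat \<Rightarrow> letter" where
  "letter_decode n = (case sum_decode n of Inl i \<Rightarrow> X i | Inr i \<Rightarrow> Xstar i)"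

definition monomial_decode :: "nat \<Rightarrow> monomial" where
  "monomial_decode n = (case prod_decode n of (c, w) \<Rightarrow> case prod_decode w of (l, ls) \<Rightarrow>
     (gaussian_decode c, letter_decode l, map letter_decode (list_decode ls)))"

definition poly_decode :: "nat \<Rightarrow> rational_star_poly" where
  "poly_decode n = map monomial_decode (list_decode n)"


section \<open>Presentations\<close>

text \<open>An algebra, given by its underlying set inside a *-algebra type and its norm, together
  with a sequence of special points \<open>special P i\<close>, \<open>i < num_special P\<close>, which is finite or
  infinite. Values of \<open>special P\<close> beyond \<open>num_special P\<close> are ignored.\<close>

record 'a presentation =
  points :: "'a set"
  nrm :: "'a \<Rightarrow> real"
  num_special :: enat
  special :: "nat \<Rightarrow> 'a"

definition cstar_presentation :: "'a::unital_cstar_algebra presentation \<Rightarrow> bool" where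
  "cstar_presentation P \<longleftrightarrow> points P = UNIV \<and> nrm P = norm \<and>
     closure (generated_star_subalgebra {special P i |i. enat i < num_special P}) = UNIV"

definition codes :: "'a presentation \<Rightarrow> nat set" where
  "codes P = {n. \<forall>i\<in>poly_indices (poly_decode n). enat i < num_special P}"

definition generated_point :: "'a::complex_star_algebra presentation \<Rightarrow> nat \<Rightarrow> 'a" where
  "generated_point P n = poly_value (special P) (poly_decode n)"

definition computable_presentation :: "'a::complex_star_algebra presentation \<Rightarrow> bool" where
  "computable_presentation P \<longleftrightarrow> (\<exists>p. \<forall>n\<in>codes P. \<forall>k. \<exists>q. computes0 p [n, k] q \<and>
     \<bar>nrm P (generated_point P n) - of_rat (nat_to_rat_surj q)\<bar> < 1 / 2 ^ k)"

definition is_name :: "'a::complex_star_algebra presentation \<Rightarrow> (nat \<Rightarrow> nat) \<Rightarrow> 'a \<Rightarrow> bool" where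
  "is_name P \<alpha> x \<longleftrightarrow> x \<in> points P \<and>
     (\<forall>k. \<alpha> k \<in> codes P \<and> nrm P (x - generated_point P (\<alpha> k)) < 1 / 2 ^ k)"

definition computable_point :: "'a::complex_star_algebra presentation \<Rightarrow> 'a \<Rightarrow> bool" where
  "computable_point P x \<longleftrightarrow> (\<exists>p \<alpha>. (\<forall>k. computes0 p [k] (\<alpha> k)) \<and> is_name P \<alpha> x)"

definition computable_map ::
  "'a::complex_star_algebra presentation \<Rightarrow> 'b::complex_star_algebra presentation
     \<Rightarrow> ('a \<Rightarrow> 'b) \<Rightarrow> bool" where
  "computable_map P Q F \<longleftrightarrow> (\<exists>p. \<forall>x\<in>points P. \<forall>\<alpha>. is_name P \<alpha> x \<longrightarrow>
     (\<exists>\<beta>. (\<forall>k. computes \<alpha> p [k] (\<beta> k)) \<and> is_name Q \<beta> (F x)))"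

definition computably_compact :: "complex set \<Rightarrow> bool" where
  "computably_compact K \<longleftrightarrow> compact K \<and>
     (\<exists>p. \<forall>k. \<exists>n. computes0 p [k] n \<and>
       (let B = \<lambda>c. ball (gaussian (gaussian_decode c)) (1 / 2 ^ k)
        in K \<subseteq> (\<Union>c\<in>set (list_decode n). B c) \<and> (\<forall>c\<in>set (list_decode n). B c \<inter> K \<noteq> {})))"


section \<open>The algebra \<open>C(K)\<close> and the continuous functional calculus\<close>

text \<open>Functions on \<open>K\<close> are represented by their extensions by zero, so that \<open>C(K)\<close> is a
  *-subalgebra of \<^typ>\<open>complex \<Rightarrow> complex\<close>; its unit is the indicator function of \<open>K\<close>.\<close>

definition C_functions :: "complex set \<Rightarrow> (complex \<Rightarrow> complex) set" where
  "C_functions K = {f. continuous_on K f \<and> (\<forall>z. z \<notin> K \<longrightarrow> f z = 0)}"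

definition C_one :: "complex set \<Rightarrow> complex \<Rightarrow> complex" where
  "C_one K = (\<lambda>z. if z \<in> K then 1 else 0)"

definition C_id :: "complex set \<Rightarrow> complex \<Rightarrow> complex" where
  "C_id K = (\<lambda>z. if z \<in> K then z else 0)"

definition C_presentation :: "complex set \<Rightarrow> (complex \<Rightarrow> complex) presentation" where
  "C_presentation K = \<lparr>points = C_functions K, nrm = (\<lambda>f. SUP z\<in>K. cmod (f z)),
     num_special = 2, special = (\<lambda>i. if i = 0 then C_one K else C_id K)\<rparr>"

definition star_homomorphism_on ::
  "'a::complex_star_algebra set \<Rightarrow> ('a \<Rightarrow> 'b::complex_star_algebra) \<Rightarrow> bool" where
  "star_homomorphism_on S \<Phi> \<longleftrightarrow>
     (\<forall>x\<in>S. \<forall>y\<in>S. \<Phi> (x + y) = \<Phi> x + \<Phi> y \<and> \<Phi> (x * y) = \<Phi> x * \<Phi> y) \<and>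
     (\<forall>x\<in>S. (\<forall>c. \<Phi> (scaleC c x) = scaleC c (\<Phi> x)) \<and> \<Phi> (star x) = star (\<Phi> x))"

text \<open>\<open>functional_calculus a f\<close> is \<open>f(a)\<close>; extensionality makes the homomorphism unique
  as a function on the whole type.\<close>

definition functional_calculus ::
  "'a::unital_cstar_algebra \<Rightarrow> (complex \<Rightarrow> complex) \<Rightarrow> 'a" where
  "functional_calculus a = (THE \<Phi>. \<Phi> \<in> extensional (C_functions (spectrum a)) \<and>
     star_homomorphism_on (C_functions (spectrum a)) \<Phi> \<and>
     \<Phi> (C_one (spectrum a)) = 1 \<and> \<Phi> (C_id (spectrum a)) = a)"

end

theory Submission
  imports Defs
begin

text \<open>
  The norm of a polynomial in \<open>a\<close>, \<open>a\<^sup>*\<close> and the unit is the maximum of the corresponding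
  function of \<open>z\<close> and its conjugate on the spectrum (\<open>poly_pair_norm\<close>). This one fact yields
  the functional calculus, its computability and the computable compactness of the spectrum.

  \<^emph>\<open>The isometry.\<close> The bicommutant \<open>B\<close> of \<open>{a, a\<^sup>*}\<close> is a commutative subalgebra that
  contains the inverses of its invertible elements, so that an element of \<open>B\<close> which is not
  invertible lies in a proper ideal of \<open>B\<close>. For every proper ideal \<open>J\<close> and every \<open>b\<close> in
  \<open>B\<close> there is a number \<open>\<lambda>\<close> such that \<open>J\<close> and \<open>b - \<lambda>\<close> together lie in a
  proper ideal (\<open>extend_proper_ideal\<close>); this says that spectra in the quotient \<open>B / J\<close> are nonempty.
  Applied to \<open>a\<close> and to \<open>a\<^sup>*\<close>, it enlarges \<open>J\<close> to a proper ideal which contains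
  \<open>a - \<lambda>\<close> and \<open>a\<^sup>* - \<kappa>\<close>. The spectra of self-adjoint elements are real, whence
  \<open>\<kappa>\<close> is the conjugate of \<open>\<lambda>\<close> (\<open>joint_ideal_exists\<close>). Modulo this ideal a polynomial
  in \<open>a\<close> and \<open>a\<^sup>*\<close> equals its value at \<open>\<lambda>\<close>. These ideals play the role of
  characters and give the spectral mapping theorem. The norm of a normal element is attained by the
  modulus of a spectral value (\<open>normal_spectral_radius\<close>), and the isometry follows.

  Both the nonemptiness of spectra and the formula for the spectral radius come from a theorem on
  seminorms, \<open>power_seminorm_tendsto_0\<close>: if \<open>1 - z h\<close> is invertible up to elements of seminorm
  zero for all \<open>z\<close> in a disc of radius \<open>R\<close>, then \<open>t\<^sup>n q(h\<^sup>n)\<close> tends to zero for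
  \<open>t < R\<close>. In place of a Cauchy integral its proof averages the resolvent over the \<open>n\<close>-th
  roots of unity.

  \<^emph>\<open>The functional calculus.\<close> By the Stone-Weierstrass theorem the isometry extends to a
  *-homomorphism on \<open>C(K)\<close>, where \<open>K\<close> is the spectrum. Unital *-homomorphisms on \<open>C(K)\<close> are
  contractive, so it is the only one that sends the identity to \<open>a\<close>.

  \<^emph>\<open>Computability.\<close> Let \<open>p\<close> be a rational *-polynomial in the special points \<open>1\<close> and
  \<open>z\<close> of \<open>C(K)\<close>. Replacing these by generated points close to the unit and to \<open>a\<close> turns
  a code of \<open>p\<close> into a code of a generated point close to \<open>p(1, a)\<close>
  (\<open>computable_poly_approximation\<close>). The required precision can be read off from the code, because
  the code bounds the coefficients, the degrees and the number of the monomials. Applying this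
  translation to a name of \<open>f\<close> gives a name of \<open>f(a)\<close>, as the functional calculus is
  contractive.

  For a Gaussian rational \<open>\<lambda>\<close> and a large number \<open>C\<close>, the norm of
  \<open>C - (a - \<lambda>)\<^sup>* (a - \<lambda>)\<close> is the maximum of \<open>C - \<bar>z - \<lambda>\<bar>\<^sup>2\<close> on \<open>K\<close>,
  which is \<open>C - d(\<lambda>, K)\<^sup>2\<close>. Since this norm is computable, so is the distance of \<open>\<lambda>\<close>
  from the spectrum, and the required balls are centred at those points of a bounded set
  containing a fine grid which are found to be close to \<open>K\<close>.
\<close>

section \<open>C*-algebras: invertibility and the spectrum\<close>

context complex_star_algebra
begin

lemma scaleC_zero_left [simp]: "scaleC 0 x = 0"
  using scaleC_add_left[of 0 0 x] by simp

lemma scaleC_zero_right [simp]: "scaleC c 0 = 0"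
  using scaleC_add_right[of c 0 0] by simp

lemma scaleC_minus_left: "scaleC (- c) x = - scaleC c x"
  using scaleC_add_left[of c "- c" x] by (simp add: eq_neg_iff_add_eq_0 add.commute)

lemma scaleC_minus_right: "scaleC c (- x) = - scaleC c x"
  using scaleC_add_right[of c x "- x"] by (simp add: eq_neg_iff_add_eq_0 add.commute)

lemma scaleC_diff_left: "scaleC (c - d) x = scaleC c x - scaleC d x"
  using scaleC_add_left[of c "- d" x] by (simp add: scaleC_minus_left)

lemma scaleC_diff_right: "scaleC c (x - y) = scaleC c x - scaleC c y"
  using scaleC_add_right[of c x "- y"] by (simp add: scaleC_minus_right)

lemma star_zero [simp]: "star 0 = 0"
  using star_add[of 0 0] by simp

lemma star_minus: "star (- x) = - star x"
  using star_add[of x "- x"] by (simp add: eq_neg_iff_add_eq_0 add.commute)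

lemma star_diff: "star (x - y) = star x - star y"
  using star_add[of x "- y"] by (simp add: star_minus)

lemma scaleC_sum_left: "scaleC (\<Sum>i\<in>I. f i) x = (\<Sum>i\<in>I. scaleC (f i) x)"
  by (induction I rule: infinite_finite_induct) (auto simp: scaleC_add_left)

end

lemmas scaleC_algebra = scaleC_add_right scaleC_add_left scaleC_diff_left scaleC_diff_right
  scaleC_minus_left scaleC_minus_right mult_scaleC_left mult_scaleC_right scaleC_scaleC scaleC_one

lemma star_one [simp]: "star (1::'a::unital_cstar_algebra) = 1"
  using star_mult[of "star 1" "1::'a"] by (simp add: star_star)

text \<open>The C*-identity gives \<open>\<parallel>y\<parallel>\<^sup>2 \<le> \<parallel>y\<^sup>*\<parallel> \<parallel>y\<parallel>\<close>; the reverse estimate is the same one for \<open>y\<^sup>*\<close>.\<close>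

lemma norm_star [simp]: "norm (star x) = norm (x::'a::unital_cstar_algebra)"
proof -
  have le: "norm y \<le> norm (star y)" for y :: 'a
  proof (cases "y = 0")
    case False
    have "norm y * norm y \<le> norm (star y) * norm y"
      using cstar_identity[of y] norm_mult_ineq[of "star y" y] by (simp add: power2_eq_square)
    with False show ?thesis by simp
  qed simp
  show ?thesis using le[of x] le[of "star x"] by (simp add: star_star)
qed

lemma scaleC_power:
  "(scaleC c x) ^ n = scaleC (c ^ n) ((x::'a::unital_cstar_algebra) ^ n)"
  by (induction n) (simp_all add: scaleC_algebra mult.commute)

lemma bounded_linear_scaleC: "bounded_linear (scaleC c :: 'a::unital_cstar_algebra \<Rightarrow> 'a)"
  by (rule bounded_linear_intro[where K = "cmod c"])
    (simp_all add: scaleC_add_right scaleR_scaleC scaleC_scaleC mult.commute norm_scaleC)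

lemma bounded_linear_star: "bounded_linear (star :: 'a::unital_cstar_algebra \<Rightarrow> 'a)"
  by (rule bounded_linear_intro[where K = 1])
    (simp_all add: star_add scaleR_scaleC star_scaleC)

definition unit_element :: "'a::ring_1 \<Rightarrow> bool" where
  "unit_element x \<longleftrightarrow> (\<exists>y. y * x = 1 \<and> x * y = 1)"

lemma spectrum_iff: "l \<in> spectrum a \<longleftrightarrow> \<not> unit_element (a - scaleC l 1)"
  by (simp add: spectrum_def unit_element_def)

lemma unit_element_mult: "unit_element x \<Longrightarrow> unit_element y \<Longrightarrow> unit_element (x * y)"
  unfolding unit_element_def by (metis mult.assoc mult.left_neutral mult.right_neutral)

text \<open>The inverse is the Neumann series \<open>\<Sum>n. x\<^sup>n\<close>.\<close>

lemma unit_element_one_minus: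
  fixes x :: "'a::{real_normed_algebra_1,banach}"
  assumes "norm x < 1"
  shows "unit_element (1 - x)"
proof -
  define S where "S = (\<Sum>n. x ^ n)"
  have summ: "summable (\<lambda>n. x ^ n)"
    using assms by (rule complete_algebra_summable_geometric)
  have tail: "(\<Sum>n. x ^ Suc n) = S - 1"
    using suminf_split_head[OF summ] by (simp add: S_def)
  have "x * S = S - 1"
    using suminf_mult[OF summ, of x] tail by (simp add: S_def)
  moreover have "S * x = S - 1"
    using suminf_mult2[OF summ, of x] tail unfolding power_Suc2 by (simp add: S_def)
  ultimately show ?thesis
    unfolding unit_element_def by (intro exI[of _ S]) (simp add: algebra_simps)
qed

lemma unit_element_scaleC:
  assumes "c \<noteq> 0" "unit_element (x::'a::unital_cstar_algebra)"
  shows "unit_element (scaleC c x)"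
proof -
  obtain y where "y * x = 1" "x * y = 1" using assms(2) by (auto simp: unit_element_def)
  then show ?thesis
    unfolding unit_element_def using assms(1)
    by (intro exI[of _ "scaleC (inverse c) y"]) (simp add: scaleC_algebra)
qed

lemma spectrum_norm_le:
  assumes "l \<in> spectrum (a::'a::unital_cstar_algebra)"
  shows "cmod l \<le> norm a"
proof (rule ccontr)
  assume "\<not> ?thesis"
  then have less: "norm a < cmod l" by simp
  then have l: "l \<noteq> 0" by auto
  have "norm (scaleC (inverse l) a) < 1"
    using less l by (simp only: norm_scaleC norm_inverse) (simp add: field_simps)
  then have "unit_element (scaleC (- l) (1 - scaleC (inverse l) a))"
    using l by (intro unit_element_scaleC unit_element_one_minus) auto
  then show False
    using assms l by (simp add: spectrum_iff scaleC_algebra)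
qed

text \<open>Write \<open>y = x (1 - z (x - y))\<close>; the second factor is covered by the Neumann series.\<close>

lemma unit_element_near:
  fixes x y z :: "'a::{real_normed_algebra_1,banach}"
  assumes "z * x = 1" "x * z = 1" "norm z * norm (x - y) < 1"
  shows "unit_element y"
proof -
  have "norm (z * (x - y)) < 1"
    using assms(3) norm_mult_ineq[of z "x - y"] by simp
  then have "unit_element (x * (1 - z * (x - y)))"
    using assms(1,2) by (intro unit_element_mult unit_element_one_minus) (auto simp: unit_element_def)
  also have "x * (1 - z * (x - y)) = y"
    using assms(2) by (simp add: right_diff_distrib mult.assoc[symmetric])
  finally show ?thesis .
qed

lemma closed_spectrum: "closed (spectrum (a::'a::unital_cstar_algebra))"
proof -
  have "open (- spectrum a)"
    unfolding open_dist
  proof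
    fix l assume "l \<in> - spectrum a"
    then obtain z where z: "z * (a - scaleC l 1) = 1" "(a - scaleC l 1) * z = 1"
      by (auto simp: spectrum_iff unit_element_def)
    have "m \<in> - spectrum a" if "dist m l < 1 / (norm z + 1)" for m
    proof -
      have "cmod (m - l) < 1 / (norm z + 1)" "0 < norm z + 1"
        using that norm_ge_zero[of z] by (simp_all add: dist_norm add_nonneg_pos)
      then have "(norm z + 1) * cmod (m - l) < 1"
        by (metis mult.commute pos_less_divide_eq)
      then have "norm z * cmod (m - l) < 1"
        by (smt (verit) mult_right_mono norm_ge_zero)
      then have "unit_element (a - scaleC m 1)"
        using z by (intro unit_element_near[OF z])
          (simp add: scaleC_diff_left[symmetric] norm_scaleC)
      then show ?thesis by (simp add: spectrum_iff)
    qed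
    then show "\<exists>e>0. \<forall>m. dist m l < e \<longrightarrow> m \<in> - spectrum a"
      by (intro exI[of _ "1 / (norm z + 1)"]) (auto simp: add_nonneg_pos)
  qed
  then show ?thesis by (simp add: closed_def)
qed

lemma compact_spectrum: "compact (spectrum (a::'a::unital_cstar_algebra))"
  unfolding compact_eq_bounded_closed bounded_iff
  using closed_spectrum spectrum_norm_le by blast

text \<open>Moving a self-adjoint element along the imaginary axis by \<open>s\<close> increases its squared norm by
  at most \<open>s\<^sup>2\<close>, whereas a spectral value with imaginary part \<open>\<beta> \<noteq> 0\<close> would
  force a term \<open>2 \<beta> s\<close>, which is not bounded above.\<close>

lemma spectrum_self_adjoint_real:
  assumes sa: "star h = (h::'a::unital_cstar_algebra)" and l: "l \<in> spectrum h"
  shows "Im l = 0"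
proof (rule ccontr)
  assume nz: "Im l \<noteq> 0"
  have bound: "2 * Im l * s \<le> (norm h)\<^sup>2" for s
  proof -
    define x where "x = h + scaleC (\<i> * s) 1"
    have "l + \<i> * s \<in> spectrum x"
      using l by (simp add: spectrum_iff x_def scaleC_add_left)
    then have "(cmod (l + \<i> * s))\<^sup>2 \<le> (norm x)\<^sup>2"
      using spectrum_norm_le by (simp add: power_mono)
    also have "(norm x)\<^sup>2 = norm (star x * x)" by (simp add: cstar_identity)
    also have "star x * x = h * h + scaleC (s\<^sup>2) 1"
      by (simp add: x_def star_add star_scaleC sa scaleC_algebra algebra_simps power2_eq_square)
    also have "norm \<dots> \<le> norm (h * h) + norm (scaleC (complex_of_real (s\<^sup>2)) (1::'a))"
      by (rule norm_triangle_ineq)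
    also have "\<dots> \<le> (norm h)\<^sup>2 + s\<^sup>2"
      using norm_mult_ineq[of h h] by (simp add: norm_scaleC norm_power power2_eq_square[of "norm h"])
    finally have "(Re l)\<^sup>2 + (Im l + s)\<^sup>2 \<le> (norm h)\<^sup>2 + s\<^sup>2"
      by (simp add: cmod_power2)
    moreover have "(Im l + s)\<^sup>2 = (Im l)\<^sup>2 + 2 * Im l * s + s\<^sup>2"
      by (simp add: power2_eq_square algebra_simps)
    moreover have "0 \<le> (Re l)\<^sup>2 + (Im l)\<^sup>2" by simp
    ultimately show ?thesis by linarith
  qed
  have "2 * Im l * (((norm h)\<^sup>2 + 1) / (2 * Im l)) = (norm h)\<^sup>2 + 1"
    using nz by simp
  with bound[of "((norm h)\<^sup>2 + 1) / (2 * Im l)"] show False by linarith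
qed

section \<open>Resolvents for algebra seminorms\<close>

text \<open>The seminorm \<open>q\<close> is meant to be the norm of a quotient algebra, expressed on representatives:
  an equation in the quotient becomes an equation up to an element with \<open>q x = 0\<close>. This avoids
  forming the quotient as a type.\<close>

locale seminormed_subalgebra =
  fixes B :: "'a::unital_cstar_algebra set" and q :: "'a \<Rightarrow> real"
  assumes one_B: "1 \<in> B"
    and add_B: "x \<in> B \<Longrightarrow> y \<in> B \<Longrightarrow> x + y \<in> B"
    and mult_B: "x \<in> B \<Longrightarrow> y \<in> B \<Longrightarrow> x * y \<in> B"
    and scale_B: "x \<in> B \<Longrightarrow> scaleC c x \<in> B"
    and commute_B: "x \<in> B \<Longrightarrow> y \<in> B \<Longrightarrow> x * y = y * x"
    and q_add: "x \<in> B \<Longrightarrow> y \<in> B \<Longrightarrow> q (x + y) \<le> q x + q y"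
    and q_mult: "x \<in> B \<Longrightarrow> y \<in> B \<Longrightarrow> q (x * y) \<le> q x * q y"
    and q_scale: "x \<in> B \<Longrightarrow> q (scaleC c x) = cmod c * q x"
    and q_one: "q 1 = 1"
begin

lemma minus_B: "x \<in> B \<Longrightarrow> - x \<in> B"
  using scale_B[of x "-1"] by (simp add: scaleC_minus_left scaleC_one)

lemma diff_B: "x \<in> B \<Longrightarrow> y \<in> B \<Longrightarrow> x - y \<in> B"
  using add_B[of x "- y"] by (simp add: minus_B)

lemma zero_B: "0 \<in> B"
  using diff_B[OF one_B one_B] by simp

lemma power_B: "x \<in> B \<Longrightarrow> x ^ n \<in> B"
  by (induction n) (auto intro: one_B mult_B)

lemma sum_B: "(\<And>i. i \<in> I \<Longrightarrow> f i \<in> B) \<Longrightarrow> (\<Sum>i\<in>I. f i) \<in> B"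
  by (induction I rule: infinite_finite_induct) (auto intro: zero_B add_B)

lemmas B_intros = one_B zero_B add_B mult_B scale_B minus_B diff_B power_B sum_B

lemma q_zero: "q 0 = 0"
  using q_scale[OF one_B, of 0] by simp

lemma q_minus: "x \<in> B \<Longrightarrow> q (- x) = q x"
  using q_scale[of x "-1"] by (simp add: scaleC_minus_left scaleC_one)

lemma q_diff: "x \<in> B \<Longrightarrow> y \<in> B \<Longrightarrow> q (x - y) \<le> q x + q y"
  using q_add[of x "- y"] by (simp add: minus_B q_minus)

lemma q_nonneg: "x \<in> B \<Longrightarrow> 0 \<le> q x"
  using q_diff[of x x] q_zero by simp

lemma q_triangle: "x \<in> B \<Longrightarrow> y \<in> B \<Longrightarrow> z \<in> B \<Longrightarrow> q (x - z) \<le> q (x - y) + q (y - z)"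
  using q_add[of "x - y" "y - z"] by (simp add: diff_B)

lemma q_sum: "(\<And>i. i \<in> I \<Longrightarrow> f i \<in> B) \<Longrightarrow> q (\<Sum>i\<in>I. f i) \<le> (\<Sum>i\<in>I. q (f i))"
proof (induction I rule: infinite_finite_induct)
  case (insert i I)
  then show ?case using q_add[of "f i" "\<Sum>i\<in>I. f i"] by (simp add: sum_B)
qed (simp_all add: q_zero)

lemma q_power: "x \<in> B \<Longrightarrow> q (x ^ n) \<le> q x ^ n"
proof (induction n)
  case (Suc n)
  then show ?case
    using q_mult[of x "x ^ n"] mult_left_mono[of "q (x ^ n)" "q x ^ n" "q x"] q_nonneg[of x]
    by (simp add: power_B)
qed (simp add: q_one)

lemma q_le_near: "x \<in> B \<Longrightarrow> y \<in> B \<Longrightarrow> q x \<le> q y + q (x - y)"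
  using q_add[of y "x - y"] by (simp add: diff_B)

end

lemma one_minus_mult_geometric: "(1 - x) * (\<Sum>m<n. x ^ m) = 1 - (x::'a::ring_1) ^ n"
proof (induction n)
  case (Suc n)
  then show ?case by (simp add: distrib_left) (simp add: left_diff_distrib)
qed simp

lemma sum_root_unity_powers:
  assumes "m < n"
  shows "(\<Sum>k<n. (exp (2 * of_real pi * \<i> / of_nat n) ^ k) ^ m) =
    (if m = 0 then of_nat n else (0::complex))"
proof (cases "m = 0")
  case False
  define w where "w = exp (2 * of_real pi * \<i> / of_nat n)"
  have w: "w ^ j = exp (2 * of_real pi * \<i> * of_nat j / of_nat n)" for j
    by (simp add: w_def exp_of_nat_mult[symmetric] mult_ac)
  have "w ^ m \<noteq> 1"
    using complex_root_unity_eq[of n m 0] assms False by (simp add: w)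
  moreover have "(w ^ m) ^ n = 1"
    using complex_root_unity[of n 1] assms
    by (simp add: w_def power_mult[symmetric] mult.commute[of m n]) (simp add: power_mult)
  ultimately have "(\<Sum>k<n. (w ^ m) ^ k) = 0"
    by (simp add: geometric_sum)
  then show ?thesis using False by (simp add: w_def power_mult[symmetric] mult.commute)
qed simp

context seminormed_subalgebra
begin

text \<open>This is the resolvent identity \<open>u - v = (z - w) h u v\<close>, which holds here up to an element of
  seminorm zero.\<close>

lemma resolvent_difference:
  assumes h: "h \<in> B" and u: "u \<in> B" "q ((1 - scaleC z h) * u - 1) = 0"
    and v: "v \<in> B" "q ((1 - scaleC w h) * v - 1) = 0"
  shows "q (u - v) \<le> cmod (z - w) * (q h * q u * q v)"
proof -
  define j where "j = (1 - scaleC z h) * u - 1"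
  define k where "k = (1 - scaleC w h) * v - 1"
  have j: "j \<in> B" "q j = 0" and k: "k \<in> B" "q k = 0"
    using h u v by (auto simp: j_def k_def intro!: B_intros)
  have "v * u = u * v" "u * (h * v) = h * (u * v)" "v * (h * u) = h * (u * v)"
    using h u v by (simp_all add: commute_B mult.assoc[symmetric])
      (simp_all add: commute_B mult.assoc B_intros)
  then have "u - v = scaleC (z - w) (h * u * v) - u * k + v * j"
    unfolding j_def k_def by (simp add: algebra_simps scaleC_algebra)
  also have "q \<dots> \<le> q (scaleC (z - w) (h * u * v)) + q (u * k) + q (v * j)"
    using h u v j k
    by (intro order.trans[OF q_add] add_mono order.trans[OF q_diff]) (auto intro!: B_intros)
  also have "q (u * k) = 0"
    using q_mult[of u k] q_nonneg[of "u * k"] u k by (simp add: mult_B)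
  also have "q (v * j) = 0"
    using q_mult[of v j] q_nonneg[of "v * j"] v j by (simp add: mult_B)
  also have "q (scaleC (z - w) (h * u * v)) \<le> cmod (z - w) * (q h * q u * q v)"
  proof -
    have "q (h * u * v) \<le> q (h * u) * q v" using h u v by (intro q_mult mult_B)
    also have "\<dots> \<le> q h * q u * q v" using h u v by (intro mult_right_mono q_mult q_nonneg)
    finally show ?thesis using h u v by (simp add: q_scale mult_B mult_left_mono)
  qed
  finally show ?thesis by simp
qed

text \<open>By the resolvent identity the seminorm of \<open>u\<close> at most doubles within a small enough distance of
  any given point. As the disc is compact, finitely many such neighbourhoods cover it.\<close>

lemma resolvent_bounded:
  assumes h: "h \<in> B"
    and u: "\<And>z. cmod z \<le> R \<Longrightarrow> u z \<in> B \<and> q ((1 - scaleC z h) * u z - 1) = 0"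
  shows "\<exists>M>0. \<forall>z. cmod z \<le> R \<longrightarrow> q (u z) \<le> M"
proof -
  define d where "d w = 1 / (2 * (q h * q (u w) + 1))" for w
  have uB: "u z \<in> B" if "cmod z \<le> R" for z using u[OF that] by simp
  have pos: "0 < q h * q (u w) + 1" if "cmod w \<le> R" for w
    using h uB[OF that] q_nonneg by (simp add: add_nonneg_pos)
  have local: "q (u z) \<le> 2 * q (u w)" if zw: "cmod z \<le> R" "cmod w \<le> R" "dist w z < d w" for z w
  proof -
    have le: "q (u z - u w) \<le> cmod (z - w) * (q h * q (u z) * q (u w))"
      using resolvent_difference[OF h] u zw by blast
    have "cmod (z - w) < 1 / (2 * (q h * q (u w) + 1))"
      using zw(3) by (simp add: dist_norm norm_minus_commute d_def)
    then have "cmod (z - w) * (2 * (q h * q (u w) + 1)) < 1"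
      using pos[OF zw(2)] by (metis pos_less_divide_eq zero_less_mult_iff zero_less_numeral)
    moreover have "x * (2 * (g + 1)) < 1 \<Longrightarrow> 0 \<le> x \<Longrightarrow> x * g \<le> 1 / 2" for x g :: real
      by (simp add: algebra_simps)
    ultimately have "cmod (z - w) * (q h * q (u w)) \<le> 1 / 2" by simp
    then have "cmod (z - w) * (q h * q (u w)) * q (u z) \<le> 1 / 2 * q (u z)"
      using q_nonneg[OF uB[OF zw(1)]] by (rule mult_right_mono)
    then have "q (u z - u w) \<le> q (u z) / 2"
      using le by (simp add: mult_ac)
    then show ?thesis using q_le_near[OF uB[OF zw(1)] uB[OF zw(2)]] by linarith
  qed
  have "cball 0 R \<subseteq> (\<Union>w\<in>cball 0 R. ball w (d w))"
  proof
    fix w :: complex assume "w \<in> cball 0 R"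
    moreover from this have "w \<in> ball w (d w)" using pos[of w] by (simp add: d_def)
    ultimately show "w \<in> (\<Union>w\<in>cball 0 R. ball w (d w))" by blast
  qed
  then obtain C where C: "C \<subseteq> cball 0 R" "finite C" "cball 0 R \<subseteq> (\<Union>w\<in>C. ball w (d w))"
    using compactE_image[of "cball (0::complex) R" "cball 0 R" "\<lambda>w. ball w (d w)"] by auto
  have nn: "0 \<le> 2 * q (u w)" if "w \<in> C" for w
    using q_nonneg[OF uB] C(1) that by auto
  have "q (u z) \<le> 1 + (\<Sum>w\<in>C. 2 * q (u w))" if z: "cmod z \<le> R" for z
  proof -
    obtain w where w: "w \<in> C" "dist w z < d w" using C(3) z by (auto simp: subset_iff)
    then have "q (u z) \<le> 2 * q (u w)" using local z C(1) by auto
    also have "\<dots> \<le> (\<Sum>w\<in>C. 2 * q (u w))"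
      by (rule member_le_sum[OF w(1) _ C(2)]) (use nn in auto)
    finally show ?thesis by simp
  qed
  then show ?thesis
    using sum_nonneg[of C "\<lambda>w. 2 * q (u w)"] nn by (intro exI[of _ "1 + (\<Sum>w\<in>C. 2 * q (u w))"]) auto
qed

text \<open>For an \<open>n\<close>-th root of unity \<open>\<omega>\<close>, the element \<open>1 - t\<^sup>n h\<^sup>n\<close> is the product of
  \<open>1 - \<omega> t h\<close> and \<open>\<Sum>m<n. (\<omega> t h)\<^sup>m\<close>. Multiplying it by the average of the resolvents over all
  \<open>\<omega>\<close> gives the average of these geometric sums; all their terms cancel except for \<open>m = 0\<close>.\<close>

lemma resolvent_average:
  fixes n :: nat and t :: real
  defines "w \<equiv> exp (2 * of_real pi * \<i> / of_nat n)"
  defines "U \<equiv> \<lambda>u::complex \<Rightarrow> 'a. scaleC (1 / of_nat n) (\<Sum>k<n. u (w ^ k * of_real t))"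
  assumes h: "h \<in> B" and n: "0 < n" and t: "0 \<le> t" "t \<le> R"
    and u: "\<And>z. cmod z \<le> R \<Longrightarrow> u z \<in> B \<and> q ((1 - scaleC z h) * u z - 1) = 0"
  shows "q ((1 - scaleC (of_real t ^ n) (h ^ n)) * U u - 1) = 0"
proof -
  define z where "z k = w ^ k * of_real t" for k
  define G where "G k = (\<Sum>m<n. scaleC (z k) h ^ m)" for k
  define D where "D k = (1 - scaleC (of_real t ^ n) (h ^ n)) * u (z k) - G k" for k
  have wn: "w ^ n = 1"
    using complex_root_unity[of n 1] n by (simp add: w_def)
  have nw: "cmod w = 1" by (simp add: w_def)
  have zR: "cmod (z k) \<le> R" for k using t nw by (simp add: z_def norm_mult norm_power)
  have uB: "u (z k) \<in> B" and uz: "q ((1 - scaleC (z k) h) * u (z k) - 1) = 0" for k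
    using u[OF zR] by auto
  have zn: "z k ^ n = of_real t ^ n" for k
    by (simp add: z_def power_mult_distrib power_mult[symmetric] mult.commute[of k n])
      (simp add: power_mult wn)
  have GB: "G k \<in> B" for k unfolding G_def using h by (intro B_intros)
  have DB: "D k \<in> B" for k unfolding D_def using h uB GB by (intro B_intros)
  have "q (D k) = 0" for k
  proof -
    have "1 - scaleC (of_real t ^ n) (h ^ n) = (1 - scaleC (z k) h) * G k"
      by (simp only: G_def one_minus_mult_geometric) (simp add: scaleC_power zn)
    also have "\<dots> = G k * (1 - scaleC (z k) h)"
      using h GB by (intro commute_B B_intros)
    finally have "D k = G k * ((1 - scaleC (z k) h) * u (z k) - 1)"
      by (simp only: D_def right_diff_distrib[of "G k" "(1 - scaleC (z k) h) * u (z k)" 1]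
          mult.assoc mult_1_right)
    then show ?thesis
      using q_mult[of "G k" "(1 - scaleC (z k) h) * u (z k) - 1"] q_nonneg[OF DB, of k] GB h uB uz
      by (simp add: B_intros)
  qed
  then have "q (\<Sum>k<n. D k) \<le> 0" using q_sum[of "{..<n}" D] DB by simp
  then have qD: "q (\<Sum>k<n. D k) = 0" using q_nonneg[OF sum_B[of "{..<n}" D]] DB by (simp add: antisym)
  have "(\<Sum>k<n. G k) = (\<Sum>m<n. \<Sum>k<n. scaleC ((w ^ k) ^ m * of_real t ^ m) (h ^ m))"
    unfolding G_def
    by (subst sum.swap) (simp add: scaleC_power z_def power_mult_distrib)
  also have "\<dots> = (\<Sum>m<n. scaleC ((\<Sum>k<n. (w ^ k) ^ m) * of_real t ^ m) (h ^ m))"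
    by (simp add: scaleC_sum_left sum_distrib_right)
  also have "\<dots> = (\<Sum>m<n. if m = 0 then scaleC (of_nat n) 1 else 0)"
    by (intro sum.cong refl) (simp add: w_def sum_root_unity_powers)
  also have "\<dots> = scaleC (of_nat n) 1" using n by (simp add: sum.delta)
  finally have "scaleC (1 / of_nat n) (\<Sum>k<n. G k) = 1"
    using n by (simp add: scaleC_algebra)
  then have "(1 - scaleC (of_real t ^ n) (h ^ n)) * U u - 1 = scaleC (1 / of_nat n) (\<Sum>k<n. D k)"
    by (simp add: U_def D_def sum_subtractf scaleC_diff_right mult_scaleC_right sum_distrib_left z_def)
  then show ?thesis using qD DB by (simp add: q_scale sum_B)
qed

text \<open>The averages \<open>U n t\<close> invert \<open>1 - t\<^sup>n h\<^sup>n\<close>, and they satisfy a Lipschitz condition in \<open>t\<close>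
  with a constant \<open>L\<close> that does not depend on \<open>n\<close>. If \<open>t\<^sup>n q(h\<^sup>n)\<close> tends to zero, then \<open>U n t\<close>
  is eventually close to the unit, hence so is \<open>U n t'\<close> for \<open>t'\<close> within a distance that depends
  on \<open>L\<close> only. That bounds the numbers \<open>t'\<^sup>n q(h\<^sup>n)\<close> and makes them tend to zero for every smaller
  value of \<open>t'\<close>. Finitely many such steps lead from \<open>0\<close> to any \<open>t < R\<close>.\<close>

theorem power_seminorm_tendsto_0:
  assumes h: "h \<in> B"
    and res: "\<And>z. cmod z \<le> R \<Longrightarrow> \<exists>u\<in>B. q ((1 - scaleC z h) * u - 1) = 0"
    and t: "0 \<le> t" "t < R"
  shows "(\<lambda>n. t ^ n * q (h ^ n)) \<longlonglongrightarrow> 0"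
proof -
  obtain u where u: "\<And>z. cmod z \<le> R \<Longrightarrow> u z \<in> B \<and> q ((1 - scaleC z h) * u z - 1) = 0"
    using res by metis
  obtain M where M: "0 < M" "\<And>z. cmod z \<le> R \<Longrightarrow> q (u z) \<le> M"
    using resolvent_bounded[OF h u] by blast
  define L where "L = q h * M * M"
  have L: "0 \<le> L" using M q_nonneg[OF h] by (simp add: L_def)
  define U where "U n s = scaleC (1 / of_nat n)
    (\<Sum>k<n. u (exp (2 * of_real pi * \<i> / of_nat n) ^ k * of_real s))" for n :: nat and s :: real
  have disc: "cmod (exp (2 * of_real pi * \<i> / of_nat n) ^ k * of_real s) \<le> R"
    if "0 \<le> s" "s \<le> R" for n k :: nat and s :: real
    using that by (simp add: norm_mult norm_power)
  have UB: "U n s \<in> B" if "0 \<le> s" "s \<le> R" for n s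
    unfolding U_def using disc[OF that] u by (intro B_intros) blast
  have U1: "q ((1 - scaleC (of_real s ^ n) (h ^ n)) * U n s - 1) = 0"
    if "0 \<le> s" "s \<le> R" "0 < n" for n s
    unfolding U_def using resolvent_average[OF h] that u by blast
  have UM: "q (U n s) \<le> M" if s: "0 \<le> s" "s \<le> R" and n: "0 < n" for n s
  proof -
    have "q (\<Sum>k<n. u (exp (2 * of_real pi * \<i> / of_nat n) ^ k * of_real s))
        \<le> (\<Sum>k<n. q (u (exp (2 * of_real pi * \<i> / of_nat n) ^ k * of_real s)))"
      using disc[OF s] u by (intro q_sum) blast
    also have "\<dots> \<le> (\<Sum>k<n. M)" by (intro sum_mono M disc s)
    finally show ?thesis
      using n disc[OF s] u by (simp add: U_def q_scale sum_B norm_divide field_simps)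
  qed
  have UL: "q (U n s - U n r) \<le> L * \<bar>s - r\<bar>"
    if s: "0 \<le> s" "s \<le> R" and r: "0 \<le> r" "r \<le> R" and n: "0 < n" for n s r
  proof -
    define w where "w = exp (2 * of_real pi * \<i> / of_nat n)"
    have one: "q (u (w ^ k * of_real s) - u (w ^ k * of_real r)) \<le> L * \<bar>s - r\<bar>" for k
    proof -
      let ?z = "w ^ k * of_real s" and ?y = "w ^ k * of_real r"
      have d: "cmod ?z \<le> R" "cmod ?y \<le> R"
        using disc[OF s, of n k] disc[OF r, of n k] by (simp_all add: w_def)
      have "cmod w = 1" by (simp add: w_def)
      then have cm: "cmod (?z - ?y) = \<bar>s - r\<bar>"
        unfolding right_diff_distrib[symmetric] of_real_diff[symmetric] norm_mult norm_power
        by (simp del: of_real_diff)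
      have "q h * q (u ?z) * q (u ?y) \<le> L"
        unfolding L_def using u[OF d(1)] u[OF d(2)] M(2)[OF d(1)] M(2)[OF d(2)] M(1) h
        by (intro mult_mono mult_nonneg_nonneg q_nonneg) auto
      then have "\<bar>s - r\<bar> * (q h * q (u ?z) * q (u ?y)) \<le> \<bar>s - r\<bar> * L"
        by (intro mult_left_mono) auto
      then show ?thesis
        using resolvent_difference[OF h, of "u ?z" ?z "u ?y" ?y] u[OF d(1)] u[OF d(2)]
        unfolding cm by (simp add: mult.commute)
    qed
    have B: "u (w ^ k * of_real s) \<in> B" "u (w ^ k * of_real r) \<in> B" for k
      using u disc[OF s, of n k] disc[OF r, of n k] by (simp_all add: w_def)
    have "U n s - U n r =
        scaleC (1 / of_nat n) (\<Sum>k<n. u (w ^ k * of_real s) - u (w ^ k * of_real r))"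
      by (simp add: U_def w_def sum_subtractf scaleC_diff_right)
    also have "q \<dots> = 1 / of_nat n * q (\<Sum>k<n. u (w ^ k * of_real s) - u (w ^ k * of_real r))"
      using B by (subst q_scale) (auto intro!: B_intros simp: norm_divide)
    also have "\<dots> \<le> 1 / of_nat n * (\<Sum>k<n. q (u (w ^ k * of_real s) - u (w ^ k * of_real r)))"
      using B by (intro mult_left_mono q_sum) (auto intro!: B_intros)
    also have "\<dots> \<le> 1 / of_nat n * (\<Sum>k<n. L * \<bar>s - r\<bar>)"
      by (intro mult_left_mono sum_mono one) auto
    also have "\<dots> = L * \<bar>s - r\<bar>" using n by simp
    finally show ?thesis .
  qed
  have step: "(\<lambda>n. r ^ n * q (h ^ n)) \<longlonglongrightarrow> 0"
    if lim: "(\<lambda>n. s ^ n * q (h ^ n)) \<longlonglongrightarrow> 0" and s: "0 \<le> s" "s \<le> s'" "s' \<le> R"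
      and small: "L * (s' - s) \<le> 1 / 4" and r: "0 \<le> r" "r < s'" for s s' r
  proof -
    have "\<forall>\<^sub>F n in sequentially. s ^ n * q (h ^ n) < 1 / (4 * M)"
      using lim M(1) by (intro order_tendstoD(2)) auto
    then have "\<forall>\<^sub>F n in sequentially. s' ^ n * q (h ^ n) \<le> 1"
      using eventually_gt_at_top[of 0]
    proof eventually_elim
      case (elim n)
      define y where "y = scaleC (of_real s ^ n) (h ^ n)"
      define x where "x = scaleC (of_real s' ^ n) (h ^ n)"
      define V where "V = U n s"
      define W where "W = U n s'"
      have B: "y \<in> B" "x \<in> B" "V \<in> B" "W \<in> B"
        using h UB s by (auto simp: y_def x_def V_def W_def intro!: B_intros)
      have qy: "q y = s ^ n * q (h ^ n)" and qx: "q x = s' ^ n * q (h ^ n)"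
        using h s by (simp_all add: y_def x_def q_scale B_intros norm_power)
      have V: "q ((1 - y) * V - 1) = 0" and W: "q ((1 - x) * W - 1) = 0"
        using U1 s elim by (simp_all add: y_def x_def V_def W_def)
      \<comment> \<open>At \<open>s\<close>: \<open>V - 1 = y V\<close> up to seminorm zero, and \<open>q y\<close> is small.\<close>
      have "V - 1 = ((1 - y) * V - 1) + y * V" by (simp add: algebra_simps)
      then have "q (V - 1) \<le> q ((1 - y) * V - 1) + q (y * V)"
        using B by (metis q_add B_intros(1,4,7))
      also have "\<dots> \<le> q y * q V" using V q_mult[of y V] B by simp
      also have "\<dots> \<le> 1 / (4 * M) * M"
        using elim UM[of s n] s B q_nonneg M(1) unfolding qy[symmetric] V_def
        by (intro mult_mono) auto
      finally have V1: "q (V - 1) \<le> 1 / 4" using M(1) by simp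
      have "q (W - V) \<le> L * \<bar>s' - s\<bar>"
        unfolding V_def W_def using s elim by (intro UL) auto
      then have "q (W - V) \<le> 1 / 4" using small s by simp
      then have W1: "q (W - 1) \<le> 1 / 2"
        using V1 q_triangle[of W V 1] B one_B by simp
      \<comment> \<open>At \<open>s'\<close>: \<open>x = (W - 1) - x (W - 1)\<close> up to seminorm zero, whence \<open>q x \<le> 1 / 2 + q x / 2\<close>.\<close>
      have "x = - ((1 - x) * W - 1) + (W - 1) - x * (W - 1)" by (simp add: algebra_simps)
      then have "q x \<le> q (- ((1 - x) * W - 1)) + q (W - 1) + q (x * (W - 1))"
        using q_diff[of "- ((1 - x) * W - 1) + (W - 1)" "x * (W - 1)"]
          q_add[of "- ((1 - x) * W - 1)" "W - 1"] B by (simp add: B_intros)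
      also have "\<dots> \<le> 1 / 2 + q x * (1 / 2)"
      proof -
        have "q (- ((1 - x) * W - 1)) = 0" using W B by (subst q_minus) (auto intro!: B_intros)
        moreover have "q (x * (W - 1)) \<le> q x * q (W - 1)" using B by (intro q_mult B_intros)
        moreover have "q x * q (W - 1) \<le> q x * (1 / 2)"
          using W1 B by (intro mult_left_mono q_nonneg)
        ultimately show ?thesis using W1 by linarith
      qed
      finally show ?case unfolding qx by simp
    qed
    then have "\<forall>\<^sub>F n in sequentially. norm (r ^ n * q (h ^ n)) \<le> (r / s') ^ n"
    proof eventually_elim
      case (elim n)
      have s': "0 < s'" using r by simp
      have "r ^ n * q (h ^ n) = (r / s') ^ n * (s' ^ n * q (h ^ n))"
        using s' by (simp add: power_divide)
      also have "\<dots> \<le> (r / s') ^ n * 1"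
        using elim r s' by (intro mult_left_mono) auto
      finally show ?case using r q_nonneg[OF power_B[OF h]] by simp
    qed
    moreover have "(\<lambda>n. (r / s') ^ n) \<longlonglongrightarrow> 0"
      using r by (intro LIMSEQ_power_zero) auto
    ultimately show ?thesis by (rule Lim_null_comparison)
  qed
  \<comment> \<open>Each step proves the limit one step width \<open>d\<close> further, at the cost of looking \<open>2 d\<close> ahead: this
    must stay within the Lipschitz range and, for the last step, within the disc.\<close>
  define d0 where "d0 = min (1 / (8 * (L + 1))) (R - t)"
  have d0: "0 < d0" using L t by (simp add: d0_def)
  obtain K :: nat where K: "t / d0 < K" using reals_Archimedean2 by blast
  then have K0: "0 < K" using t d0 by (cases K) (auto simp: field_simps)
  define d where "d = t / K"
  have d: "0 \<le> d" "d \<le> d0" using K K0 t d0 by (simp_all add: d_def field_simps)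
  have Ld: "L * (2 * d) \<le> 1 / 4"
  proof -
    have "L * (2 * d) \<le> (L + 1) * (2 * (1 / (8 * (L + 1))))"
      using d L by (intro mult_mono) (auto simp: d0_def)
    also have "\<dots> = 1 / 4" using L by (simp add: field_simps)
    finally show ?thesis .
  qed
  show ?thesis
  proof (cases "t = 0")
    case True
    have "\<forall>\<^sub>F n in sequentially. t ^ n * q (h ^ n) = 0"
      using eventually_gt_at_top[of 0] by eventually_elim (simp add: True)
    then show ?thesis by (simp add: tendsto_eventually)
  next
    case False
    then have dpos: "0 < d" using t K0 by (simp add: d_def)
    have "k \<le> K \<Longrightarrow> (\<lambda>n. (real k * d) ^ n * q (h ^ n)) \<longlonglongrightarrow> 0" for k
    proof (induction k)
      case 0
      have "\<forall>\<^sub>F n in sequentially. (real 0 * d) ^ n * q (h ^ n) = 0"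
        using eventually_gt_at_top[of 0] by eventually_elim simp
      then show ?case by (simp add: tendsto_eventually)
    next
      case (Suc k)
      have "real (Suc k) * d \<le> real K * d" using Suc.prems d by (intro mult_right_mono) auto
      then have "real (Suc k) * d \<le> t" using K0 by (simp add: d_def)
      moreover have "d \<le> R - t" using d by (simp add: d0_def)
      ultimately have R: "(real k + 2) * d \<le> R" by (simp add: distrib_right)
      show ?case
        by (rule step[where s = "real k * d" and s' = "(real k + 2) * d"])
          (use Suc R Ld dpos in \<open>auto simp: distrib_right\<close>)
    qed
    from this[of K] show ?thesis using K0 by (simp add: d_def)
  qed
qed

end


section \<open>Ideals of inverse-closed commutative subalgebras\<close>

text \<open>Because \<open>B\<close> contains the inverses of its elements, invertibility within \<open>B\<close> and in the whole
  algebra agree, and spectra may be computed in \<open>B\<close>.\<close>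

locale inverse_closed_subalgebra =
  fixes B :: "'a::unital_cstar_algebra set"
  assumes one_in: "1 \<in> B"
    and add_in: "x \<in> B \<Longrightarrow> y \<in> B \<Longrightarrow> x + y \<in> B"
    and mult_in: "x \<in> B \<Longrightarrow> y \<in> B \<Longrightarrow> x * y \<in> B"
    and scale_in: "x \<in> B \<Longrightarrow> scaleC c x \<in> B"
    and commute: "x \<in> B \<Longrightarrow> y \<in> B \<Longrightarrow> x * y = y * x"
    and inverse_in: "x \<in> B \<Longrightarrow> y * x = 1 \<Longrightarrow> x * y = 1 \<Longrightarrow> y \<in> B"
begin

definition proper_ideal :: "'a set \<Rightarrow> bool" where
  "proper_ideal J \<longleftrightarrow> J \<subseteq> B \<and> 0 \<in> J \<and> (\<forall>x\<in>J. \<forall>y\<in>J. x + y \<in> J) \<and>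
     (\<forall>x\<in>B. \<forall>y\<in>J. x * y \<in> J) \<and> 1 \<notin> J"

lemma minus_in: "x \<in> B \<Longrightarrow> - x \<in> B"
  using scale_in[of x "-1"] by (simp add: scaleC_minus_left scaleC_one)

lemma diff_in: "x \<in> B \<Longrightarrow> y \<in> B \<Longrightarrow> x - y \<in> B"
  using add_in[of x "- y"] by (simp add: minus_in)

lemma zero_in: "0 \<in> B"
  using diff_in[OF one_in one_in] by simp

lemma power_in: "x \<in> B \<Longrightarrow> x ^ n \<in> B"
  by (induction n) (auto intro: one_in mult_in)

lemmas in_intros = one_in zero_in add_in mult_in scale_in minus_in diff_in power_in

context
  fixes J assumes J: "proper_ideal J"
begin

lemma ideal_subset: "x \<in> J \<Longrightarrow> x \<in> B" using J by (auto simp: proper_ideal_def)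
lemma ideal_zero: "0 \<in> J" using J by (simp add: proper_ideal_def)
lemma ideal_add: "x \<in> J \<Longrightarrow> y \<in> J \<Longrightarrow> x + y \<in> J" using J by (simp add: proper_ideal_def)
lemma ideal_mult_left: "x \<in> B \<Longrightarrow> y \<in> J \<Longrightarrow> x * y \<in> J" using J by (simp add: proper_ideal_def)
lemma ideal_mult_right: "y \<in> J \<Longrightarrow> x \<in> B \<Longrightarrow> y * x \<in> J"
  using ideal_mult_left[of x y] commute[of x y] ideal_subset by simp
lemma ideal_not_one: "1 \<notin> J" using J by (simp add: proper_ideal_def)

lemma ideal_scale: "x \<in> J \<Longrightarrow> scaleC c x \<in> J"
  using ideal_mult_left[OF scale_in[OF one_in], of x c] by (simp add: mult_scaleC_left)

lemma ideal_minus: "x \<in> J \<Longrightarrow> - x \<in> J"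
  using ideal_scale[of x "-1"] by (simp add: scaleC_minus_left scaleC_one)

lemma ideal_diff: "x \<in> J \<Longrightarrow> y \<in> J \<Longrightarrow> x - y \<in> J"
  using ideal_add[of x "- y"] by (simp add: ideal_minus)

lemma ideal_not_unit: "x \<in> J \<Longrightarrow> \<not> unit_element x"
  unfolding unit_element_def
  using ideal_mult_left inverse_in[of x] ideal_subset ideal_not_one by metis

lemma ideal_scalar: "scaleC c 1 \<in> J \<Longrightarrow> c = 0"
  using ideal_scale[of "scaleC c 1" "inverse c"] ideal_not_one
  by (cases "c = 0") (auto simp: scaleC_algebra)

lemma ideal_approx: "0 < e \<Longrightarrow> \<exists>j\<in>J. norm (x - j) < infdist x J + e"
proof -
  assume "0 < e"
  have "(INF j\<in>J. dist x j) < infdist x J + e"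
    using \<open>0 < e\<close> ideal_zero by (auto simp: infdist_def)
  then show ?thesis
    using ideal_zero by (subst (asm) cINF_less_iff) (auto simp: dist_norm intro!: bdd_belowI2[of _ 0])
qed

text \<open>The norm of the quotient algebra modulo \<open>J\<close>, seen on representatives. Its unit has norm
  one because an element closer than \<open>1\<close> to the unit is invertible.\<close>

lemma quotient_seminorm: "seminormed_subalgebra B (\<lambda>x. infdist x J)"
proof
  have le: "infdist x J \<le> r" if "\<And>e. 0 < e \<Longrightarrow> infdist x J \<le> r + e" for x r
    using that by (rule field_le_epsilon)
  show "infdist (x + y) J \<le> infdist x J + infdist y J" for x y
  proof (rule le)
    fix e :: real assume "0 < e"
    then obtain j k where jk: "j \<in> J" "norm (x - j) < infdist x J + e / 2"
      "k \<in> J" "norm (y - k) < infdist y J + e / 2"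
      using ideal_approx[of "e / 2"] by (metis half_gt_zero)
    have "infdist (x + y) J \<le> norm ((x - j) + (y - k))"
      using infdist_le[OF ideal_add[OF jk(1,3)], of "x + y"] by (simp add: dist_norm algebra_simps)
    also have "\<dots> \<le> infdist x J + infdist y J + e"
      using jk norm_triangle_ineq[of "x - j" "y - k"] by simp
    finally show "infdist (x + y) J \<le> infdist x J + infdist y J + e" .
  qed
  show "infdist (x * y) J \<le> infdist x J * infdist y J" if B: "x \<in> B" "y \<in> B" for x y
  proof (rule LIMSEQ_le_const)
    let ?f = "\<lambda>n::nat. (infdist x J + inverse (real (Suc n))) * (infdist y J + inverse (real (Suc n)))"
    have "?f \<longlonglongrightarrow> (infdist x J + 0) * (infdist y J + 0)"
      by (intro tendsto_intros LIMSEQ_inverse_real_of_nat)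
    then show "?f \<longlonglongrightarrow> infdist x J * infdist y J" by simp
    have "infdist (x * y) J \<le> (infdist x J + e) * (infdist y J + e)" if e: "0 < e" for e
    proof -
      obtain j k where jk: "j \<in> J" "norm (x - j) < infdist x J + e"
        "k \<in> J" "norm (y - k) < infdist y J + e"
        using ideal_approx[OF e] by metis
      have "j * y + x * k - j * k \<in> J"
        using jk B by (intro ideal_add ideal_diff ideal_mult_left ideal_mult_right)
          (auto intro: ideal_subset)
      then have "infdist (x * y) J \<le> norm (x * y - (j * y + x * k - j * k))"
        using infdist_le[of "j * y + x * k - j * k" J "x * y"] by (simp add: dist_norm)
      also have "\<dots> = norm ((x - j) * (y - k))" by (simp add: algebra_simps)
      also have "\<dots> \<le> norm (x - j) * norm (y - k)" by (rule norm_mult_ineq)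
      also have "\<dots> \<le> (infdist x J + e) * (infdist y J + e)"
        using jk e by (intro mult_mono) (auto simp: infdist_nonneg)
      finally show ?thesis .
    qed
    then show "\<exists>N. \<forall>n\<ge>N. infdist (x * y) J \<le> ?f n" by auto
  qed
  show "infdist (scaleC c x) J = cmod c * infdist x J" for c x
  proof -
    have half: "infdist (scaleC c x) J \<le> cmod c * infdist x J" for c x
    proof (rule LIMSEQ_le_const)
      let ?f = "\<lambda>n::nat. cmod c * (infdist x J + inverse (real (Suc n)))"
      have "?f \<longlonglongrightarrow> cmod c * (infdist x J + 0)"
        by (intro tendsto_intros LIMSEQ_inverse_real_of_nat)
      then show "?f \<longlonglongrightarrow> cmod c * infdist x J" by simp
      have "infdist (scaleC c x) J \<le> cmod c * (infdist x J + e)" if "0 < e" for e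
      proof -
        obtain j where j: "j \<in> J" "norm (x - j) < infdist x J + e"
          using ideal_approx[OF \<open>0 < e\<close>, of x] by blast
        have "infdist (scaleC c x) J \<le> norm (scaleC c x - scaleC c j)"
          using infdist_le[OF ideal_scale[OF j(1)]] by (simp add: dist_norm)
        also have "\<dots> = cmod c * norm (x - j)"
          by (simp add: scaleC_diff_right[symmetric] norm_scaleC)
        finally show ?thesis using j(2) by (meson less_imp_le mult_left_mono norm_ge_zero order.trans)
      qed
      then show "\<exists>N. \<forall>n\<ge>N. infdist (scaleC c x) J \<le> ?f n" by auto
    qed
    show ?thesis
    proof (cases "c = 0")
      case True
      then show ?thesis by (simp add: infdist_zero[OF ideal_zero])
    next
      case False
      have "infdist x J = infdist (scaleC (inverse c) (scaleC c x)) J"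
        using False by (simp add: scaleC_algebra)
      also have "\<dots> \<le> cmod (inverse c) * infdist (scaleC c x) J" by (rule half)
      finally have "cmod c * infdist x J \<le> infdist (scaleC c x) J"
        using False by (simp add: norm_divide field_simps)
      with half show ?thesis by (rule antisym)
    qed
  qed
  show "infdist 1 J = 1"
  proof (rule antisym)
    show "infdist 1 J \<le> 1" using infdist_le[OF ideal_zero, of 1] by simp
    show "1 \<le> infdist 1 J"
    proof (rule ccontr)
      assume "\<not> ?thesis"
      then obtain j where "j \<in> J" "norm (1 - j) < 1"
        using ideal_approx[of "1 - infdist 1 J" 1] by auto
      then show False using unit_element_one_minus[of "1 - j"] ideal_not_unit by auto
    qed
  qed
qed (auto intro: in_intros commute)

text \<open>The quotient by \<open>J\<close> has nonempty spectra: otherwise \<open>b\<close> would be invertible modulo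
  \<open>J\<close> with all of its powers, and the quotient norms of the powers \<open>b\<^sup>n\<close> would
  decrease faster than every geometric sequence.\<close>

theorem extend_proper_ideal:
  assumes b: "b \<in> B"
  shows "\<exists>l J'. proper_ideal J' \<and> J \<subseteq> J' \<and> b - scaleC l 1 \<in> J'"
proof -
  define E where "E l = {j + (b - scaleC l 1) * c | j c. j \<in> J \<and> c \<in> B}" for l
  have E: "proper_ideal (E l) \<and> J \<subseteq> E l \<and> b - scaleC l 1 \<in> E l" if "1 \<notin> E l" for l
  proof (intro conjI)
    have d: "b - scaleC l 1 \<in> B" using b by (intro in_intros)
    have "j + (b - scaleC l 1) * 0 \<in> E l" if "j \<in> J" for j
      unfolding E_def using that zero_in by blast
    then show "J \<subseteq> E l" by auto
    show "b - scaleC l 1 \<in> E l"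
      unfolding E_def using ideal_zero one_in by force
    have add: "x + y \<in> E l" if xy: "x \<in> E l" "y \<in> E l" for x y
    proof -
      obtain j c where x: "x = j + (b - scaleC l 1) * c" "j \<in> J" "c \<in> B"
        using xy(1) by (auto simp: E_def)
      obtain k e where y: "y = k + (b - scaleC l 1) * e" "k \<in> J" "e \<in> B"
        using xy(2) by (auto simp: E_def)
      have "x + y = (j + k) + (b - scaleC l 1) * (c + e)"
        by (simp add: x y distrib_left)
      then show ?thesis unfolding E_def using x y ideal_add add_in by blast
    qed
    have mult: "x * y \<in> E l" if xy: "x \<in> B" "y \<in> E l" for x y
    proof -
      obtain k e where y: "y = k + (b - scaleC l 1) * e" "k \<in> J" "e \<in> B"
        using xy(2) by (auto simp: E_def)
      have "x * y = x * k + (b - scaleC l 1) * (x * e)"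
        using commute[OF xy(1) d] by (simp add: y distrib_left mult.assoc[symmetric])
      then show ?thesis unfolding E_def using xy y ideal_mult_left mult_in by blast
    qed
    have "E l \<subseteq> B"
      unfolding E_def using d ideal_subset by (auto intro!: add_in mult_in[of "b - scaleC l 1"])
    moreover have "0 \<in> E l" using \<open>J \<subseteq> E l\<close> ideal_zero by blast
    ultimately show "proper_ideal (E l)"
      unfolding proper_ideal_def using add mult that by auto
  qed
  have "\<exists>l. 1 \<notin> E l"
  proof (rule ccontr)
    assume "\<not> ?thesis"
    then have all: "\<exists>j c. j \<in> J \<and> c \<in> B \<and> 1 = j + (b - scaleC l 1) * c" for l
      unfolding E_def by blast
    interpret seminormed_subalgebra B "\<lambda>x. infdist x J" by (rule quotient_seminorm)
    have "\<exists>u\<in>B. infdist ((1 - scaleC z b) * u - 1) J = 0" for z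
    proof (cases "z = 0")
      case True
      then show ?thesis using one_in by (intro bexI[of _ 1]) (simp_all add: infdist_zero ideal_zero)
    next
      case False
      obtain j c where j: "j \<in> J" "c \<in> B" "1 = j + (b - scaleC (inverse z) 1) * c"
        using all by metis
      have "(1 - scaleC z b) * scaleC (- inverse z) c - 1 = (b - scaleC (inverse z) 1) * c - 1"
        using False by (simp add: scaleC_algebra algebra_simps)
      also have "\<dots> = - j" using j(3) by (simp add: algebra_simps)
      finally have "infdist ((1 - scaleC z b) * scaleC (- inverse z) c - 1) J = 0"
        using ideal_minus[OF j(1)] by (simp add: infdist_zero)
      then show ?thesis using scale_in[OF j(2)] by blast
    qed
    then have lim: "(\<lambda>n. t ^ n * infdist (b ^ n) J) \<longlonglongrightarrow> 0" if "0 \<le> t" for t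
      using power_seminorm_tendsto_0[OF b, of "t + 1" t] that by simp
    \<comment> \<open>An inverse \<open>c\<close> of \<open>b\<close> modulo \<open>J\<close>: then \<open>1 \<le> q(c)\<^sup>n q(b\<^sup>n)\<close>, against the limit
      for \<open>t = q(c)\<close>.\<close>
    obtain j c where j: "j \<in> J" "c \<in> B" "1 = j + (b - scaleC 0 1) * c"
      using all by metis
    have inv: "\<exists>k\<in>J. 1 = k + b ^ n * c ^ n" for n
    proof (induction n)
      case 0
      show ?case using ideal_zero by (intro bexI[of _ 0]) simp_all
    next
      case (Suc n)
      then obtain k where k: "k \<in> J" "1 = k + b ^ n * c ^ n" by blast
      have "b ^ Suc n * c ^ Suc n = b * (b ^ n * c ^ n) * c"
        by (simp only: power_Suc[of b] power_Suc2[of c] mult.assoc)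
      also have "b ^ n * c ^ n = 1 - k" using k by (simp add: algebra_simps)
      also have "b * (1 - k) * c = (1 - j) - b * k * c"
        using j(3) by (simp add: algebra_simps)
      finally have "1 = (j + b * k * c) + b ^ Suc n * c ^ Suc n" by simp
      moreover have "j + b * k * c \<in> J"
        using j k b by (intro ideal_add ideal_mult_left ideal_mult_right)
      ultimately show ?case by blast
    qed
    have ge: "1 \<le> infdist c J ^ n * infdist (b ^ n) J" for n
    proof -
      obtain k where k: "k \<in> J" "1 = k + b ^ n * c ^ n" using inv by blast
      have "1 = infdist (k + b ^ n * c ^ n) J" using q_one k(2) by simp
      also have "\<dots> \<le> infdist k J + infdist (b ^ n * c ^ n) J"
        using k j b by (intro q_add mult_in power_in) (auto intro: ideal_subset)
      also have "\<dots> \<le> 0 + infdist (b ^ n) J * infdist (c ^ n) J"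
        using k j b by (intro add_mono q_mult power_in) (simp_all add: infdist_zero)
      also have "\<dots> \<le> infdist (b ^ n) J * infdist c J ^ n"
        using q_power[OF j(2)] by (simp add: mult_left_mono infdist_nonneg)
      finally show ?thesis by (simp add: mult.commute)
    qed
    have "\<forall>\<^sub>F n in sequentially. infdist c J ^ n * infdist (b ^ n) J < 1"
      using lim[OF infdist_nonneg] by (rule order_tendstoD(2)) simp
    then show False using ge by (auto simp: eventually_sequentially not_less[symmetric])
  qed
  then show ?thesis using E by blast
qed

end

end

section \<open>The joint spectrum of a normal element and its adjoint\<close>

definition commutant :: "'a::ring set \<Rightarrow> 'a set" where
  "commutant S = {y. \<forall>x\<in>S. x * y = y * x}"

lemma bicommutant_superset: "S \<subseteq> commutant (commutant S)"
  by (auto simp: commutant_def)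

text \<open>The inverse of \<open>x\<close> commutes with everything that commutes with \<open>x\<close>, so it stays in the
  bicommutant. The bicommutant is commutative, since a commuting set lies in its own commutant.\<close>

lemma inverse_closed_bicommutant:
  fixes S :: "'a::unital_cstar_algebra set"
  assumes comm: "\<And>x y. x \<in> S \<Longrightarrow> y \<in> S \<Longrightarrow> x * y = y * x"
  shows "inverse_closed_subalgebra (commutant (commutant S))"
proof
  have sub: "commutant (commutant S) \<subseteq> commutant S"
    using comm by (auto simp: commutant_def)
  fix x y :: 'a and c
  assume x: "x \<in> commutant (commutant S)"
  show "scaleC c x \<in> commutant (commutant S)"
    using x by (auto simp: commutant_def mult_scaleC_left mult_scaleC_right)
  show "y \<in> commutant (commutant S)" if y: "y * x = 1" "x * y = 1"
    unfolding commutant_def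
  proof safe
    fix z assume "\<forall>w\<in>S. w * z = z * w"
    then have z: "z * x = x * z" using x by (auto simp: commutant_def)
    have "z * y = y * x * z * y" using y by simp
    also have "\<dots> = y * (z * x) * y" by (simp add: z mult.assoc)
    also have "\<dots> = y * z" using y by (simp add: mult.assoc)
    finally show "z * y = y * z" .
  qed
  assume y: "y \<in> commutant (commutant S)"
  show "x * y = y * x" using x y sub by (auto simp: commutant_def)
  show "x + y \<in> commutant (commutant S)"
    using x y by (auto simp: commutant_def distrib_left distrib_right)
  show "x * y \<in> commutant (commutant S)"
    using x y unfolding commutant_def by (auto simp: mult.assoc) (metis mult.assoc)
qed (simp add: commutant_def)

lemma (in inverse_closed_subalgebra) principal_ideal:
  assumes x: "x \<in> B" and nu: "\<not> unit_element x"
  shows "proper_ideal ((\<lambda>c. c * x) ` B)"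
  unfolding proper_ideal_def
proof (intro conjI ballI)
  show "(\<lambda>c. c * x) ` B \<subseteq> B" using x mult_in by auto
  show "0 \<in> (\<lambda>c. c * x) ` B" using zero_in by (intro image_eqI[of _ _ 0]) auto
  show "1 \<notin> (\<lambda>c. c * x) ` B"
  proof
    assume "1 \<in> (\<lambda>c. c * x) ` B"
    then obtain c where "c \<in> B" "1 = c * x" by auto
    then have "unit_element x"
      using commute[of c x] x unfolding unit_element_def by (intro exI[of _ c]) simp
    with nu show False by simp
  qed
next
  fix y z assume "y \<in> (\<lambda>c. c * x) ` B" "z \<in> (\<lambda>c. c * x) ` B"
  then obtain c d where "c \<in> B" "d \<in> B" "y = c * x" "z = d * x" by auto
  then show "y + z \<in> (\<lambda>c. c * x) ` B"
    using add_in by (intro image_eqI[of _ _ "c + d"]) (auto simp: distrib_right)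
next
  fix y z assume y: "y \<in> B" "z \<in> (\<lambda>c. c * x) ` B"
  then obtain d where "d \<in> B" "z = d * x" by auto
  then show "y * z \<in> (\<lambda>c. c * x) ` B"
    using mult_in y by (intro image_eqI[of _ _ "y * d"]) (auto simp: mult.assoc)
qed

lemma (in inverse_closed_subalgebra) norm_seminorm: "seminormed_subalgebra B norm"
  by standard (auto intro: in_intros commute norm_triangle_ineq norm_mult_ineq simp: norm_scaleC)

text \<open>Apply the C*-identity to \<open>x x\<close> and to the self-adjoint element \<open>x\<^sup>* x\<close>; normality makes
  \<open>(x x)\<^sup>* (x x)\<close> the square of the latter.\<close>

lemma normal_norm_square:
  assumes "normal_element (x::'a::unital_cstar_algebra)"
  shows "norm (x * x) = (norm x)\<^sup>2" "normal_element (x * x)"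
proof -
  have n: "star x * x = x * star x" using assms by (simp add: normal_element_def)
  have "star (x * x) * (x * x) = star x * (star x * x) * x" by (simp add: star_mult mult.assoc)
  also have "\<dots> = star x * (x * star x) * x" by (simp only: n)
  also have "\<dots> = (star x * x) * (star x * x)" by (simp only: mult.assoc)
  finally have e: "star (x * x) * (x * x) = (star x * x) * (star x * x)" .
  have "(norm (x * x))\<^sup>2 = norm ((star x * x) * (star x * x))"
    by (simp only: cstar_identity[symmetric] e)
  also have "\<dots> = norm (star (star x * x) * (star x * x))" by (simp add: star_mult star_star)
  also have "\<dots> = ((norm x)\<^sup>2)\<^sup>2" by (simp only: cstar_identity)
  finally show "norm (x * x) = (norm x)\<^sup>2" by (rule power2_eq_imp_eq) auto
  have "(x * x) * star (x * x) = x * (x * star x) * star x" by (simp add: star_mult mult.assoc)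
  also have "\<dots> = x * (star x * x) * star x" by (simp only: n)
  also have "\<dots> = (x * star x) * (x * star x)" by (simp only: mult.assoc)
  finally show "normal_element (x * x)" by (simp add: normal_element_def e n)
qed

lemma normal_norm_power:
  assumes "normal_element (x::'a::unital_cstar_algebra)"
  shows "norm (x ^ (2 ^ m)) = norm x ^ (2 ^ m) \<and> normal_element (x ^ (2 ^ m))"
proof (induction m)
  case (Suc m)
  have "x ^ (2 ^ Suc m) = x ^ (2 ^ m) * x ^ (2 ^ m)"
    by (simp add: power_add[symmetric] mult_2)
  then show ?case
    using normal_norm_square[of "x ^ (2 ^ m)"] Suc by (simp add: power_mult[symmetric] mult.commute)
qed (simp add: assms)

text \<open>Were the spectrum contained in a disc of radius \<open>r < \<parallel>x\<parallel>\<close>, the powers of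
  \<open>x / \<parallel>x\<parallel>\<close> would tend to zero; but those with exponent \<open>2\<^sup>m\<close> have norm one.\<close>

lemma normal_spectral_radius:
  assumes n: "normal_element (x::'a::unital_cstar_algebra)"
  shows "\<exists>l\<in>spectrum x. norm x \<le> cmod l"
proof (rule ccontr)
  assume "\<not> ?thesis"
  then have less: "\<And>l. l \<in> spectrum x \<Longrightarrow> cmod l < norm x" by force
  have x0: "x \<noteq> 0"
  proof
    assume "x = 0"
    then have "0 \<in> spectrum x" by (simp add: spectrum_iff unit_element_def)
    with less \<open>x = 0\<close> show False by force
  qed
  obtain r where r: "0 \<le> r" "r < norm x" "\<And>l. l \<in> spectrum x \<Longrightarrow> cmod l \<le> r"
  proof (cases "spectrum x = {}")
    case True
    then show ?thesis using that[of 0] x0 by auto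
  next
    case False
    have "continuous_on (spectrum x) cmod" by (intro continuous_intros)
    then obtain l where "l \<in> spectrum x" "\<And>m. m \<in> spectrum x \<Longrightarrow> cmod m \<le> cmod l"
      using continuous_attains_sup[OF compact_spectrum False] by blast
    then show ?thesis using that[of "cmod l"] less by auto
  qed
  define s where "s = (r + norm x) / 2"
  have s: "r < s" "s < norm x" "0 < s" using r by (simp_all add: s_def)
  interpret inverse_closed_subalgebra "commutant (commutant {x})"
    by (rule inverse_closed_bicommutant) auto
  interpret seminormed_subalgebra "commutant (commutant {x})" norm
    by (rule norm_seminorm)
  have xB: "x \<in> commutant (commutant {x})" using bicommutant_superset by blast
  have "\<exists>u\<in>commutant (commutant {x}). norm ((1 - scaleC z x) * u - 1) = 0"
    if z: "cmod z \<le> 1 / s" for z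
  proof -
    have "unit_element (1 - scaleC z x)"
    proof (cases "z = 0")
      case True
      then show ?thesis by (auto simp: unit_element_def)
    next
      case False
      then have "s \<le> cmod (inverse z)"
        using z s by (simp add: norm_inverse norm_divide field_simps)
      then have "inverse z \<notin> spectrum x" using r(3) s by force
      then have "unit_element (scaleC (- z) (x - scaleC (inverse z) 1))"
        using False by (intro unit_element_scaleC) (auto simp: spectrum_iff)
      then show ?thesis using False by (simp add: scaleC_algebra)
    qed
    then obtain u where u: "u * (1 - scaleC z x) = 1" "(1 - scaleC z x) * u = 1"
      by (auto simp: unit_element_def)
    have "u \<in> commutant (commutant {x})"
      by (rule inverse_in[OF _ u]) (intro in_intros xB)
    then show ?thesis using u by (intro bexI[of _ u]) simp_all
  qed
  then have "(\<lambda>n. (1 / norm x) ^ n * norm (x ^ n)) \<longlonglongrightarrow> 0"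
    using s x0 by (intro power_seminorm_tendsto_0[OF xB, of "1 / s"]) (auto simp: field_simps)
  then have "\<forall>\<^sub>F n in sequentially. (1 / norm x) ^ n * norm (x ^ n) < 1"
    by (rule order_tendstoD(2)) simp
  then obtain N where N: "\<And>n. N \<le> n \<Longrightarrow> (1 / norm x) ^ n * norm (x ^ n) < 1"
    by (auto simp: eventually_sequentially)
  have "N \<le> 2 ^ N" using less_exp[of N] by linarith
  from N[OF this] show False
    using normal_norm_power[OF n, of N] x0 by (simp add: power_divide)
qed

locale normal_element_calculus =
  fixes a :: "'a::unital_cstar_algebra"
  assumes normal: "normal_element a"
begin

definition B :: "'a set" where "B = commutant (commutant {a, star a})"

sublocale inverse_closed_subalgebra B
  unfolding B_def using normal
  by (intro inverse_closed_bicommutant) (auto simp: normal_element_def)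

lemma a_in_B: "a \<in> B" "star a \<in> B"
  using bicommutant_superset[of "{a, star a}"] by (auto simp: B_def)

text \<open>A joint ideal for \<open>\<lambda>\<close> stands for a character of \<open>B\<close> that takes the value \<open>\<lambda>\<close> at
  \<open>a\<close>.\<close>

definition joint_ideal :: "'a set \<Rightarrow> complex \<Rightarrow> bool" where
  "joint_ideal J l \<longleftrightarrow> proper_ideal J \<and> a - scaleC l 1 \<in> J \<and> star a - scaleC (cnj l) 1 \<in> J"

text \<open>If \<open>a - \<lambda>\<close> and \<open>a\<^sup>* - \<kappa>\<close> lie in a proper ideal, so do the translates of the
  self-adjoint elements \<open>a + a\<^sup>*\<close> and \<open>i (a - a\<^sup>*)\<close> by \<open>\<lambda> + \<kappa>\<close> and
  \<open>i (\<lambda> - \<kappa>)\<close>. Both numbers are therefore real, that is, \<open>\<kappa>\<close> is the conjugate of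
  \<open>\<lambda>\<close>.\<close>

lemma joint_ideal_exists:
  assumes "proper_ideal J"
  shows "\<exists>J' l. joint_ideal J' l \<and> J \<subseteq> J'"
proof -
  obtain l J1 where J1: "proper_ideal J1" "J \<subseteq> J1" "a - scaleC l 1 \<in> J1"
    using extend_proper_ideal[OF assms a_in_B(1)] by blast
  obtain k J2 where J2: "proper_ideal J2" "J1 \<subseteq> J2" "star a - scaleC k 1 \<in> J2"
    using extend_proper_ideal[OF J1(1) a_in_B(2)] by blast
  have mem: "a - scaleC l 1 \<in> J2" using J1 J2 by blast
  have "(a - scaleC l 1) + (star a - scaleC k 1) \<in> J2"
    using ideal_add[OF J2(1) mem J2(3)] .
  then have "l + k \<in> spectrum (a + star a)"
    using ideal_not_unit[OF J2(1)] by (simp add: spectrum_iff scaleC_algebra algebra_simps)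
  then have 1: "Im (l + k) = 0"
    by (rule spectrum_self_adjoint_real[rotated]) (simp add: star_add star_star add.commute)
  have "scaleC \<i> ((a - scaleC l 1) - (star a - scaleC k 1)) \<in> J2"
    by (intro ideal_scale[OF J2(1)] ideal_diff[OF J2(1)] mem J2(3))
  then have "\<i> * (l - k) \<in> spectrum (scaleC \<i> (a - star a))"
    using ideal_not_unit[OF J2(1)] by (simp add: spectrum_iff scaleC_algebra algebra_simps)
  then have 2: "Im (\<i> * (l - k)) = 0"
    by (rule spectrum_self_adjoint_real[rotated])
      (simp add: star_diff star_star star_scaleC scaleC_algebra)
  have "k = cnj l" using 1 2 by (simp add: complex_eq_iff)
  then show ?thesis using J2 J1 mem unfolding joint_ideal_def by blast
qed

lemma joint_ideal_spectrum: "joint_ideal J l \<Longrightarrow> l \<in> spectrum a"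
  using ideal_not_unit[of J "a - scaleC l 1"] by (simp add: joint_ideal_def spectrum_iff)

text \<open>Extending the principal ideal of \<open>a - \<lambda>\<close> gives a joint ideal for some \<open>\<mu>\<close>. It contains the
  scalar \<open>\<mu> - \<lambda>\<close>, which must vanish.\<close>

lemma spectrum_joint_ideal:
  assumes l: "l \<in> spectrum a"
  shows "\<exists>J. joint_ideal J l"
proof -
  let ?J = "(\<lambda>c. c * (a - scaleC l 1)) ` B"
  have "a - scaleC l 1 \<in> B" by (intro in_intros a_in_B)
  then have J: "proper_ideal ?J" using l by (intro principal_ideal) (simp_all add: spectrum_iff)
  then obtain J' m where J': "joint_ideal J' m" "?J \<subseteq> J'"
    using joint_ideal_exists by blast
  have pJ: "proper_ideal J'" and m: "a - scaleC m 1 \<in> J'"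
    using J'(1) by (simp_all add: joint_ideal_def)
  have l: "1 * (a - scaleC l 1) \<in> J'" using J'(2) one_in by blast
  from ideal_diff[OF pJ l m]
  have "scaleC (m - l) 1 \<in> J'" by (simp add: scaleC_diff_left)
  then have "m = l" using J'(1) ideal_scalar unfolding joint_ideal_def by fastforce
  then show ?thesis using J' by blast
qed

end

section \<open>Continuous functions on a compact set\<close>

lemma C_one_in: "C_one K \<in> C_functions K"
proof -
  have "continuous_on K (C_one K)"
    by (rule continuous_on_cong[THEN iffD2, OF refl _ continuous_on_const[of K 1]]) (simp add: C_one_def)
  then show ?thesis by (simp add: C_functions_def C_one_def)
qed

lemma C_id_in: "C_id K \<in> C_functions K"
proof -
  have "continuous_on K (C_id K)"
    by (rule continuous_on_cong[THEN iffD2, OF refl _ continuous_on_id]) (simp add: C_id_def)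
  then show ?thesis by (simp add: C_functions_def C_id_def)
qed

lemma C_functions_closed:
  assumes "f \<in> C_functions K" "g \<in> C_functions K"
  shows "f + g \<in> C_functions K" "f - g \<in> C_functions K" "f * g \<in> C_functions K"
    "scaleC c f \<in> C_functions K" "star f \<in> C_functions K"
  using assms
  by (auto simp: C_functions_def plus_fun_def fun_diff_def times_fun_def scaleC_fun_def star_fun_def
      scaleC_complex_def star_complex_def intro!: continuous_intros)

abbreviation sup_norm :: "complex set \<Rightarrow> (complex \<Rightarrow> complex) \<Rightarrow> real" where
  "sup_norm K f \<equiv> SUP z\<in>K. cmod (f z)"

lemma sup_norm_attained:
  assumes "compact K" "K \<noteq> {}" "f \<in> C_functions K"
  shows "\<exists>z\<in>K. sup_norm K f = cmod (f z)"
proof -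
  have "continuous_on K (\<lambda>z. cmod (f z))"
    using assms(3) by (auto simp: C_functions_def intro!: continuous_intros)
  then obtain z where z: "z \<in> K" "\<And>w. w \<in> K \<Longrightarrow> cmod (f w) \<le> cmod (f z)"
    using continuous_attains_sup[OF assms(1,2)] by blast
  then have "sup_norm K f = cmod (f z)" by (intro cSup_eq_maximum) auto
  with z show ?thesis by blast
qed

lemma sup_norm_upper:
  assumes "compact K" "f \<in> C_functions K" "z \<in> K"
  shows "cmod (f z) \<le> sup_norm K f"
proof -
  have "continuous_on K (\<lambda>z. cmod (f z))"
    using assms(2) by (auto simp: C_functions_def intro!: continuous_intros)
  then have "bdd_above ((\<lambda>z. cmod (f z)) ` K)"
    using assms(1) by (intro bounded_imp_bdd_above compact_imp_bounded compact_continuous_image)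
  then show ?thesis using assms(3) by (intro cSUP_upper) auto
qed

section \<open>The continuous functional calculus\<close>

text \<open>A *-polynomial in \<open>a\<close> together with the function that it defines on the spectrum, both built up in
  parallel. As a relation, it needs no normal form for polynomials; that \<open>f\<close> determines \<open>x\<close> is a
  consequence of \<open>poly_pair_norm\<close>, applied to differences.\<close>

inductive poly_pair :: "'a::unital_cstar_algebra \<Rightarrow> (complex \<Rightarrow> complex) \<Rightarrow> 'a \<Rightarrow> bool" for a where
  one: "poly_pair a (C_one (spectrum a)) 1"
| ident: "poly_pair a (C_id (spectrum a)) a"
| add: "poly_pair a f x \<Longrightarrow> poly_pair a g y \<Longrightarrow> poly_pair a (f + g) (x + y)"
| mult: "poly_pair a f x \<Longrightarrow> poly_pair a g y \<Longrightarrow> poly_pair a (f * g) (x * y)"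
| scaleC: "poly_pair a f x \<Longrightarrow> poly_pair a (scaleC c f) (scaleC c x)"
| star: "poly_pair a f x \<Longrightarrow> poly_pair a (star f) (star x)"

lemma poly_pair_diff: "poly_pair a f x \<Longrightarrow> poly_pair a g y \<Longrightarrow> poly_pair a (f - g) (x - y)"
  using poly_pair.add[of a f x "scaleC (-1) g" "scaleC (-1) y"] poly_pair.scaleC[of a g y "-1"]
  by (simp add: scaleC_minus_left scaleC_one)

lemma poly_pair_zero: "poly_pair a 0 0"
  using poly_pair.scaleC[OF poly_pair.one, of a 0] by simp

lemma poly_pair_C_functions: "poly_pair a f x \<Longrightarrow> f \<in> C_functions (spectrum a)"
  by (induction rule: poly_pair.induct) (blast intro: C_one_in C_id_in C_functions_closed)+

context normal_element_calculus
begin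

lemma spectrum_nonempty: "spectrum a \<noteq> {}"
  using normal_spectral_radius[OF normal] by blast

lemma poly_pair_in_B: "poly_pair a f x \<Longrightarrow> x \<in> B \<and> star x \<in> B"
  by (induction rule: poly_pair.induct)
    (auto simp: star_add star_mult star_scaleC star_star intro: in_intros a_in_B)

lemma poly_pair_normal: "poly_pair a f x \<Longrightarrow> normal_element x"
  using poly_pair_in_B[of f x] commute[of "star x" x] by (simp add: normal_element_def)

text \<open>Modulo a joint ideal for \<open>\<lambda>\<close>, the elements \<open>a\<close> and \<open>a\<^sup>*\<close> are scalars, and so is every
  polynomial in them. The statement about \<open>x\<^sup>*\<close> is carried along for the induction step of adjoints.\<close>

lemma poly_pair_joint_ideal:
  assumes J: "joint_ideal J l" and p: "poly_pair a f x"
  shows "x - scaleC (f l) 1 \<in> J \<and> star x - scaleC (cnj (f l)) 1 \<in> J"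
  using p
proof (induction rule: poly_pair.induct)
  have l: "l \<in> spectrum a" using J by (rule joint_ideal_spectrum)
  have pJ: "proper_ideal J" using J by (simp add: joint_ideal_def)
  note ideal = ideal_zero[OF pJ] ideal_add[OF pJ] ideal_mult_left[OF pJ] ideal_mult_right[OF pJ]
    ideal_scale[OF pJ]
  {
    case one
    show ?case using l ideal by (simp add: C_one_def scaleC_one)
  next
    case ident
    show ?case using l J by (simp add: C_id_def joint_ideal_def)
  next
    case (add f x g y)
    have "(x - scaleC (f l) 1) + (y - scaleC (g l) 1) \<in> J"
      "(star x - scaleC (cnj (f l)) 1) + (star y - scaleC (cnj (g l)) 1) \<in> J"
      using add ideal by auto
    then show ?case by (simp add: plus_fun_def scaleC_algebra star_add algebra_simps)
  next
    case (mult f x g y)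
    have B: "x \<in> B" "star y \<in> B" "star x \<in> B" "y \<in> B"
      using poly_pair_in_B mult by auto
    have "x * (y - scaleC (g l) 1) + scaleC (g l) (x - scaleC (f l) 1) \<in> J"
      "star y * (star x - scaleC (cnj (f l)) 1) + scaleC (cnj (f l)) (star y - scaleC (cnj (g l)) 1) \<in> J"
      using mult B ideal by auto
    then show ?case
      by (simp add: times_fun_def scaleC_algebra star_mult algebra_simps)
  next
    case (scaleC f x c)
    have "scaleC c (x - scaleC (f l) 1) \<in> J" "scaleC (cnj c) (star x - scaleC (cnj (f l)) 1) \<in> J"
      using scaleC ideal by auto
    then show ?case by (simp add: scaleC_fun_def scaleC_complex_def star_scaleC scaleC_algebra)
  next
    case (star f x)
    then show ?case by (simp add: star_fun_def star_complex_def star_star)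
  }
qed

text \<open>Some spectral value \<open>m\<close> of the normal element \<open>x\<close> has modulus \<open>\<parallel>x\<parallel>\<close>. A joint ideal, for
  \<open>\<lambda>\<close> say, containing \<open>x - m\<close> also contains \<open>x - f \<lambda>\<close>, whence \<open>m = f \<lambda>\<close>. Conversely, each value
  of \<open>f\<close> on the spectrum of \<open>a\<close> is a spectral value of \<open>x\<close> and bounded by its norm.\<close>

lemma poly_pair_norm:
  assumes p: "poly_pair a f x"
  shows "norm x = sup_norm (spectrum a) f"
proof (rule antisym)
  note C = poly_pair_C_functions[OF p]
  obtain m where m: "m \<in> spectrum x" "norm x \<le> cmod m"
    using normal_spectral_radius[OF poly_pair_normal[OF p]] by blast
  have "x - scaleC m 1 \<in> B" using poly_pair_in_B[OF p] by (intro in_intros) auto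
  then have pi: "proper_ideal ((\<lambda>c. c * (x - scaleC m 1)) ` B)"
    using m by (intro principal_ideal) (auto simp: spectrum_iff)
  then obtain J l where J: "joint_ideal J l" "(\<lambda>c. c * (x - scaleC m 1)) ` B \<subseteq> J"
    using joint_ideal_exists by blast
  have pJ: "proper_ideal J" using J(1) by (simp add: joint_ideal_def)
  have "1 * (x - scaleC m 1) \<in> J" using J(2) one_in by blast
  from ideal_diff[OF pJ this poly_pair_joint_ideal[OF J(1) p, THEN conjunct1]]
  have "scaleC (f l - m) 1 \<in> J" by (simp add: scaleC_diff_left)
  then have "f l = m" using J(1) ideal_scalar unfolding joint_ideal_def by fastforce
  then show "norm x \<le> sup_norm (spectrum a) f"
    using m(2) sup_norm_upper[OF compact_spectrum C joint_ideal_spectrum[OF J(1)]] by simp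
  obtain k where k: "k \<in> spectrum a" "sup_norm (spectrum a) f = cmod (f k)"
    using sup_norm_attained[OF compact_spectrum spectrum_nonempty C] by blast
  obtain I where I: "joint_ideal I k" using spectrum_joint_ideal[OF k(1)] by blast
  then have "f k \<in> spectrum x"
    using poly_pair_joint_ideal[OF I p] ideal_not_unit unfolding joint_ideal_def spectrum_iff by blast
  then show "sup_norm (spectrum a) f \<le> norm x"
    using spectrum_norm_le k(2) by simp
qed

text \<open>The real-valued functions among the polynomials form an algebra that contains the coordinates
  \<open>Re\<close> and \<open>Im\<close>, and the real Stone-Weierstrass theorem applies to the two parts of \<open>f\<close>.\<close>

lemma poly_pair_dense:
  assumes f: "f \<in> C_functions (spectrum a)" and e: "0 < e"
  shows "\<exists>g x. poly_pair a g x \<and> (\<forall>z\<in>spectrum a. cmod (f z - g z) < e)"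
proof -
  define P where "P r \<longleftrightarrow> (\<exists>g x. poly_pair a g x \<and> (\<forall>z\<in>spectrum a. g z = of_real (r z)))"
    for r :: "complex \<Rightarrow> real"
  have const: "P (\<lambda>z. c)" for c
    unfolding P_def by (intro exI conjI, rule poly_pair.scaleC[OF poly_pair.one, of a "of_real c"])
      (simp add: scaleC_fun_def C_one_def scaleC_complex_def)
  have cont: "continuous_on (spectrum a) r" if r: "P r" for r
  proof -
    obtain g x where g: "poly_pair a g x" "\<And>z. z \<in> spectrum a \<Longrightarrow> g z = of_real (r z)"
      using r unfolding P_def by blast
    have "continuous_on (spectrum a) (\<lambda>z. Re (g z))"
      using poly_pair_C_functions[OF g(1)] by (auto simp: C_functions_def intro!: continuous_intros)
    then show ?thesis using g(2) by (simp cong: continuous_on_cong)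
  qed
  have add: "P (\<lambda>z. r z + s z)" and mult: "P (\<lambda>z. r z * s z)" if rs: "P r \<and> P s" for r s
  proof -
    obtain g x h y where gh: "poly_pair a g x" "\<And>z. z \<in> spectrum a \<Longrightarrow> g z = of_real (r z)"
      "poly_pair a h y" "\<And>z. z \<in> spectrum a \<Longrightarrow> h z = of_real (s z)"
      using rs unfolding P_def by auto
    show "P (\<lambda>z. r z + s z)"
      unfolding P_def by (intro exI conjI, rule poly_pair.add[OF gh(1,3)]) (simp add: gh)
    show "P (\<lambda>z. r z * s z)"
      unfolding P_def by (intro exI conjI, rule poly_pair.mult[OF gh(1,3)]) (simp add: gh)
  qed
  have Re: "P Re"
    unfolding P_def
    by (intro exI conjI, rule poly_pair.scaleC[of _ _ _ "1/2", OF poly_pair.add[OF poly_pair.ident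
            poly_pair.star[OF poly_pair.ident]]])
      (simp add: scaleC_fun_def plus_fun_def star_fun_def C_id_def scaleC_complex_def star_complex_def
        complex_eq_iff)
  have Im: "P Im"
    unfolding P_def
    by (intro exI conjI, rule poly_pair.scaleC[of _ _ _ "- \<i> / 2", OF poly_pair_diff[OF poly_pair.ident
            poly_pair.star[OF poly_pair.ident]]])
      (simp add: scaleC_fun_def fun_diff_def star_fun_def C_id_def scaleC_complex_def star_complex_def
        complex_eq_iff)
  have sep: "\<exists>r. P r \<and> r z \<noteq> r w" if "z \<in> spectrum a \<and> w \<in> spectrum a \<and> z \<noteq> w" for z w
    using that Re Im complex_eq_iff[of z w] by blast
  have approx: "\<exists>r. P r \<and> (\<forall>z\<in>spectrum a. \<bar>h z - r z\<bar> < e / 2)"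
    if "continuous_on (spectrum a) h" for h
    by (rule Stone_Weierstrass_HOL[of "spectrum a" P h "e / 2", OF compact_spectrum const cont
          add mult sep that]) (use e in auto)
  have cf: "continuous_on (spectrum a) (\<lambda>z. Re (f z))" "continuous_on (spectrum a) (\<lambda>z. Im (f z))"
    using f by (auto simp: C_functions_def intro!: continuous_intros)
  obtain r where r: "P r" "\<And>z. z \<in> spectrum a \<Longrightarrow> \<bar>Re (f z) - r z\<bar> < e / 2"
    using approx[OF cf(1)] by auto
  obtain s where s: "P s" "\<And>z. z \<in> spectrum a \<Longrightarrow> \<bar>Im (f z) - s z\<bar> < e / 2"
    using approx[OF cf(2)] by auto
  obtain g x where g: "poly_pair a g x" "\<And>z. z \<in> spectrum a \<Longrightarrow> g z = of_real (r z)"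
    using r(1) unfolding P_def by auto
  obtain h y where h: "poly_pair a h y" "\<And>z. z \<in> spectrum a \<Longrightarrow> h z = of_real (s z)"
    using s(1) unfolding P_def by auto
  have "poly_pair a (g + scaleC \<i> h) (x + scaleC \<i> y)"
    by (intro poly_pair.intros g h)
  moreover have "cmod (f z - (g + scaleC \<i> h) z) < e" if z: "z \<in> spectrum a" for z
  proof -
    have "cmod (f z - (g + scaleC \<i> h) z) \<le> \<bar>Re (f z) - r z\<bar> + \<bar>Im (f z) - s z\<bar>"
      using cmod_le[of "f z - (g + scaleC \<i> h) z"]
      by (simp add: plus_fun_def scaleC_fun_def scaleC_complex_def g(2)[OF z] h(2)[OF z])
    then show ?thesis using r(2)[OF z] s(2)[OF z] by linarith
  qed
  ultimately show ?thesis by blast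
qed


text \<open>The closure of the graph of the polynomial calculus, which will turn out to be the graph of the
  functional calculus.\<close>

definition calculus_pair :: "(complex \<Rightarrow> complex) \<Rightarrow> 'a \<Rightarrow> bool" where
  "calculus_pair f x \<longleftrightarrow> f \<in> C_functions (spectrum a) \<and>
     (\<exists>F X. (\<forall>n. poly_pair a (F n) (X n)) \<and> uniform_limit (spectrum a) F f sequentially \<and>
       X \<longlonglongrightarrow> x)"

lemma poly_pair_calculus: "poly_pair a f x \<Longrightarrow> calculus_pair f x"
  unfolding calculus_pair_def
  by (auto intro!: exI[of _ "\<lambda>n. f"] exI[of _ "\<lambda>n. x"] uniform_limit_const
      dest: poly_pair_C_functions)

lemma calculus_pair_add:
  assumes "calculus_pair f x" "calculus_pair g y"
  shows "calculus_pair (f + g) (x + y)"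
proof -
  obtain F X G Y where FG: "\<And>n. poly_pair a (F n) (X n)"
    "uniform_limit (spectrum a) F f sequentially" "X \<longlonglongrightarrow> x"
    "\<And>n. poly_pair a (G n) (Y n)" "uniform_limit (spectrum a) G g sequentially" "Y \<longlonglongrightarrow> y"
    using assms unfolding calculus_pair_def by blast
  show ?thesis
    unfolding calculus_pair_def
  proof (intro conjI exI allI)
    show "f + g \<in> C_functions (spectrum a)"
      using assms by (intro C_functions_closed) (auto simp: calculus_pair_def)
    show "poly_pair a (F n + G n) (X n + Y n)" for n by (intro poly_pair.add FG)
    show "uniform_limit (spectrum a) (\<lambda>n. F n + G n) (f + g) sequentially"
      using uniform_limit_add[OF FG(2,5)] by (simp add: plus_fun_def)
    show "(\<lambda>n. X n + Y n) \<longlonglongrightarrow> x + y" by (intro tendsto_add FG)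
  qed
qed

lemma calculus_pair_mult:
  assumes "calculus_pair f x" "calculus_pair g y"
  shows "calculus_pair (f * g) (x * y)"
proof -
  obtain F X G Y where FG: "\<And>n. poly_pair a (F n) (X n)"
    "uniform_limit (spectrum a) F f sequentially" "X \<longlonglongrightarrow> x"
    "\<And>n. poly_pair a (G n) (Y n)" "uniform_limit (spectrum a) G g sequentially" "Y \<longlonglongrightarrow> y"
    using assms unfolding calculus_pair_def by blast
  have bdd: "bounded (h ` spectrum a)" if "h \<in> C_functions (spectrum a)" for h
    using that by (intro compact_imp_bounded compact_continuous_image compact_spectrum)
      (simp add: C_functions_def)
  show ?thesis
    unfolding calculus_pair_def
  proof (intro conjI exI allI)
    show "f * g \<in> C_functions (spectrum a)"
      using assms by (intro C_functions_closed) (auto simp: calculus_pair_def)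
    show "poly_pair a (F n * G n) (X n * Y n)" for n by (intro poly_pair.mult FG)
    show "uniform_limit (spectrum a) (\<lambda>n. F n * G n) (f * g) sequentially"
      using uniform_lim_mult[OF FG(2,5)] bdd assms by (simp add: times_fun_def calculus_pair_def)
    show "(\<lambda>n. X n * Y n) \<longlonglongrightarrow> x * y" by (intro tendsto_mult FG)
  qed
qed

lemma calculus_pair_scaleC:
  assumes "calculus_pair f x"
  shows "calculus_pair (scaleC c f) (scaleC c x)"
proof -
  obtain F X where F: "\<And>n. poly_pair a (F n) (X n)"
    "uniform_limit (spectrum a) F f sequentially" "X \<longlonglongrightarrow> x"
    using assms unfolding calculus_pair_def by blast
  show ?thesis
    unfolding calculus_pair_def
  proof (intro conjI exI allI)
    show "scaleC c f \<in> C_functions (spectrum a)"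
      using assms by (intro C_functions_closed) (auto simp: calculus_pair_def)
    show "poly_pair a (scaleC c (F n)) (scaleC c (X n))" for n by (intro poly_pair.scaleC F)
    show "uniform_limit (spectrum a) (\<lambda>n. scaleC c (F n)) (scaleC c f) sequentially"
      using bounded_linear.uniform_limit[OF bounded_linear_mult_right F(2), of c]
      by (simp add: scaleC_fun_def scaleC_complex_def)
    show "(\<lambda>n. scaleC c (X n)) \<longlonglongrightarrow> scaleC c x"
      using bounded_linear.tendsto[OF bounded_linear_scaleC F(3)] .
  qed
qed

lemma calculus_pair_star:
  assumes "calculus_pair f x"
  shows "calculus_pair (star f) (star x)"
proof -
  obtain F X where F: "\<And>n. poly_pair a (F n) (X n)"
    "uniform_limit (spectrum a) F f sequentially" "X \<longlonglongrightarrow> x"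
    using assms unfolding calculus_pair_def by blast
  show ?thesis
    unfolding calculus_pair_def
  proof (intro conjI exI allI)
    show "star f \<in> C_functions (spectrum a)"
      using assms by (intro C_functions_closed[of f _ f]) (auto simp: calculus_pair_def)
    show "poly_pair a (star (F n)) (star (X n))" for n by (intro poly_pair.star F)
    show "uniform_limit (spectrum a) (\<lambda>n. star (F n)) (star f) sequentially"
      using bounded_linear.uniform_limit[OF bounded_linear_cnj F(2)]
      by (simp add: star_fun_def star_complex_def)
    show "(\<lambda>n. star (X n)) \<longlonglongrightarrow> star x"
      using bounded_linear.tendsto[OF bounded_linear_star F(3)] .
  qed
qed

lemma calculus_pair_diff:
  "calculus_pair f x \<Longrightarrow> calculus_pair g y \<Longrightarrow> calculus_pair (f - g) (x - y)"
  using calculus_pair_add[of f x "scaleC (-1) g" "scaleC (-1) y"] calculus_pair_scaleC[of g y "-1"]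
  by (simp add: scaleC_minus_left scaleC_one)

lemma sup_norm_least:
  "(\<And>z. z \<in> spectrum a \<Longrightarrow> cmod (f z) \<le> e) \<Longrightarrow> sup_norm (spectrum a) f \<le> e"
  by (rule cSUP_least[OF spectrum_nonempty])

lemma calculus_pair_norm:
  assumes "calculus_pair f x"
  shows "norm x \<le> sup_norm (spectrum a) f"
proof (rule field_le_epsilon)
  fix e :: real assume e: "0 < e"
  have f: "f \<in> C_functions (spectrum a)" using assms by (simp add: calculus_pair_def)
  obtain F X where F: "\<And>n. poly_pair a (F n) (X n)"
    "uniform_limit (spectrum a) F f sequentially" "X \<longlonglongrightarrow> x"
    using assms unfolding calculus_pair_def by blast
  have "\<forall>\<^sub>F n in sequentially. \<forall>z\<in>spectrum a. dist (F n z) (f z) < e"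
    using F(2) e by (rule uniform_limitD)
  then have "\<forall>\<^sub>F n in sequentially. norm (X n) \<le> sup_norm (spectrum a) f + e"
  proof eventually_elim
    case (elim n)
    have "sup_norm (spectrum a) (F n) \<le> sup_norm (spectrum a) f + e"
    proof (rule sup_norm_least)
      fix z assume z: "z \<in> spectrum a"
      have "cmod (F n z) \<le> cmod (f z) + dist (F n z) (f z)"
        using norm_triangle_sub[of "F n z" "f z"] by (simp add: dist_norm)
      then show "cmod (F n z) \<le> sup_norm (spectrum a) f + e"
        using elim z sup_norm_upper[OF compact_spectrum f z] by force
    qed
    then show ?case by (simp add: poly_pair_norm[OF F(1)])
  qed
  then show "norm x \<le> sup_norm (spectrum a) f + e"
    by (rule tendsto_upperbound[OF tendsto_norm[OF F(3)]]) simp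
qed

lemma calculus_pair_unique:
  assumes "calculus_pair f x" "calculus_pair f y"
  shows "x = y"
  using calculus_pair_norm[OF calculus_pair_diff[OF assms]] spectrum_nonempty by simp

text \<open>If polynomials converge uniformly to \<open>f\<close>, then by the isometry their values at \<open>a\<close> form a Cauchy
  sequence.\<close>

lemma calculus_pair_exists:
  assumes f: "f \<in> C_functions (spectrum a)"
  shows "\<exists>x. calculus_pair f x"
proof -
  have "\<exists>g x. poly_pair a g x \<and> (\<forall>z\<in>spectrum a. cmod (f z - g z) < inverse (real (Suc n)))" for n
    using f by (rule poly_pair_dense) simp
  then obtain F X where F: "\<And>n. poly_pair a (F n) (X n)"
    "\<And>n z. z \<in> spectrum a \<Longrightarrow> cmod (f z - F n z) < inverse (real (Suc n))"
    by metis
  have ul: "uniform_limit (spectrum a) F f sequentially"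
  proof (rule uniform_limitI)
    fix e :: real assume "0 < e"
    then have "\<forall>\<^sub>F n in sequentially. inverse (real (Suc n)) < e"
      by (rule order_tendstoD(2)[OF LIMSEQ_inverse_real_of_nat])
    then show "\<forall>\<^sub>F n in sequentially. \<forall>z\<in>spectrum a. dist (F n z) (f z) < e"
    proof eventually_elim
      case (elim n)
      show ?case
      proof
        fix z assume "z \<in> spectrum a"
        then show "dist (F n z) (f z) < e"
          using F(2)[of z n] elim by (simp add: dist_norm norm_minus_commute[of "F n z"])
      qed
    qed
  qed
  have "Cauchy X"
    unfolding Cauchy_def
  proof (intro allI impI)
    fix e :: real assume e: "0 < e"
    have "\<forall>\<^sub>F n in sequentially. inverse (real (Suc n)) < e / 4"
      using e by (intro order_tendstoD(2)[OF LIMSEQ_inverse_real_of_nat]) simp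
    then obtain N where N: "\<And>n. N \<le> n \<Longrightarrow> inverse (real (Suc n)) < e / 4"
      by (auto simp: eventually_sequentially)
    have "dist (X m) (X n) < e" if "N \<le> m" "N \<le> n" for m n
    proof -
      have "norm (X m - X n) = sup_norm (spectrum a) (F m - F n)"
        by (rule poly_pair_norm[OF poly_pair_diff[OF F(1) F(1)]])
      also have "\<dots> \<le> e / 2"
      proof (rule sup_norm_least)
        fix z assume z: "z \<in> spectrum a"
        have "cmod (F m z - F n z) \<le> cmod (f z - F m z) + cmod (f z - F n z)"
          using norm_triangle_ineq4[of "f z - F n z" "f z - F m z"] by (simp add: algebra_simps)
        then show "cmod ((F m - F n) z) \<le> e / 2"
          using F(2)[OF z, of m] F(2)[OF z, of n] N[OF that(1)] N[OF that(2)] by simp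
      qed
      finally show ?thesis using e by (simp add: dist_norm)
    qed
    then show "\<exists>N. \<forall>m\<ge>N. \<forall>n\<ge>N. dist (X m) (X n) < e" by blast
  qed
  then obtain x where "X \<longlonglongrightarrow> x" using Cauchy_convergent convergent_def by blast
  then show ?thesis using f F(1) ul unfolding calculus_pair_def by blast
qed

text \<open>A unital *-homomorphism on \<open>C(K)\<close> is contractive: \<open>\<Psi> f\<close> is normal, and \<open>\<Psi> f - \<mu>\<close> is invertible
  whenever \<open>f - \<mu>\<close> has no zero on \<open>K\<close>.\<close>

lemma star_homomorphism_norm_le:
  fixes \<Psi> :: "(complex \<Rightarrow> complex) \<Rightarrow> 'a"
  assumes hom: "star_homomorphism_on (C_functions (spectrum a)) \<Psi>"
    and one: "\<Psi> (C_one (spectrum a)) = 1"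
    and f: "f \<in> C_functions (spectrum a)"
  shows "norm (\<Psi> f) \<le> sup_norm (spectrum a) f"
proof -
  let ?C = "C_functions (spectrum a)" and ?u = "C_one (spectrum a)"
  have h: "\<Psi> (g + k) = \<Psi> g + \<Psi> k" "\<Psi> (g * k) = \<Psi> g * \<Psi> k" "\<Psi> (scaleC c g) = scaleC c (\<Psi> g)"
    "\<Psi> (star g) = star (\<Psi> g)" if "g \<in> ?C" "k \<in> ?C" for g k c
    using hom that by (auto simp: star_homomorphism_on_def)
  have sf: "star f \<in> ?C" using f by (rule C_functions_closed(5)) (rule f)
  have "star f * f = f * star f" by (simp add: mult.commute)
  then have "normal_element (\<Psi> f)"
    unfolding normal_element_def h(4)[OF f f, symmetric] h(2)[OF sf f, symmetric]
      h(2)[OF f sf, symmetric] by (rule arg_cong)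
  then obtain m where m: "m \<in> spectrum (\<Psi> f)" "norm (\<Psi> f) \<le> cmod m"
    using normal_spectral_radius by blast
  have "cmod m \<le> sup_norm (spectrum a) f"
  proof (rule ccontr)
    assume "\<not> ?thesis"
    then have ne: "f z \<noteq> m" if "z \<in> spectrum a" for z
      using sup_norm_upper[OF compact_spectrum f that] by auto
    define g where "g z = (if z \<in> spectrum a then 1 / (f z - m) else 0)" for z
    have "continuous_on (spectrum a) (\<lambda>z. 1 / (f z - m))"
      using f ne by (auto simp: C_functions_def intro!: continuous_intros)
    then have g: "g \<in> ?C"
      by (simp add: C_functions_def g_def cong: continuous_on_cong)
    define k where "k = f + scaleC (- m) ?u"
    have u: "?u \<in> ?C" by (rule C_one_in)
    have k: "k \<in> ?C"
      unfolding k_def by (intro C_functions_closed(1) f C_functions_closed(4)[OF u u])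
    have "\<Psi> k = \<Psi> f - scaleC m 1"
      using h(1)[OF f C_functions_closed(4)[OF u u], of "- m"] h(3)[OF u u, of "- m"] one
        scaleC_minus_left[of m "1::'a"]
      unfolding k_def by simp
    moreover have "g * k = ?u"
      using ne by (auto simp: fun_eq_iff g_def k_def C_one_def scaleC_fun_def scaleC_complex_def)
    moreover have "k * g = ?u" using \<open>g * k = ?u\<close> by (simp add: mult.commute)
    ultimately have "unit_element (\<Psi> f - scaleC m 1)"
      unfolding unit_element_def using h(2)[OF g k] h(2)[OF k g] one by (intro exI[of _ "\<Psi> g"]) simp
    then show False using m by (simp add: spectrum_iff)
  qed
  with m show ?thesis by linarith
qed

lemma star_homomorphism_poly_pair:
  assumes hom: "star_homomorphism_on (C_functions (spectrum a)) \<Psi>"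
    and one: "\<Psi> (C_one (spectrum a)) = 1" and ident: "\<Psi> (C_id (spectrum a)) = a"
    and p: "poly_pair a f x"
  shows "\<Psi> f = x"
  using p
proof (induction rule: poly_pair.induct)
qed (use hom one ident poly_pair_C_functions in \<open>unfold star_homomorphism_on_def, blast+\<close>)

lemma star_homomorphism_calculus_pair:
  assumes hom: "star_homomorphism_on (C_functions (spectrum a)) \<Psi>"
    and one: "\<Psi> (C_one (spectrum a)) = 1" and ident: "\<Psi> (C_id (spectrum a)) = a"
    and p: "calculus_pair f x"
  shows "\<Psi> f = x"
proof -
  have f: "f \<in> C_functions (spectrum a)" using p by (simp add: calculus_pair_def)
  have "norm (\<Psi> f - x) \<le> 0 + e" if e: "0 < e" for e
  proof -
    obtain g y where g: "poly_pair a g y" "\<And>z. z \<in> spectrum a \<Longrightarrow> cmod (f z - g z) < e / 2"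
      using poly_pair_dense[OF f, of "e / 2"] e by auto
    note gC = poly_pair_C_functions[OF g(1)]
    have le: "sup_norm (spectrum a) (f - g) \<le> e / 2"
      using g(2) by (intro sup_norm_least) (auto simp: less_imp_le)
    have "\<Psi> (f + scaleC (-1) g) = \<Psi> f + scaleC (-1) (\<Psi> g)"
      using hom f gC C_functions_closed(4)[OF gC gC] unfolding star_homomorphism_on_def by metis
    then have "\<Psi> (f - g) = \<Psi> f - y"
      using star_homomorphism_poly_pair[OF hom one ident g(1)]
      by (simp add: scaleC_minus_left scaleC_one)
    then have "norm (\<Psi> f - y) \<le> e / 2"
      using order.trans[OF star_homomorphism_norm_le[OF hom one C_functions_closed(2)[OF f gC]] le]
      by (simp only:)
    moreover have "norm (x - y) \<le> e / 2"
      using calculus_pair_norm[OF calculus_pair_diff[OF p poly_pair_calculus[OF g(1)]]] le by simp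
    ultimately show ?thesis
      using norm_triangle_ineq4[of "\<Psi> f - y" "x - y"] by simp
  qed
  then have "norm (\<Psi> f - x) \<le> 0" by (rule field_le_epsilon)
  then show ?thesis by simp
qed

text \<open>The calculus pairs form a *-homomorphism, because limits respect the operations. Any other
  one with the same values at the unit and the identity has the same values on polynomials and, being
  contractive, on their uniform limits.\<close>

theorem functional_calculus_pair:
  assumes "calculus_pair f x"
  shows "functional_calculus a f = x"
proof -
  let ?K = "spectrum a" and ?C = "C_functions (spectrum a)"
  define \<Phi> where "\<Phi> = restrict (\<lambda>f. THE x. calculus_pair f x) ?C"
  have \<Phi>: "\<Phi> f = x" if "calculus_pair f x" for f x
  proof -
    have "\<Phi> f = (THE x. calculus_pair f x)" using that by (simp add: \<Phi>_def calculus_pair_def)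
    also have "\<dots> = x" using that by (rule the_equality) (rule calculus_pair_unique[OF _ that])
    finally show ?thesis .
  qed
  have ex: "calculus_pair f (\<Phi> f)" if "f \<in> ?C" for f
    using calculus_pair_exists[OF that] \<Phi> by metis
  have hom: "star_homomorphism_on ?C \<Phi>"
    unfolding star_homomorphism_on_def
    by (intro ballI conjI allI \<Phi> calculus_pair_add calculus_pair_mult calculus_pair_scaleC
        calculus_pair_star ex)
  have one: "\<Phi> (C_one ?K) = 1" and ident: "\<Phi> (C_id ?K) = a"
    by (intro \<Phi> poly_pair_calculus poly_pair.intros)+
  have "functional_calculus a = \<Phi>"
    unfolding functional_calculus_def
  proof (rule the_equality)
    show "\<Phi> \<in> extensional ?C \<and> star_homomorphism_on ?C \<Phi> \<and> \<Phi> (C_one ?K) = 1 \<and> \<Phi> (C_id ?K) = a"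
      using hom one ident by (simp add: \<Phi>_def)
    fix \<Psi> assume \<Psi>: "\<Psi> \<in> extensional ?C \<and> star_homomorphism_on ?C \<Psi> \<and> \<Psi> (C_one ?K) = 1 \<and>
      \<Psi> (C_id ?K) = a"
    show "\<Psi> = \<Phi>"
    proof (rule extensionalityI)
      show "\<Psi> \<in> extensional ?C" "\<Phi> \<in> extensional ?C" using \<Psi> by (simp_all add: \<Phi>_def)
      show "\<Psi> f = \<Phi> f" if "f \<in> ?C" for f
        using star_homomorphism_calculus_pair[OF _ _ _ ex[OF that]] \<Psi> by blast
    qed
  qed
  then show ?thesis using \<Phi>[OF assms] by simp
qed

text \<open>In this form the calculus is evaluated: a good polynomial approximation \<open>g\<close> to \<open>f\<close> gives an
  equally good approximation \<open>y = g(a)\<close> to \<open>f(a)\<close>.\<close>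

theorem functional_calculus_approx:
  assumes f: "f \<in> C_functions (spectrum a)" and p: "poly_pair a g y"
  shows "norm (functional_calculus a f - y) \<le> sup_norm (spectrum a) (f - g)"
proof -
  obtain x where x: "calculus_pair f x" using calculus_pair_exists[OF f] by blast
  show ?thesis
    using calculus_pair_norm[OF calculus_pair_diff[OF x poly_pair_calculus[OF p]]]
    by (simp add: functional_calculus_pair[OF x])
qed

end

section \<open>Computable functions of several arguments\<close>

text \<open>One program has to work for all oracles. It can then be used both absolutely and as a part of a
  machine that reads a name from its oracle.\<close>

definition computable :: "nat \<Rightarrow> (nat list \<Rightarrow> nat) \<Rightarrow> bool" where
  "computable n F \<longleftrightarrow> (\<exists>p. \<forall>\<alpha> xs. length xs = n \<longrightarrow> computes \<alpha> p xs (F xs))"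

abbreviation computable1 :: "(nat \<Rightarrow> nat) \<Rightarrow> bool" where
  "computable1 f \<equiv> computable 1 (\<lambda>xs. f (xs ! 0))"

abbreviation computable2 :: "(nat \<Rightarrow> nat \<Rightarrow> nat) \<Rightarrow> bool" where
  "computable2 f \<equiv> computable 2 (\<lambda>xs. f (xs ! 0) (xs ! 1))"

abbreviation computable3 :: "(nat \<Rightarrow> nat \<Rightarrow> nat \<Rightarrow> nat) \<Rightarrow> bool" where
  "computable3 f \<equiv> computable 3 (\<lambda>xs. f (xs ! 0) (xs ! 1) (xs ! 2))"

named_theorems computable

lemma computable_cong:
  "(\<And>xs. length xs = n \<Longrightarrow> F xs = G xs) \<Longrightarrow> computable n F \<Longrightarrow> computable n G"
  unfolding computable_def by metis

lemma computable_comp: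
  assumes F: "computable (length Gs) F" and Gs: "\<And>G. G \<in> set Gs \<Longrightarrow> computable n G"
  shows "computable n (\<lambda>xs. F (map (\<lambda>G. G xs) Gs))"
proof -
  obtain p where p: "\<And>\<alpha> xs. length xs = length Gs \<Longrightarrow> computes \<alpha> p xs (F xs)"
    using F unfolding computable_def by blast
  have "\<exists>gs. \<forall>\<alpha> xs. length xs = n \<longrightarrow>
      list_all2 (\<lambda>g y. computes \<alpha> g xs y) gs (map (\<lambda>G. G xs) Gs)"
    using Gs
  proof (induction Gs)
    case Nil
    then show ?case by (intro exI[of _ "[]"]) simp
  next
    case (Cons G Gs)
    obtain g where "\<And>\<alpha> xs. length xs = n \<Longrightarrow> computes \<alpha> g xs (G xs)"
      using Cons.prems[of G] unfolding computable_def by auto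
    moreover obtain gs where "\<And>\<alpha> xs. length xs = n \<Longrightarrow>
        list_all2 (\<lambda>g y. computes \<alpha> g xs y) gs (map (\<lambda>G. G xs) Gs)"
      using Cons by auto
    ultimately show ?case by (intro exI[of _ "g # gs"]) simp
  qed
  then obtain gs where "\<And>\<alpha> xs. length xs = n \<Longrightarrow>
      list_all2 (\<lambda>g y. computes \<alpha> g xs y) gs (map (\<lambda>G. G xs) Gs)"
    by blast
  then have "computes \<alpha> (Comp p gs) xs (F (map (\<lambda>G. G xs) Gs))" if "length xs = n" for \<alpha> xs
    using that p by (intro computes.comp) auto
  then show ?thesis unfolding computable_def by blast
qed

lemma computable_app1:
  assumes "computable1 f" "computable n A"
  shows "computable n (\<lambda>xs. f (A xs))"
  using computable_comp[of "[A]" "\<lambda>xs. f (xs ! 0)" n] assms by simp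

lemma computable_app2:
  assumes "computable2 f" "computable n A" "computable n B"
  shows "computable n (\<lambda>xs. f (A xs) (B xs))"
  using computable_comp[of "[A, B]" "\<lambda>xs. f (xs ! 0) (xs ! 1)" n] assms
  by (auto simp: numeral_2_eq_2)

lemma computable_app3:
  assumes "computable3 f" "computable n A" "computable n B" "computable n C"
  shows "computable n (\<lambda>xs. f (A xs) (B xs) (C xs))"
  using computable_comp[of "[A, B, C]" "\<lambda>xs. f (xs ! 0) (xs ! 1) (xs ! 2)" n] assms
  by (auto simp: numeral_2_eq_2 numeral_3_eq_3)

lemma computable_nth [computable]: "i < n \<Longrightarrow> computable n (\<lambda>xs. xs ! i)"
  unfolding computable_def by (blast intro: computes.proj)

lemma computable_Suc [computable]: "computable n A \<Longrightarrow> computable n (\<lambda>xs. Suc (A xs))"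
proof (rule computable_app1[where f = Suc])
  have "computes \<alpha> Succ xs (Suc (xs ! 0))" if "length xs = 1" for \<alpha> xs
    using that computes.succ by (cases xs) auto
  then show "computable1 Suc" unfolding computable_def by blast
qed

lemma computable_const [computable]: "computable n (\<lambda>xs. c)"
proof (induction c)
  case 0
  show ?case unfolding computable_def by (blast intro: computes.zero)
qed (rule computable_Suc)

lemma computable_rec_nat:
  assumes F: "computable n F" and G: "computable (n + 2) G"
  shows "computable (n + 1) (\<lambda>xs. rec_nat (F (tl xs)) (\<lambda>m y. G (m # y # tl xs)) (hd xs))"
proof -
  obtain p where p: "\<And>\<alpha> xs. length xs = n \<Longrightarrow> computes \<alpha> p xs (F xs)"
    using F unfolding computable_def by blast
  obtain r where r: "\<And>\<alpha> xs. length xs = n + 2 \<Longrightarrow> computes \<alpha> r xs (G xs)"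
    using G unfolding computable_def by blast
  have main: "computes \<alpha> (PrimRec p r) (m # xs) (rec_nat (F xs) (\<lambda>m y. G (m # y # xs)) m)"
    if "length xs = n" for \<alpha> xs m
    by (induction m) (use that in \<open>auto intro!: computes.primrec_0 computes.primrec_Suc p r\<close>)
  have "computes \<alpha> (PrimRec p r) xs (rec_nat (F (tl xs)) (\<lambda>m y. G (m # y # tl xs)) (hd xs))"
    if "length xs = n + 1" for \<alpha> xs
    using main[of "tl xs" \<alpha> "hd xs"] that by (cases xs) auto
  then show ?thesis unfolding computable_def by blast
qed

lemma computable1_rec:
  assumes "computable2 g" "f 0 = c" "\<And>m. f (Suc m) = g m (f m)"
  shows "computable1 f"
proof (rule computable_cong)
  have "computable (0 + 1) (\<lambda>xs. rec_nat c (\<lambda>m y. g ((m # y # tl xs) ! 0) ((m # y # tl xs) ! 1)) (hd xs))"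
    by (rule computable_rec_nat) (use assms computable_const in \<open>simp_all add: numeral_2_eq_2\<close>)
  then show "computable 1 (\<lambda>xs. rec_nat c (\<lambda>m y. g m y) (hd xs))" by simp
  fix xs :: "nat list" assume "length xs = 1"
  moreover have "rec_nat c (\<lambda>m y. g m y) m = f m" for m
    by (induction m) (simp_all add: assms)
  ultimately show "rec_nat c (\<lambda>m y. g m y) (hd xs) = f (xs ! 0)" by (cases xs) auto
qed

lemma computable2_rec:
  assumes "computable1 b" "computable3 g"
    and "\<And>p. f 0 p = b p" "\<And>m p. f (Suc m) p = g m (f m p) p"
  shows "computable2 f"
proof (rule computable_cong)
  have "computable (1 + 1) (\<lambda>xs. rec_nat (b (tl xs ! 0))
      (\<lambda>m y. g ((m # y # tl xs) ! 0) ((m # y # tl xs) ! 1) ((m # y # tl xs) ! 2)) (hd xs))"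
    by (rule computable_rec_nat) (use assms in \<open>simp_all add: numeral_3_eq_3\<close>)
  then show "computable 2 (\<lambda>xs. rec_nat (b (tl xs ! 0)) (\<lambda>m y. g m y (tl xs ! 0)) (hd xs))"
    by (simp add: numeral_2_eq_2)
  fix xs :: "nat list" assume "length xs = 2"
  moreover have "rec_nat (b p) (\<lambda>m y. g m y p) m = f m p" for m p
    by (induction m) (simp_all add: assms)
  ultimately show "rec_nat (b (tl xs ! 0)) (\<lambda>m y. g m y (tl xs ! 0)) (hd xs) = f (xs ! 0) (xs ! 1)"
    by (auto simp: length_Suc_conv numeral_2_eq_2)
qed

lemma computable3_funpow:
  assumes "computable2 s"
  shows "computable3 (\<lambda>m p z. (s p ^^ m) z)"
proof (rule computable_cong)
  have "computable (2 + 2) (\<lambda>xs. s (xs ! 2) (xs ! 1))"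
    by (rule computable_app2[OF assms]) (rule computable, simp)+
  then have "computable (2 + 1) (\<lambda>xs. rec_nat (tl xs ! 1)
      (\<lambda>m y. s ((m # y # tl xs) ! 2) ((m # y # tl xs) ! 1)) (hd xs))"
    by (intro computable_rec_nat computable_nth) simp_all
  then show "computable 3 (\<lambda>xs. rec_nat (tl xs ! 1) (\<lambda>m y. s (tl xs ! 0) y) (hd xs))"
    by (simp add: numeral_2_eq_2 numeral_3_eq_3)
  fix xs :: "nat list" assume "length xs = 3"
  moreover have "rec_nat z (\<lambda>m y. s p y) m = (s p ^^ m) z" for m p z
    by (induction m) simp_all
  ultimately show "rec_nat (tl xs ! 1) (\<lambda>m y. s (tl xs ! 0) y) (hd xs) = (s (xs ! 1) ^^ (xs ! 0)) (xs ! 2)"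
    by (auto simp: length_Suc_conv numeral_2_eq_2 numeral_3_eq_3)
qed

subsection \<open>Arithmetic and decisions\<close>

lemma computable_add [computable]:
  "computable n A \<Longrightarrow> computable n B \<Longrightarrow> computable n (\<lambda>xs. A xs + B xs)"
proof (rule computable_app2[where f = "(+)"])
  show "computable2 (+)"
    by (rule computable2_rec[where b = "\<lambda>p. p" and g = "\<lambda>m y p. Suc y"]) (rule computable | simp)+
qed

lemma computable_mult [computable]:
  "computable n A \<Longrightarrow> computable n B \<Longrightarrow> computable n (\<lambda>xs. A xs * B xs)"
proof (rule computable_app2[where f = "(*)"])
  show "computable2 (*)"
    by (rule computable2_rec[where b = "\<lambda>p. 0" and g = "\<lambda>m y p. p + y"]) (rule computable | simp)+
qed

lemma computable_diff [computable]:
  "computable n A \<Longrightarrow> computable n B \<Longrightarrow> computable n (\<lambda>xs. A xs - B xs)"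
proof (rule computable_app2[where f = "(-)"])
  have "computable1 (\<lambda>x. x - 1)"
    by (rule computable1_rec[where g = "\<lambda>m y. m" and c = 0]) (rule computable | simp)+
  note pred = computable_app1[OF this]
  have "computable2 (\<lambda>m p. p - m)"
    by (rule computable2_rec[where b = "\<lambda>p. p" and g = "\<lambda>m y p. y - 1"]) (rule computable pred | simp)+
  from computable_app2[OF this, of 2 "\<lambda>xs. xs ! 1" "\<lambda>xs. xs ! 0"]
  show "computable2 (-)" by (simp add: computable_nth)
qed

lemma computable_power [computable]:
  "computable n A \<Longrightarrow> computable n B \<Longrightarrow> computable n (\<lambda>xs. A xs ^ B xs)"
proof -
  have "computable2 (\<lambda>m p. p ^ m)"
    by (rule computable2_rec[where b = "\<lambda>p. 1" and g = "\<lambda>m y p. p * y"]) (rule computable | simp)+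
  then show "computable n A \<Longrightarrow> computable n B \<Longrightarrow> computable n (\<lambda>xs. A xs ^ B xs)"
    using computable_app2[of "\<lambda>m p. p ^ m" n B A] by simp
qed

lemma computable_mod_2 [computable]: "computable n A \<Longrightarrow> computable n (\<lambda>xs. A xs mod 2)"
proof (rule computable_app1[where f = "\<lambda>x. x mod 2"])
  show "computable1 (\<lambda>x. x mod 2)"
    by (rule computable1_rec[where g = "\<lambda>m y. 1 - y" and c = 0]) (rule computable | simp add: mod_Suc)+
qed

lemma computable_div_2 [computable]: "computable n A \<Longrightarrow> computable n (\<lambda>xs. A xs div 2)"
proof (rule computable_app1[where f = "\<lambda>x. x div 2"])
  show "computable1 (\<lambda>x. x div 2)"
    by (rule computable1_rec[where g = "\<lambda>m y. y + m mod 2" and c = 0]) (rule computable | simp | arith)+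
qed

definition decidable :: "nat \<Rightarrow> (nat list \<Rightarrow> bool) \<Rightarrow> bool" where
  "decidable n P \<longleftrightarrow> computable n (\<lambda>xs. of_bool (P xs))"

lemma decidable_le [computable]:
  assumes "computable n A" "computable n B"
  shows "decidable n (\<lambda>xs. A xs \<le> B xs)"
proof -
  have "computable n (\<lambda>xs. 1 - (A xs - B xs))" by (intro computable assms)
  moreover have "1 - (x - y) = of_bool (x \<le> y)" for x y :: nat by simp
  ultimately show ?thesis unfolding decidable_def by simp
qed

lemma decidable_conj [computable]:
  assumes "decidable n P" "decidable n Q"
  shows "decidable n (\<lambda>xs. P xs \<and> Q xs)"
  using computable_mult[of n "\<lambda>xs. of_bool (P xs)" "\<lambda>xs. of_bool (Q xs)"] assms
  unfolding decidable_def by (simp add: of_bool_conj)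

lemma decidable_not [computable]:
  assumes "decidable n P"
  shows "decidable n (\<lambda>xs. \<not> P xs)"
proof -
  have "computable n (\<lambda>xs. 1 - of_bool (P xs))"
    using assms unfolding decidable_def by (intro computable)
  moreover have "1 - of_bool p = (of_bool (\<not> p) :: nat)" for p by simp
  ultimately show ?thesis unfolding decidable_def by simp
qed

lemma decidable_less [computable]:
  assumes "computable n A" "computable n B"
  shows "decidable n (\<lambda>xs. A xs < B xs)"
  using decidable_not[OF decidable_le[OF assms(2,1)]] by (simp add: not_le)

lemma decidable_eq [computable]:
  assumes "computable n A" "computable n B"
  shows "decidable n (\<lambda>xs. A xs = B xs)"
  using decidable_conj[OF decidable_le[OF assms] decidable_le[OF assms(2,1)]] by (simp add: eq_iff)

lemma computable_if [computable]:
  assumes "decidable n P" "computable n A" "computable n B"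
  shows "computable n (\<lambda>xs. if P xs then A xs else B xs)"
proof -
  have "computable n (\<lambda>xs. of_bool (P xs) * A xs + (1 - of_bool (P xs)) * B xs)"
    using assms unfolding decidable_def by (intro computable)
  moreover have "of_bool p * x + (1 - of_bool p) * y = (if p then x else y)" for p and x y :: nat
    by simp
  ultimately show ?thesis by simp
qed

subsection \<open>Coded pairs and lists\<close>

text \<open>The number of the diagonal on which the pairing function enumerates the pair coded by \<open>n\<close>. Unlike
  the two components it changes monotonically with \<open>n\<close>, by at most one in each step, so that it is
  primitive recursive; the components are obtained from it by subtraction.\<close>

definition triangle_root :: "nat \<Rightarrow> nat" where
  "triangle_root n = fst (prod_decode n) + snd (prod_decode n)"

lemma triangle_mono: "m \<le> n \<Longrightarrow> triangle m \<le> triangle n"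
  by (unfold triangle_def, intro div_le_mono mult_le_mono) auto

lemma triangle_root_bounds: "triangle (triangle_root n) \<le> n" "n < triangle (Suc (triangle_root n))"
proof -
  obtain a b where ab: "prod_decode n = (a, b)" by fastforce
  have "n = triangle (a + b) + a"
    using prod_decode_inverse[of n] unfolding ab prod_encode_def by simp
  moreover have "triangle_root n = a + b" by (simp add: triangle_root_def ab)
  ultimately show "triangle (triangle_root n) \<le> n" "n < triangle (Suc (triangle_root n))"
    by simp_all
qed

lemma triangle_root_unique:
  assumes "triangle r \<le> n" "n < triangle (Suc r)"
  shows "triangle_root n = r"
proof (rule ccontr)
  assume "\<not> ?thesis"
  then consider "Suc r \<le> triangle_root n" | "Suc (triangle_root n) \<le> r" by linarith
  then show False
  proof cases
    case 1
    from triangle_mono[OF this] triangle_root_bounds(1)[of n] assms(2) show False by linarith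
  next
    case 2
    from triangle_mono[OF this] triangle_root_bounds(2)[of n] assms(1) show False by linarith
  qed
qed

lemma prod_decode_triangle_root:
  "fst (prod_decode n) = n - triangle (triangle_root n)"
  "snd (prod_decode n) = triangle_root n - (n - triangle (triangle_root n))"
proof -
  obtain a b where ab: "prod_decode n = (a, b)" by fastforce
  have "n = triangle (a + b) + a"
    using prod_decode_inverse[of n] unfolding ab prod_encode_def by simp
  then have "n - triangle (a + b) = a" by linarith
  then show "fst (prod_decode n) = n - triangle (triangle_root n)"
    "snd (prod_decode n) = triangle_root n - (n - triangle (triangle_root n))"
    by (simp_all add: triangle_root_def ab)
qed

lemma computable_triangle [computable]: "computable n A \<Longrightarrow> computable n (\<lambda>xs. triangle (A xs))"
  unfolding triangle_def by (intro computable)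

lemma computable_triangle_root [computable]:
  "computable n A \<Longrightarrow> computable n (\<lambda>xs. triangle_root (A xs))"
proof (rule computable_app1[where f = triangle_root])
  show "computable1 triangle_root"
  proof (rule computable1_rec)
    show "computable2 (\<lambda>m r. if triangle (Suc r) \<le> Suc m then Suc r else r)"
      by (rule computable | simp)+
    show "triangle_root 0 = 0" by (rule triangle_root_unique) simp_all
    fix m
    show "triangle_root (Suc m) =
        (if triangle (Suc (triangle_root m)) \<le> Suc m then Suc (triangle_root m) else triangle_root m)"
      using triangle_root_bounds[of m] by (intro triangle_root_unique) auto
  qed
qed

abbreviation pair :: "nat \<Rightarrow> nat \<Rightarrow> nat" where "pair x y \<equiv> prod_encode (x, y)"
abbreviation pfst :: "nat \<Rightarrow> nat" where "pfst n \<equiv> fst (prod_decode n)"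
abbreviation psnd :: "nat \<Rightarrow> nat" where "psnd n \<equiv> snd (prod_decode n)"

lemma computable_pair [computable]:
  "computable n A \<Longrightarrow> computable n B \<Longrightarrow> computable n (\<lambda>xs. pair (A xs) (B xs))"
  unfolding prod_encode_def case_prod_conv by (intro computable)

lemma computable_pfst [computable]: "computable n A \<Longrightarrow> computable n (\<lambda>xs. pfst (A xs))"
  unfolding prod_decode_triangle_root by (intro computable)

lemma computable_psnd [computable]: "computable n A \<Longrightarrow> computable n (\<lambda>xs. psnd (A xs))"
  unfolding prod_decode_triangle_root by (intro computable)

lemma pfst_le: "pfst n \<le> n" and psnd_le: "psnd n \<le> n"
  using le_prod_encode_1[of "pfst n" "psnd n"] le_prod_encode_2[of "psnd n" "pfst n"] by simp_all

definition cons_code :: "nat \<Rightarrow> nat \<Rightarrow> nat" where "cons_code x n = Suc (pair x n)"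

lemma list_decode_cons [simp]: "list_decode (cons_code x n) = x # list_decode n"
  by (simp add: cons_code_def)

lemma list_decode_Suc: "list_decode (Suc n) = pfst n # list_decode (psnd n)"
  by (simp split: prod.split)

declare list_decode.simps(2) [simp del]

lemma computable_cons_code [computable]:
  "computable n A \<Longrightarrow> computable n B \<Longrightarrow> computable n (\<lambda>xs. cons_code (A xs) (B xs))"
  unfolding cons_code_def by (intro computable)

lemma length_list_decode_le: "length (list_decode n) \<le> n"
proof (induction n rule: less_induct)
  case (less n)
  show ?case
  proof (cases n)
    case (Suc m)
    have "length (list_decode (psnd m)) \<le> psnd m"
      using less[of "psnd m"] psnd_le[of m] Suc by simp
    then show ?thesis using psnd_le[of m] by (simp add: Suc list_decode_Suc)
  qed simp
qed

lemma set_list_decode_less: "x \<in> set (list_decode n) \<Longrightarrow> x < n"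
proof (induction n rule: less_induct)
  case (less n)
  show ?case
  proof (cases n)
    case (Suc m)
    then show ?thesis
      using less.IH[of "psnd m"] less.prems psnd_le[of m] pfst_le[of m] by (auto simp: list_decode_Suc)
  qed (use less in simp)
qed

definition fold_step :: "(nat \<Rightarrow> nat \<Rightarrow> nat \<Rightarrow> nat) \<Rightarrow> nat \<Rightarrow> nat \<Rightarrow> nat" where
  "fold_step f p s = (if psnd s = 0 then s
     else pair (f p (pfst s) (pfst (psnd s - 1))) (psnd (psnd s - 1)))"

lemma fold_step_funpow:
  "length (list_decode l) \<le> m \<Longrightarrow>
    (fold_step f p ^^ m) (pair z l) = pair (foldl (f p) z (list_decode l)) 0"
proof (induction m arbitrary: z l)
  case 0
  then have "l = 0" by (cases l) (simp_all add: list_decode_Suc)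
  then show ?case by simp
next
  case (Suc m)
  show ?case
  proof (cases l)
    case 0
    then have "fold_step f p (pair z l) = pair z l" by (simp add: fold_step_def)
    then show ?thesis using Suc.IH[of 0 z] 0 by (simp add: funpow_swap1)
  next
    case (Suc k)
    then have "fold_step f p (pair z l) = pair (f p z (pfst k)) (psnd k)"
      by (simp add: fold_step_def)
    then show ?thesis
      using Suc.IH[of "psnd k" "f p z (pfst k)"] Suc.prems Suc
      by (simp add: funpow_swap1 list_decode_Suc)
  qed
qed

text \<open>Folding over a coded list is iteration on a pair of the accumulator and the remaining
  list; the code of a list bounds its length. The single parameter \<open>p\<close> may be a coded
  tuple.\<close>

lemma computable_foldl:
  assumes f: "computable3 f" and "computable n P" "computable n Z" "computable n L"
  shows "computable n (\<lambda>xs. foldl (f (P xs)) (Z xs) (list_decode (L xs)))"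
proof -
  note [computable] = computable_app3[OF f]
  have "computable2 (fold_step f)"
    unfolding fold_step_def by (rule computable | simp)+
  note it = computable_app3[OF computable3_funpow[OF this]]
  have "computable n (\<lambda>xs. pfst ((fold_step f (P xs) ^^ L xs) (pair (Z xs) (L xs))))"
    using assms by (intro computable it)
  then show ?thesis by (simp add: fold_step_funpow length_list_decode_le)
qed

definition rev_append_code :: "nat \<Rightarrow> nat \<Rightarrow> nat" where
  "rev_append_code m n = foldl (\<lambda>l x. cons_code x l) n (list_decode m)"

lemma list_decode_rev_append [simp]:
  "list_decode (rev_append_code m n) = rev (list_decode m) @ list_decode n"
proof -
  have "list_decode (foldl (\<lambda>l x. cons_code x l) n xs) = rev xs @ list_decode n" for xs
    by (induction xs arbitrary: n) simp_all
  then show ?thesis by (simp add: rev_append_code_def)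
qed

lemma computable_rev_append [computable]:
  assumes "computable n A" "computable n B"
  shows "computable n (\<lambda>xs. rev_append_code (A xs) (B xs))"
  unfolding rev_append_code_def
  by (rule computable_foldl[where f = "\<lambda>p l x. cons_code x l" and P = "\<lambda>xs. 0"])
    (rule computable assms | simp)+

subsection \<open>Computing without the oracle\<close>

text \<open>Absolute computability is computability with the zero function as oracle. The corresponding
  programs have to be run with a name as oracle: their queries are replaced by the constant zero.\<close>

fun answer_zero :: "prog \<Rightarrow> prog" where
  "answer_zero Zero = Zero"
| "answer_zero Succ = Succ"
| "answer_zero (Proj i) = Proj i"
| "answer_zero Query = Zero"
| "answer_zero (Comp f gs) = Comp (answer_zero f) (map answer_zero gs)"
| "answer_zero (PrimRec f g) = PrimRec (answer_zero f) (answer_zero g)"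
| "answer_zero (Mu f) = Mu (answer_zero f)"

lemma computes_answer_zero: "computes0 p xs y \<Longrightarrow> computes \<alpha> (answer_zero p) xs y"
proof (induction rule: computes.induct)
  case (comp xs gs ys f z)
  then show ?case
    by (auto intro!: computes.comp simp: list_all2_conv_all_nth)
next
  case (mu f n xs)
  then show ?case by (auto intro!: computes.mu)
qed (auto intro: computes.intros)

lemma computable_computes0:
  assumes "\<And>xs. length xs = n \<Longrightarrow> computes0 p xs (F xs)"
  shows "computable n F"
  using computes_answer_zero[OF assms] unfolding computable_def by blast

text \<open>Norms of generated points are given by a program that need not halt outside the set of codes. It
  becomes part of a total computable function once its first argument always is a code.\<close>

lemma computable_partial_app2:
  assumes p: "\<And>x y. x \<in> D \<Longrightarrow> computes0 p [x, y] (f x y)"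
    and A: "computable n A" "\<And>xs. length xs = n \<Longrightarrow> A xs \<in> D" and B: "computable n B"
  shows "computable n (\<lambda>xs. f (A xs) (B xs))"
proof -
  obtain g where g: "\<And>\<alpha> xs. length xs = n \<Longrightarrow> computes \<alpha> g xs (A xs)"
    using A(1) unfolding computable_def by blast
  obtain h where h: "\<And>\<alpha> xs. length xs = n \<Longrightarrow> computes \<alpha> h xs (B xs)"
    using B unfolding computable_def by blast
  have "computes \<alpha> (Comp (answer_zero p) [g, h]) xs (f (A xs) (B xs))" if "length xs = n" for \<alpha> xs
    by (rule computes.comp[where ys = "[A xs, B xs]"])
      (use that g h computes_answer_zero[OF p[OF A(2)]] in auto)
  then show ?thesis unfolding computable_def by blast
qed

lemma computable_computes0D:
  assumes "computable1 f"
  shows "\<exists>p. \<forall>k. computes0 p [k] (f k)"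
proof -
  obtain p where "\<And>\<alpha> xs. length xs = 1 \<Longrightarrow> computes \<alpha> p xs (f (xs ! 0))"
    using assms unfolding computable_def by blast
  from this[of "[_]"] show ?thesis by (intro exI[of _ p]) simp
qed

section \<open>Arithmetic of codes\<close>

text \<open>The code of an integer is even if it is nonnegative, and odd otherwise; \<open>(n + 1) div 2\<close> is the
  absolute value of the integer coded by \<open>n\<close>, and \<open>m\<close> and \<open>-m\<close> have the codes \<open>2 * m\<close> and
  \<open>2 * m - 1\<close>. For the product with zero the subtraction is truncated, which gives the code \<open>0\<close>.\<close>

definition int_mult_code :: "nat \<Rightarrow> nat \<Rightarrow> nat" where
  "int_mult_code x y = 2 * ((x + 1) div 2 * ((y + 1) div 2)) - (x + y) mod 2"

lemma int_decode_if: "int_decode n = (if even n then int (n div 2) else - int (n div 2) - 1)"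
  by (simp add: int_decode_def sum_decode_def)

lemma int_decode_mult: "int_decode (int_mult_code x y) = int_decode x * int_decode y"
proof -
  have odd: "int_decode (2 * N - 1) = - int N" for N
    by (cases N) (simp_all add: int_decode_if)
  have half: "(2 * p + 1) div 2 = p" "(Suc (2 * p) + 1) div 2 = p + 1" for p :: nat by simp_all
  consider p q where "x = 2 * p" "y = 2 * q" | p q where "x = 2 * p" "y = Suc (2 * q)"
    | p q where "x = Suc (2 * p)" "y = 2 * q" | p q where "x = Suc (2 * p)" "y = Suc (2 * q)"
    by (metis evenE oddE Suc_eq_plus1)
  then show ?thesis
  proof cases
    case 1
    then have "int_mult_code x y = 2 * (p * q)" by (simp add: int_mult_code_def half)
    then show ?thesis using 1 by (simp add: int_decode_if)
  next
    case 2
    then have "int_mult_code x y = 2 * (p * (q + 1)) - 1"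
      by (simp add: int_mult_code_def half mod_Suc)
    then show ?thesis using 2 odd[of "p * (q + 1)"] by (simp add: int_decode_if algebra_simps)
  next
    case 3
    then have "int_mult_code x y = 2 * ((p + 1) * q) - 1"
      by (simp add: int_mult_code_def half mod_Suc)
    then show ?thesis using 3 odd[of "(p + 1) * q"] by (simp add: int_decode_if algebra_simps)
  next
    case 4
    then have "int_mult_code x y = 2 * ((p + 1) * (q + 1))"
      by (simp add: int_mult_code_def half mod_Suc)
    then show ?thesis using 4 by (simp add: int_decode_if algebra_simps)
  qed
qed

lemma int_decode_1: "int_decode 1 = -1" "int_decode (Suc 0) = -1"
  by (simp_all add: int_decode_if)

lemma abs_int_decode_le: "\<bar>int_decode n\<bar> \<le> int n"
  by (simp add: int_decode_if) presburger

definition rat_mult_code :: "nat \<Rightarrow> nat \<Rightarrow> nat" where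
  "rat_mult_code x y = pair (int_mult_code (pfst x) (pfst y)) (int_mult_code (psnd x) (psnd y))"

definition rat_neg_code :: "nat \<Rightarrow> nat" where
  "rat_neg_code x = pair (int_mult_code 1 (pfst x)) (psnd x)"

lemma nat_to_rat_surj_eq: "nat_to_rat_surj n = Fract (int_decode (pfst n)) (int_decode (psnd n))"
  by (simp add: nat_to_rat_surj_def split: prod.split)

lemma nat_to_rat_surj_mult: "nat_to_rat_surj (rat_mult_code x y) = nat_to_rat_surj x * nat_to_rat_surj y"
  by (simp add: nat_to_rat_surj_eq rat_mult_code_def int_decode_mult)

lemma nat_to_rat_surj_neg: "nat_to_rat_surj (rat_neg_code x) = - nat_to_rat_surj x"
  by (simp add: nat_to_rat_surj_eq rat_neg_code_def int_decode_mult int_decode_1)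

lemma nat_to_rat_surj_0 [simp]: "nat_to_rat_surj 0 = 0"
  using prod_decode_inverse[of 0]
  by (simp add: nat_to_rat_surj_eq int_decode_if rat_number_collapse prod_decode_def prod_decode_aux.simps)

text \<open>The numerator is bounded by its code, and a nonzero denominator only decreases the quotient. The
  denominator zero stands for the number \<open>0\<close>.\<close>

lemma abs_nat_to_rat_surj_le: "\<bar>real_of_rat (nat_to_rat_surj n)\<bar> \<le> real n"
proof -
  let ?x = "int_decode (pfst n)" and ?y = "int_decode (psnd n)"
  have "\<bar>real_of_rat (nat_to_rat_surj n)\<bar> = \<bar>real_of_int ?x\<bar> / \<bar>real_of_int ?y\<bar>"
    by (simp add: nat_to_rat_surj_eq Fract_of_int_quotient of_rat_divide)
  also have "\<dots> \<le> \<bar>real_of_int ?x\<bar>"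
  proof (cases "?y = 0")
    case False
    then have "1 \<le> \<bar>real_of_int ?y\<bar>" by linarith
    then show ?thesis using divide_left_mono[of 1 "\<bar>real_of_int ?y\<bar>" "\<bar>real_of_int ?x\<bar>"] by simp
  qed simp
  also have "\<dots> \<le> real (pfst n)" using abs_int_decode_le[of "pfst n"] by linarith
  also have "\<dots> \<le> real n" using pfst_le by simp
  finally show ?thesis .
qed

definition gaussian_value :: "nat \<Rightarrow> complex" where
  "gaussian_value c = gaussian (gaussian_decode c)"

lemma gaussian_value_eq:
  "gaussian_value c = Complex (of_rat (nat_to_rat_surj (pfst c))) (of_rat (nat_to_rat_surj (psnd c)))"
  by (simp add: gaussian_value_def gaussian_def gaussian_decode_def split: prod.split)

lemma cmod_gaussian_value_le: "cmod (gaussian_value c) \<le> 2 * real c"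
proof -
  have "cmod (gaussian_value c) \<le> \<bar>Re (gaussian_value c)\<bar> + \<bar>Im (gaussian_value c)\<bar>" by (rule cmod_le)
  also have "\<dots> \<le> real (pfst c) + real (psnd c)"
    unfolding gaussian_value_eq using abs_nat_to_rat_surj_le by (simp add: add_mono)
  also have "\<dots> \<le> 2 * real c" using pfst_le[of c] psnd_le[of c] by linarith
  finally show ?thesis .
qed

text \<open>The product of two Gaussian rationals is returned as a sum, in order to avoid the addition of
  fractions: the first summand uses the real part of \<open>c\<close>, the second one the imaginary part.\<close>

definition gaussian_mult_re :: "nat \<Rightarrow> nat \<Rightarrow> nat" where
  "gaussian_mult_re c d = pair (rat_mult_code (pfst c) (pfst d)) (rat_mult_code (pfst c) (psnd d))"

definition gaussian_mult_im :: "nat \<Rightarrow> nat \<Rightarrow> nat" where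
  "gaussian_mult_im c d =
     pair (rat_neg_code (rat_mult_code (psnd c) (psnd d))) (rat_mult_code (psnd c) (pfst d))"

definition gaussian_cnj :: "nat \<Rightarrow> nat" where
  "gaussian_cnj c = pair (pfst c) (rat_neg_code (psnd c))"

lemma gaussian_value_mult:
  "gaussian_value (gaussian_mult_re c d) + gaussian_value (gaussian_mult_im c d) =
     gaussian_value c * gaussian_value d"
  by (simp add: gaussian_value_eq gaussian_mult_re_def gaussian_mult_im_def nat_to_rat_surj_mult
      nat_to_rat_surj_neg complex_eq_iff of_rat_mult of_rat_minus)

lemma gaussian_value_cnj: "gaussian_value (gaussian_cnj c) = cnj (gaussian_value c)"
  by (simp add: gaussian_value_eq gaussian_cnj_def nat_to_rat_surj_neg complex_eq_iff of_rat_minus)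

lemma computable_int_mult [computable]:
  "computable n A \<Longrightarrow> computable n B \<Longrightarrow> computable n (\<lambda>xs. int_mult_code (A xs) (B xs))"
  unfolding int_mult_code_def by (intro computable)

lemma computable_rat_mult [computable]:
  "computable n A \<Longrightarrow> computable n B \<Longrightarrow> computable n (\<lambda>xs. rat_mult_code (A xs) (B xs))"
  unfolding rat_mult_code_def by (intro computable)

lemma computable_rat_neg [computable]:
  "computable n A \<Longrightarrow> computable n (\<lambda>xs. rat_neg_code (A xs))"
  unfolding rat_neg_code_def by (intro computable)

lemma computable_gaussian_mult_re [computable]:
  "computable n A \<Longrightarrow> computable n B \<Longrightarrow> computable n (\<lambda>xs. gaussian_mult_re (A xs) (B xs))"
  unfolding gaussian_mult_re_def by (intro computable)

lemma computable_gaussian_mult_im [computable]: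
  "computable n A \<Longrightarrow> computable n B \<Longrightarrow> computable n (\<lambda>xs. gaussian_mult_im (A xs) (B xs))"
  unfolding gaussian_mult_im_def by (intro computable)

lemma computable_gaussian_cnj [computable]:
  "computable n A \<Longrightarrow> computable n (\<lambda>xs. gaussian_cnj (A xs))"
  unfolding gaussian_cnj_def by (intro computable)

section \<open>Values and letters of coded polynomials\<close>

definition letter_code_value :: "(nat \<Rightarrow> 'a::unital_cstar_algebra) \<Rightarrow> nat \<Rightarrow> 'a" where
  "letter_code_value v l = letter_value v (letter_decode l)"

definition word_value :: "(nat \<Rightarrow> 'a::unital_cstar_algebra) \<Rightarrow> nat \<Rightarrow> 'a" where
  "word_value v w = prod_list (map (letter_code_value v) (list_decode w))"

text \<open>A monomial is coded by its coefficient and by its nonempty word as a pair of head and tail.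
  Such a pair is one less than the code of the word as a list.\<close>

definition monomial_code_value :: "(nat \<Rightarrow> 'a::unital_cstar_algebra) \<Rightarrow> nat \<Rightarrow> 'a" where
  "monomial_code_value v m = scaleC (gaussian_value (pfst m)) (word_value v (Suc (psnd m)))"

definition poly_code_value :: "(nat \<Rightarrow> 'a::unital_cstar_algebra) \<Rightarrow> nat \<Rightarrow> 'a" where
  "poly_code_value v n = (\<Sum>m\<leftarrow>list_decode n. monomial_code_value v m)"

lemma foldl_mult: "foldl (\<lambda>x m. x * f m) x ms = x * prod_list (map f ms)" for x :: "'a::monoid_mult"
  by (induction ms arbitrary: x) (simp_all add: mult.assoc)

lemma monomial_value_decode: "monomial_value v (monomial_decode m) = monomial_code_value v m"
  by (simp add: monomial_decode_def monomial_code_value_def word_value_def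
      letter_code_value_def[abs_def] gaussian_value_def list_decode_Suc foldl_mult comp_def split: prod.split)

lemma poly_value_decode: "poly_value v (poly_decode n) = poly_code_value v n"
  by (simp add: poly_value_def poly_decode_def poly_code_value_def monomial_value_decode comp_def)

definition word_indices :: "nat \<Rightarrow> nat set" where
  "word_indices w = (\<lambda>l. letter_index (letter_decode l)) ` set (list_decode w)"

definition poly_code_indices :: "nat \<Rightarrow> nat set" where
  "poly_code_indices n = (\<Union>m\<in>set (list_decode n). word_indices (Suc (psnd m)))"

lemma poly_indices_decode: "poly_indices (poly_decode n) = poly_code_indices n"
proof -
  have "(case monomial_decode m of (c, l, ls) \<Rightarrow> letter_index ` set (l # ls)) = word_indices (Suc (psnd m))"
    for m
    by (simp add: word_indices_def monomial_decode_def list_decode_Suc image_image split: prod.split)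
  then show ?thesis by (simp add: poly_indices_def poly_decode_def poly_code_indices_def)
qed

lemma poly_code_value_cons [simp]:
  "poly_code_value v (cons_code m n) = monomial_code_value v m + poly_code_value v n"
  and poly_code_value_0 [simp]: "poly_code_value v 0 = 0"
  by (simp_all add: poly_code_value_def)

lemma poly_code_indices_cons [simp]:
  "poly_code_indices (cons_code m n) = word_indices (Suc (psnd m)) \<union> poly_code_indices n"
  and poly_code_indices_0 [simp]: "poly_code_indices 0 = {}"
  by (simp_all add: poly_code_indices_def)

lemma sum_list_scaleC_mult:
  fixes x :: "'a::complex_star_algebra"
  shows "(\<Sum>m\<leftarrow>ms. scaleC c (x * f m)) = scaleC c (x * (\<Sum>m\<leftarrow>ms. f m))"
  by (induction ms) (simp_all add: distrib_left scaleC_add_right)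

lemma foldl_value:
  fixes V :: "nat \<Rightarrow> 'a::comm_monoid_add"
  assumes "\<And>s x. V (f s x) = V s + g x"
  shows "V (foldl f z xs) = V z + (\<Sum>x\<leftarrow>xs. g x)"
  by (induction xs arbitrary: z) (simp_all add: assms add.assoc)

lemma foldl_indices:
  assumes "\<And>s x. x \<in> set xs \<Longrightarrow> I s \<subseteq> N \<Longrightarrow> I (f s x) \<subseteq> N" "I z \<subseteq> N"
  shows "I (foldl f z xs) \<subseteq> N"
  using assms by (induction xs arbitrary: z) simp_all

subsection \<open>Words\<close>

definition append_word :: "nat \<Rightarrow> nat \<Rightarrow> nat" where
  "append_word u w = rev_append_code (rev_append_code u 0) w"

lemma list_decode_append_word [simp]: "list_decode (append_word u w) = list_decode u @ list_decode w"
  by (simp add: append_word_def)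

definition letter_star :: "nat \<Rightarrow> nat" where
  "letter_star l = (l + 1) - 2 * (l mod 2)"

lemma letter_decode_if: "letter_decode l = (if even l then X (l div 2) else Xstar (l div 2))"
  by (simp add: letter_decode_def sum_decode_def)

lemma letter_star_correct:
  "letter_code_value v (letter_star l) = star (letter_code_value v l)"
  "letter_index (letter_decode (letter_star l)) = letter_index (letter_decode l)"
proof -
  consider p where "l = 2 * p" | p where "l = Suc (2 * p)" by (metis evenE oddE Suc_eq_plus1)
  then show "letter_code_value v (letter_star l) = star (letter_code_value v l)"
    "letter_index (letter_decode (letter_star l)) = letter_index (letter_decode l)"
    by (cases; simp add: letter_star_def letter_code_value_def letter_decode_if star_star mod_Suc)+
qed

definition word_star :: "nat \<Rightarrow> nat" where
  "word_star w = foldl (\<lambda>u l. cons_code (letter_star l) u) 0 (list_decode w)"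

lemma list_decode_word_star: "list_decode (word_star w) = rev (map letter_star (list_decode w))"
proof -
  have "list_decode (foldl (\<lambda>u l. cons_code (letter_star l) u) z xs) =
      rev (map letter_star xs) @ list_decode z" for xs z
    by (induction xs arbitrary: z) simp_all
  then show ?thesis by (simp add: word_star_def)
qed

lemma star_prod_list: "star (prod_list xs) = prod_list (rev (map star xs))"
  for xs :: "'a::unital_cstar_algebra list"
  by (induction xs) (simp_all add: star_mult)

lemma word_value_append: "word_value v (append_word u w) = word_value v u * word_value v w"
  by (simp add: word_value_def)

lemma word_value_star: "word_value v (word_star w) = star (word_value v w)"
  by (simp add: word_value_def list_decode_word_star star_prod_list rev_map letter_star_correct comp_def)

lemma word_indices_append: "word_indices (append_word u w) = word_indices u \<union> word_indices w"
  by (auto simp: word_indices_def)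

lemma word_indices_star: "word_indices (word_star w) = word_indices w"
  by (simp add: word_indices_def list_decode_word_star letter_star_correct image_image)

lemma Suc_append_word: "Suc (append_word u (Suc w) - Suc 0) = append_word u (Suc w)"
  using list_decode_append_word[of u "Suc w"] by (cases "append_word u (Suc w)") (simp_all add: list_decode_Suc)

lemma Suc_word_star: "Suc (word_star (Suc w) - Suc 0) = word_star (Suc w)"
  using list_decode_word_star[of "Suc w"] by (cases "word_star (Suc w)") (simp_all add: list_decode_Suc)

lemma computable_append_word [computable]:
  "computable n A \<Longrightarrow> computable n B \<Longrightarrow> computable n (\<lambda>xs. append_word (A xs) (B xs))"
  unfolding append_word_def by (intro computable)

lemma computable_letter_star [computable]:
  "computable n A \<Longrightarrow> computable n (\<lambda>xs. letter_star (A xs))"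
  unfolding letter_star_def by (intro computable)

lemma computable_word_star [computable]:
  assumes "computable n A"
  shows "computable n (\<lambda>xs. word_star (A xs))"
  unfolding word_star_def
  by (rule computable_foldl[where f = "\<lambda>p u l. cons_code (letter_star l) u" and P = "\<lambda>xs. 0"])
    (rule computable assms | simp)+

subsection \<open>Polynomials\<close>

text \<open>Sums are concatenations, up to order.\<close>

lemma poly_code_value_rev_append:
  "poly_code_value v (rev_append_code p q) = poly_code_value v p + poly_code_value v q"
  by (simp add: poly_code_value_def rev_map[symmetric] sum_list_rev)

lemma poly_code_indices_rev_append:
  "poly_code_indices (rev_append_code p q) = poly_code_indices p \<union> poly_code_indices q"
  by (simp add: poly_code_indices_def)

text \<open>A polynomial is multiplied from the left by a monomial whose word \<open>u\<close> may be empty, contrary to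
  the words in a code. The empty word serves for multiplication by scalars. Every monomial yields two,
  as the product of the coefficients is a sum.\<close>

definition monomial_times_step :: "nat \<Rightarrow> nat \<Rightarrow> nat \<Rightarrow> nat" where
  "monomial_times_step e s m =
     (let w = append_word (psnd e) (Suc (psnd m)) - 1
      in cons_code (pair (gaussian_mult_re (pfst e) (pfst m)) w)
           (cons_code (pair (gaussian_mult_im (pfst e) (pfst m)) w) s))"

definition monomial_times :: "nat \<Rightarrow> nat \<Rightarrow> nat \<Rightarrow> nat" where
  "monomial_times c u q = foldl (monomial_times_step (pair c u)) 0 (list_decode q)"

lemma poly_code_value_monomial_times:
  "poly_code_value v (monomial_times c u q) =
     scaleC (gaussian_value c) (word_value v u * poly_code_value v q)"
proof -
  have "poly_code_value v (monomial_times_step (pair c u) s m) = poly_code_value v s +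
      scaleC (gaussian_value c) (word_value v u * monomial_code_value v m)" for s m
  proof -
    have "poly_code_value v (monomial_times_step (pair c u) s m) =
        scaleC (gaussian_value (gaussian_mult_re c (pfst m)) + gaussian_value (gaussian_mult_im c (pfst m)))
          (word_value v u * word_value v (Suc (psnd m))) + poly_code_value v s"
      by (simp add: monomial_times_step_def Let_def monomial_code_value_def Suc_append_word
          word_value_append scaleC_add_left add.assoc)
    then show ?thesis
      unfolding gaussian_value_mult
      by (simp add: monomial_code_value_def mult_scaleC_right scaleC_scaleC add.commute)
  qed
  from foldl_value[of "poly_code_value v"
      "monomial_times_step (pair c u)" "\<lambda>m. scaleC (gaussian_value c) (word_value v u * monomial_code_value v m)",
      OF this]
  show ?thesis
    by (simp add: monomial_times_def sum_list_scaleC_mult poly_code_value_def[of v q])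
qed


lemma poly_code_indices_monomial_times:
  assumes "word_indices u \<subseteq> N" "poly_code_indices q \<subseteq> N"
  shows "poly_code_indices (monomial_times c u q) \<subseteq> N"
  unfolding monomial_times_def
proof (rule foldl_indices[where I = poly_code_indices])
  fix s m assume m: "m \<in> set (list_decode q)" and s: "poly_code_indices s \<subseteq> N"
  have "word_indices (Suc (psnd m)) \<subseteq> N" using m assms(2) by (auto simp: poly_code_indices_def)
  with s assms(1) show "poly_code_indices (monomial_times_step (pair c u) s m) \<subseteq> N"
    by (simp add: monomial_times_step_def Let_def Suc_append_word word_indices_append)
qed simp

lemma computable_monomial_times [computable]:
  assumes "computable n A" "computable n B" "computable n C"
  shows "computable n (\<lambda>xs. monomial_times (A xs) (B xs) (C xs))"
  unfolding monomial_times_def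
proof (rule computable_foldl[where P = "\<lambda>xs. pair (A xs) (B xs)" and Z = "\<lambda>xs. 0"])
  show "computable3 monomial_times_step"
    unfolding monomial_times_step_def Let_def by (rule computable | simp)+
qed (intro computable assms)+

definition poly_times_step :: "nat \<Rightarrow> nat \<Rightarrow> nat \<Rightarrow> nat" where
  "poly_times_step q s m = rev_append_code (monomial_times (pfst m) (Suc (psnd m)) q) s"

definition poly_times :: "nat \<Rightarrow> nat \<Rightarrow> nat" where
  "poly_times p q = foldl (poly_times_step q) 0 (list_decode p)"

lemma poly_code_value_times:
  "poly_code_value v (poly_times p q) = poly_code_value v p * poly_code_value v q"
proof -
  have "poly_code_value v (poly_times_step q s m) =
      poly_code_value v s + monomial_code_value v m * poly_code_value v q" for s m
    by (simp add: poly_times_step_def poly_code_value_rev_append poly_code_value_monomial_times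
        monomial_code_value_def mult_scaleC_left add.commute)
  from foldl_value[of "poly_code_value v"
      "poly_times_step q" "\<lambda>m. monomial_code_value v m * poly_code_value v q",
      OF this]
  show ?thesis
    by (simp add: poly_times_def sum_list_mult_const poly_code_value_def[of v p])
qed

lemma poly_code_indices_times:
  assumes "poly_code_indices p \<subseteq> N" "poly_code_indices q \<subseteq> N"
  shows "poly_code_indices (poly_times p q) \<subseteq> N"
  unfolding poly_times_def
proof (rule foldl_indices[where I = poly_code_indices])
  fix s m assume m: "m \<in> set (list_decode p)" and s: "poly_code_indices s \<subseteq> N"
  have "word_indices (Suc (psnd m)) \<subseteq> N" using m assms(1) by (auto simp: poly_code_indices_def)
  with s assms(2) show "poly_code_indices (poly_times_step q s m) \<subseteq> N"
    by (simp add: poly_times_step_def poly_code_indices_rev_append poly_code_indices_monomial_times)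
qed simp

lemma computable_poly_times [computable]:
  assumes "computable n A" "computable n B"
  shows "computable n (\<lambda>xs. poly_times (A xs) (B xs))"
  unfolding poly_times_def
proof (rule computable_foldl[where P = B and Z = "\<lambda>xs. 0"])
  show "computable3 poly_times_step"
    unfolding poly_times_step_def by (rule computable | simp)+
qed (intro computable assms)+

definition monomial_star :: "nat \<Rightarrow> nat" where
  "monomial_star m = pair (gaussian_cnj (pfst m)) (word_star (Suc (psnd m)) - 1)"

definition poly_star :: "nat \<Rightarrow> nat" where
  "poly_star p = foldl (\<lambda>s m. cons_code (monomial_star m) s) 0 (list_decode p)"

lemma monomial_code_value_star: "monomial_code_value v (monomial_star m) = star (monomial_code_value v m)"
  by (simp add: monomial_star_def monomial_code_value_def Suc_word_star gaussian_value_cnj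
      word_value_star star_scaleC)

lemma star_sum_list: "star (\<Sum>m\<leftarrow>ms. f m) = (\<Sum>m\<leftarrow>ms. star (f m))"
  for f :: "_ \<Rightarrow> 'a::complex_star_algebra"
  by (induction ms) (simp_all add: star_add)

lemma poly_code_value_star: "poly_code_value v (poly_star p) = star (poly_code_value v p)"
proof -
  have "poly_code_value v (cons_code (monomial_star m) s) =
      poly_code_value v s + star (monomial_code_value v m)" for s m
    by (simp add: monomial_code_value_star add.commute)
  from foldl_value[of "poly_code_value v"
      "\<lambda>s m. cons_code (monomial_star m) s" "\<lambda>m. star (monomial_code_value v m)",
      OF this]
  show ?thesis by (simp add: poly_star_def star_sum_list poly_code_value_def[of v p])
qed

lemma poly_code_indices_star:
  assumes "poly_code_indices p \<subseteq> N"
  shows "poly_code_indices (poly_star p) \<subseteq> N"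
  unfolding poly_star_def
proof (rule foldl_indices[where I = poly_code_indices])
  fix s m assume m: "m \<in> set (list_decode p)" and s: "poly_code_indices s \<subseteq> N"
  have "word_indices (Suc (psnd m)) \<subseteq> N" using m assms by (auto simp: poly_code_indices_def)
  with s show "poly_code_indices (cons_code (monomial_star m) s) \<subseteq> N"
    by (simp add: monomial_star_def Suc_word_star word_indices_star)
qed simp

lemma computable_poly_star [computable]:
  assumes "computable n A"
  shows "computable n (\<lambda>xs. poly_star (A xs))"
  unfolding poly_star_def
proof (rule computable_foldl[where f = "\<lambda>p s m. cons_code (monomial_star m) s" and P = "\<lambda>xs. 0"
      and Z = "\<lambda>xs. 0"])
  show "computable3 (\<lambda>p s m. cons_code (monomial_star m) s)"
    unfolding monomial_star_def by (rule computable | simp)+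
qed (intro computable assms)+

subsection \<open>Substitution\<close>

definition two_values :: "'a \<Rightarrow> 'a \<Rightarrow> nat \<Rightarrow> 'a" where
  "two_values x y i = (if i = 0 then x else y)"

text \<open>In the following functions \<open>e\<close> is the coded pair of the polynomials that replace the first
  indeterminate and all the others.\<close>

definition letter_subst :: "nat \<Rightarrow> nat \<Rightarrow> nat" where
  "letter_subst e l =
     (let p = if l div 2 = 0 then pfst e else psnd e in if l mod 2 = 0 then p else poly_star p)"

definition word_subst_step :: "nat \<Rightarrow> nat \<Rightarrow> nat \<Rightarrow> nat" where
  "word_subst_step e s l = poly_times s (letter_subst e l)"

text \<open>The coefficient is multiplied into the first factor, so that there is no need for an empty word.\<close>

definition monomial_subst :: "nat \<Rightarrow> nat \<Rightarrow> nat" where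
  "monomial_subst e m = foldl (word_subst_step e)
     (monomial_times (pfst m) 0 (letter_subst e (pfst (psnd m)))) (list_decode (psnd (psnd m)))"

definition poly_subst_step :: "nat \<Rightarrow> nat \<Rightarrow> nat \<Rightarrow> nat" where
  "poly_subst_step e s m = rev_append_code (monomial_subst e m) s"

definition poly_subst :: "nat \<Rightarrow> nat \<Rightarrow> nat" where
  "poly_subst e n = foldl (poly_subst_step e) 0 (list_decode n)"

context
  fixes v :: "nat \<Rightarrow> 'a::unital_cstar_algebra" and e :: nat and w :: "nat \<Rightarrow> 'a"
  defines "w \<equiv> two_values (poly_code_value v (pfst e)) (poly_code_value v (psnd e))"
begin

lemma poly_code_value_letter_subst: "poly_code_value v (letter_subst e l) = letter_code_value w l"
proof (cases "even l")
  case True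
  then show ?thesis
    by (auto simp: letter_subst_def letter_code_value_def letter_decode_if w_def two_values_def elim: evenE)
next
  case False
  then have "l mod 2 = 1" by presburger
  then show ?thesis
    using False by (simp add: letter_subst_def letter_code_value_def letter_decode_if w_def
        two_values_def poly_code_value_star)
qed

lemma poly_code_value_monomial_subst: "poly_code_value v (monomial_subst e m) = monomial_code_value w m"
proof -
  have "poly_code_value v (foldl (word_subst_step e) z ls) =
      poly_code_value v z * prod_list (map (letter_code_value w) ls)" for z ls
    by (induction ls arbitrary: z)
      (simp_all add: word_subst_step_def poly_code_value_times poly_code_value_letter_subst mult.assoc)
  then show ?thesis
    by (simp add: monomial_subst_def poly_code_value_monomial_times poly_code_value_letter_subst
        monomial_code_value_def word_value_def list_decode_Suc mult_scaleC_left)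
qed

lemma poly_code_value_subst: "poly_code_value v (poly_subst e n) = poly_code_value w n"
proof -
  have "poly_code_value v (poly_subst_step e s m) = poly_code_value v s + monomial_code_value w m" for s m
    by (simp add: poly_subst_step_def poly_code_value_rev_append poly_code_value_monomial_subst add.commute)
  from foldl_value[of "poly_code_value v"
      "poly_subst_step e" "monomial_code_value w",
      OF this]
  show ?thesis by (simp add: poly_subst_def poly_code_value_def[of w n])
qed

end

context
  fixes e N assumes e: "poly_code_indices (pfst e) \<subseteq> N" "poly_code_indices (psnd e) \<subseteq> N"
begin

lemma poly_code_indices_letter_subst: "poly_code_indices (letter_subst e l) \<subseteq> N"
  using e by (simp add: letter_subst_def Let_def poly_code_indices_star)

lemma poly_code_indices_monomial_subst: "poly_code_indices (monomial_subst e m) \<subseteq> N"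
  unfolding monomial_subst_def
proof (rule foldl_indices[where I = poly_code_indices])
  show "poly_code_indices (monomial_times (pfst m) 0 (letter_subst e (pfst (psnd m)))) \<subseteq> N"
    by (intro poly_code_indices_monomial_times poly_code_indices_letter_subst) (simp add: word_indices_def)
qed (simp add: word_subst_step_def poly_code_indices_times poly_code_indices_letter_subst)

lemma poly_code_indices_subst: "poly_code_indices (poly_subst e n) \<subseteq> N"
  unfolding poly_subst_def
  by (rule foldl_indices[where I = poly_code_indices])
    (simp_all add: poly_subst_step_def poly_code_indices_rev_append poly_code_indices_monomial_subst)

end

lemma computable_letter_subst [computable]:
  "computable n A \<Longrightarrow> computable n B \<Longrightarrow> computable n (\<lambda>xs. letter_subst (A xs) (B xs))"
  unfolding letter_subst_def Let_def by (intro computable)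

lemma computable_monomial_subst [computable]:
  assumes "computable n A" "computable n B"
  shows "computable n (\<lambda>xs. monomial_subst (A xs) (B xs))"
  unfolding monomial_subst_def
proof (rule computable_foldl[where P = A])
  show "computable3 word_subst_step"
    unfolding word_subst_step_def by (rule computable | simp)+
qed (intro computable assms)+

lemma computable_poly_subst [computable]:
  assumes "computable n A" "computable n B"
  shows "computable n (\<lambda>xs. poly_subst (A xs) (B xs))"
  unfolding poly_subst_def
proof (rule computable_foldl[where P = A and Z = "\<lambda>xs. 0"])
  show "computable3 poly_subst_step"
    unfolding poly_subst_step_def by (rule computable | simp)+
qed (intro computable assms)+

section \<open>A modulus of continuity for coded polynomials\<close>

lemma norm_letter_code_value:
  assumes "\<And>i. norm (v i) \<le> M"
  shows "norm (letter_code_value v l) \<le> M"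
  using assms by (cases "letter_decode l") (simp_all add: letter_code_value_def)

lemma norm_letter_code_value_diff:
  assumes "\<And>i. norm (v i - w i) \<le> d"
  shows "norm (letter_code_value v l - letter_code_value w l) \<le> d"
  using assms by (cases "letter_decode l") (simp_all add: letter_code_value_def flip: star_diff)

context
  fixes v w :: "nat \<Rightarrow> 'a::unital_cstar_algebra" and M d :: real
  assumes M: "1 \<le> M" and v: "\<And>i. norm (v i) \<le> M" and w: "\<And>i. norm (w i) \<le> M"
    and d: "\<And>i. norm (v i - w i) \<le> d"
begin

lemma perturbation_nonneg: "0 \<le> d"
  using order.trans[OF norm_ge_zero d] .

lemma norm_prod_letters: "norm (prod_list (map (letter_code_value w) ls)) \<le> M ^ length ls"
proof (induction ls)
  case (Cons l ls)
  have "norm (letter_code_value w l * prod_list (map (letter_code_value w) ls))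
      \<le> norm (letter_code_value w l) * norm (prod_list (map (letter_code_value w) ls))"
    by (rule norm_mult_ineq)
  also have "\<dots> \<le> M * M ^ length ls"
    using M Cons norm_letter_code_value[OF w] by (intro mult_mono) auto
  finally show ?case by simp
qed simp

lemma norm_prod_letters_diff:
  "norm (prod_list (map (letter_code_value v) ls) - prod_list (map (letter_code_value w) ls))
     \<le> length ls * M ^ length ls * d"
proof (induction ls)
  case (Cons l ls)
  let ?x = "letter_code_value v l" and ?y = "letter_code_value w l"
  let ?p = "prod_list (map (letter_code_value v) ls)" and ?q = "prod_list (map (letter_code_value w) ls)"
  have "?x * ?p - ?y * ?q = ?x * (?p - ?q) + (?x - ?y) * ?q" by (simp add: algebra_simps)
  then have "norm (?x * ?p - ?y * ?q) \<le> norm (?x * (?p - ?q)) + norm ((?x - ?y) * ?q)"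
    by (simp add: norm_triangle_ineq)
  also have "norm (?x * (?p - ?q)) \<le> norm ?x * norm (?p - ?q)" by (rule norm_mult_ineq)
  also have "norm ?x * norm (?p - ?q) \<le> M * (length ls * M ^ length ls * d)"
    using M Cons norm_letter_code_value[OF v] by (intro mult_mono) auto
  also have "norm ((?x - ?y) * ?q) \<le> norm (?x - ?y) * norm ?q" by (rule norm_mult_ineq)
  also have "norm (?x - ?y) * norm ?q \<le> d * M ^ length ls"
    using norm_letter_code_value_diff[OF d] norm_prod_letters perturbation_nonneg by (intro mult_mono) auto
  also have "d * M ^ length ls \<le> d * (M * M ^ length ls)"
    using M perturbation_nonneg mult_right_mono[of 1 M "M ^ length ls"] by (intro mult_left_mono) auto
  finally show ?case by (simp add: algebra_simps)
qed simp

text \<open>The code \<open>n\<close> is larger than the codes of all its parts. It bounds the number of monomials and the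
  length of each word; the moduli of the coefficients are at most \<open>2 * n\<close>.\<close>

lemma norm_poly_code_value_diff:
  "norm (poly_code_value v n - poly_code_value w n) \<le> 2 * real n ^ 3 * M ^ n * d"
proof -
  have mon: "norm (monomial_code_value v m - monomial_code_value w m) \<le> 2 * real n ^ 2 * M ^ n * d"
    if m: "m \<in> set (list_decode n)" for m
  proof -
    let ?l = "list_decode (Suc (psnd m))"
    have mn: "Suc (psnd m) \<le> n" using set_list_decode_less[OF m] psnd_le[of m] by simp
    then have len: "length ?l \<le> n" using length_list_decode_le le_trans by blast
    have "real (length ?l) * M ^ length ?l * d \<le> real n * M ^ n * d"
      using len M perturbation_nonneg by (intro mult_right_mono mult_mono power_increasing) auto
    then have w: "norm (word_value v (Suc (psnd m)) - word_value w (Suc (psnd m))) \<le> real n * M ^ n * d"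
      using norm_prod_letters_diff[of ?l] by (simp add: word_value_def)
    have "cmod (gaussian_value (pfst m)) \<le> 2 * real (pfst m)" by (rule cmod_gaussian_value_le)
    also have "\<dots> \<le> 2 * real n" using pfst_le[of m] set_list_decode_less[OF m] by simp
    finally have "cmod (gaussian_value (pfst m)) *
        norm (word_value v (Suc (psnd m)) - word_value w (Suc (psnd m))) \<le> 2 * real n * (real n * M ^ n * d)"
      using w by (intro mult_mono) auto
    then show ?thesis
      by (simp add: monomial_code_value_def scaleC_diff_right[symmetric] norm_scaleC power2_eq_square mult.assoc)
  qed
  have sum: "norm ((\<Sum>m\<leftarrow>ms. f m) - (\<Sum>m\<leftarrow>ms. g m)) \<le> length ms * c"
    if "\<And>m. m \<in> set ms \<Longrightarrow> norm (f m - g m) \<le> c" for ms and f g :: "nat \<Rightarrow> 'a" and c :: real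
    using that
  proof (induction ms)
    case (Cons m ms)
    have "norm ((f m - g m) + ((\<Sum>m\<leftarrow>ms. f m) - (\<Sum>m\<leftarrow>ms. g m))) \<le> c + length ms * c"
      using Cons by (intro order.trans[OF norm_triangle_ineq] add_mono) auto
    then show ?case by (simp add: algebra_simps)
  qed simp
  have "norm (poly_code_value v n - poly_code_value w n)
      \<le> length (list_decode n) * (2 * real n ^ 2 * M ^ n * d)"
    unfolding poly_code_value_def by (rule sum) (rule mon)
  also have "\<dots> \<le> real n * (2 * real n ^ 2 * M ^ n * d)"
    using length_list_decode_le M perturbation_nonneg by (intro mult_right_mono) auto
  finally show ?thesis by (simp add: power3_eq_cube power2_eq_square mult_ac)
qed

end

text \<open>Since \<open>n < 2\<^sup>n\<close>, a precision that is linear in the code \<open>n\<close> suffices.\<close>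

lemma norm_poly_code_value_diff_less:
  fixes v w :: "nat \<Rightarrow> 'a::unital_cstar_algebra"
  assumes "\<And>i. norm (v i) \<le> 2 ^ e" "\<And>i. norm (w i) \<le> 2 ^ e"
    and "\<And>i. norm (v i - w i) \<le> 1 / 2 ^ (k + 1 + (3 + e) * n)"
  shows "norm (poly_code_value v n - poly_code_value w n) < 1 / 2 ^ k"
proof -
  let ?d = "1 / 2 ^ (k + 1 + (3 + e) * n) :: real"
  have "norm (poly_code_value v n - poly_code_value w n) \<le> 2 * real n ^ 3 * (2 ^ e) ^ n * ?d"
    by (rule norm_poly_code_value_diff) (use assms in auto)
  also have "\<dots> < 2 * (2 ^ n) ^ 3 * (2 ^ e) ^ n * ?d"
    using of_nat_less_two_power[of n, where ?'a = real]
    by (intro mult_strict_right_mono mult_strict_left_mono power_strict_mono) auto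
  also have "\<dots> = 1 / 2 ^ k"
    by (simp add: power_add power_mult[symmetric] mult.commute[of n] distrib_right power_mult_distrib)
  finally show ?thesis .
qed

text \<open>Substituting generated points within \<open>2\<^sup>-\<^sup>j\<close> of \<open>x\<close> and \<open>y\<close> into the polynomial coded by
  \<open>n\<close> produces the code of a generated point for every \<open>n\<close>, as all indeterminates but the first
  are replaced by \<open>y\<close>; the accuracy \<open>j\<close> comes from the modulus of continuity.\<close>

theorem computable_poly_approximation:
  fixes P :: "'a::unital_cstar_algebra presentation"
  assumes P: "points P = UNIV" "nrm P = norm"
    and x: "computable_point P x" and y: "computable_point P y"
  shows "\<exists>T. computable2 T \<and> (\<forall>n k. T n k \<in> codes P \<and>
    norm (poly_code_value (two_values x y) n - generated_point P (T n k)) < 1 / 2 ^ k)"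
proof -
  obtain p \<xi> where \<xi>: "\<And>k. computes0 p [k] (\<xi> k)" "is_name P \<xi> x"
    using x unfolding computable_point_def by blast
  obtain q \<eta> where \<eta>: "\<And>k. computes0 q [k] (\<eta> k)" "is_name P \<eta> y"
    using y unfolding computable_point_def by blast
  have c\<xi>: "computable1 \<xi>" and c\<eta>: "computable1 \<eta>"
    using \<xi>(1) \<eta>(1) by (auto intro!: computable_computes0 simp: length_Suc_conv)
  note [computable] = computable_app1[OF c\<xi>] computable_app1[OF c\<eta>]
  obtain e :: nat where e: "norm x + norm y + 1 < 2 ^ e"
    using real_arch_pow[of 2 "norm x + norm y + 1"] by auto
  define J where "J n k = k + 1 + (3 + e) * n" for n k :: nat
  define T where "T n k = poly_subst (pair (\<xi> (J n k)) (\<eta> (J n k))) n" for n k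
  have "computable2 T" unfolding T_def J_def by (rule computable | simp)+
  moreover have "T n k \<in> codes P \<and>
    norm (poly_code_value (two_values x y) n - generated_point P (T n k)) < 1 / 2 ^ k" for n k
  proof
    let ?j = "J n k"
    have codes: "codes P = {m. poly_code_indices m \<subseteq> {i. enat i < num_special P}}"
      by (auto simp: codes_def poly_indices_decode)
    have mem: "\<xi> ?j \<in> codes P" "\<eta> ?j \<in> codes P" using \<xi>(2) \<eta>(2) by (auto simp: is_name_def)
    then show "T n k \<in> codes P"
      unfolding codes T_def mem_Collect_eq by (intro poly_code_indices_subst) simp_all
    define x' where "x' = generated_point P (\<xi> ?j)"
    define y' where "y' = generated_point P (\<eta> ?j)"
    have near: "norm (x - x') < 1 / 2 ^ ?j" "norm (y - y') < 1 / 2 ^ ?j"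
      using \<xi>(2) \<eta>(2) P by (auto simp: is_name_def x'_def y'_def)
    have le1: "1 / 2 ^ ?j \<le> (1::real)" by simp
    have x': "norm x' \<le> norm x + 1" and y': "norm y' \<le> norm y + 1"
      using near le1 norm_triangle_ineq2[of x' x] norm_triangle_ineq2[of y' y]
      unfolding norm_minus_commute[of _ x] norm_minus_commute[of _ y] by linarith+
    have le: "norm x \<le> 2 ^ e" "norm y \<le> 2 ^ e" "norm x' \<le> 2 ^ e" "norm y' \<le> 2 ^ e"
      using e x' y' norm_ge_zero[of x] norm_ge_zero[of y] by linarith+
    have "generated_point P (T n k) = poly_code_value (two_values x' y') n"
      by (simp add: generated_point_def poly_value_decode T_def poly_code_value_subst x'_def y'_def)
    moreover have "norm (poly_code_value (two_values x y) n - poly_code_value (two_values x' y') n) < 1 / 2 ^ k"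
    proof (rule norm_poly_code_value_diff_less[where e = e])
      fix i
      show "norm (two_values x y i) \<le> 2 ^ e"
        using le by (simp add: two_values_def)
      show "norm (two_values x' y' i) \<le> 2 ^ e"
        using le by (simp add: two_values_def)
      show "norm (two_values x y i - two_values x' y' i) \<le> 1 / 2 ^ (k + 1 + (3 + e) * n)"
        using near by (simp add: two_values_def J_def)
    qed
    ultimately show "norm (poly_code_value (two_values x y) n - generated_point P (T n k)) < 1 / 2 ^ k"
      by simp
  qed
  ultimately show ?thesis by blast
qed

section \<open>The functional calculus is computable\<close>

lemma poly_pair_poly_value:
  "poly_pair a (poly_value (special (C_presentation (spectrum a))) p) (poly_value (two_values 1 a) p)"
proof -
  let ?s = "special (C_presentation (spectrum a))" and ?v = "two_values 1 a"
  have base: "poly_pair a (?s i) (?v i)" for i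
    by (simp add: C_presentation_def two_values_def poly_pair.one poly_pair.ident)
  have letter: "poly_pair a (letter_value ?s l) (letter_value ?v l)" for l
    using base by (cases l) (auto intro: poly_pair.star)
  have word: "poly_pair a f x \<Longrightarrow> poly_pair a (foldl (\<lambda>x m. x * letter_value ?s m) f ls)
      (foldl (\<lambda>x m. x * letter_value ?v m) x ls)" for f x ls
    by (induction ls arbitrary: f x) (auto intro: poly_pair.mult letter)
  have mono: "poly_pair a (monomial_value ?s m) (monomial_value ?v m)" for m
    by (cases m) (auto intro!: poly_pair.scaleC word letter)
  show ?thesis
    unfolding poly_value_def
  proof (induction p)
    case Nil
    show ?case by (simp only: list.map sum_list.Nil poly_pair_zero)
  next
    case (Cons m p)
    then show ?case by (simp only: list.map sum_list.Cons poly_pair.add mono)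
  qed
qed

text \<open>A name of \<open>f\<close> consists of codes of polynomials close to \<open>f\<close>. Their values at \<open>a\<close> are just as
  close to \<open>f(a)\<close>. Taking the term of index \<open>k + 1\<close> leaves half of the admitted error to the
  approximation of that value by a generated point.\<close>

theorem computable_functional_calculus:
  fixes P :: "'a::unital_cstar_algebra presentation"
  assumes P: "points P = UNIV" "nrm P = norm"
    and one: "computable_point P 1" and n: "normal_element a" and a: "computable_point P a"
  shows "computable_map (C_presentation (spectrum a)) P (functional_calculus a)"
proof -
  interpret normal_element_calculus a by standard (rule n)
  obtain T where T: "computable2 T" "\<And>n k. T n k \<in> codes P"
    "\<And>n k. norm (poly_code_value (two_values 1 a) n - generated_point P (T n k)) < 1 / 2 ^ k"
    using computable_poly_approximation[OF P one a] by blast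
  obtain t where t: "\<And>\<alpha> x y. computes \<alpha> t [x, y] (T x y)"
    using T(1) unfolding computable_def by (metis length_Cons list.size(3) nth_Cons_0 nth_Cons_Suc
        numeral_2_eq_2 One_nat_def)
  define p where "p = Comp t [Comp Query [Comp Succ [Proj 0]], Comp Succ [Proj 0]]"
  have p: "computes \<alpha> p [k] (T (\<alpha> (Suc k)) (Suc k))" for \<alpha> k
  proof -
    have "computes \<alpha> (Proj 0) [k] k" using computes.proj[of 0 "[k]" \<alpha>] by simp
    then have s: "computes \<alpha> (Comp Succ [Proj 0]) [k] (Suc k)"
      by (intro computes.comp[where ys = "[k]"] computes.succ) simp
    then have "computes \<alpha> (Comp Query [Comp Succ [Proj 0]]) [k] (\<alpha> (Suc k))"
      by (intro computes.comp[where ys = "[Suc k]"] computes.query) simp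
    with s show ?thesis
      unfolding p_def by (intro computes.comp[where ys = "[\<alpha> (Suc k), Suc k]"] t) simp
  qed
  have "is_name P (\<lambda>k. T (\<alpha> (Suc k)) (Suc k)) (functional_calculus a f)"
    if f: "f \<in> points (C_presentation (spectrum a))" and \<alpha>: "is_name (C_presentation (spectrum a)) \<alpha> f"
    for f \<alpha>
    unfolding is_name_def
  proof (intro conjI allI)
    show "functional_calculus a f \<in> points P" using P by simp
    fix k
    show "T (\<alpha> (Suc k)) (Suc k) \<in> codes P" by (rule T)
    let ?n = "\<alpha> (Suc k)"
    let ?y = "poly_code_value (two_values 1 a) ?n"
    have pp: "poly_pair a (generated_point (C_presentation (spectrum a)) ?n) ?y"
      unfolding generated_point_def poly_value_decode[symmetric] by (rule poly_pair_poly_value)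
    have fC: "f \<in> C_functions (spectrum a)" using f by (simp add: C_presentation_def)
    have "nrm (C_presentation (spectrum a)) (f - generated_point (C_presentation (spectrum a)) ?n)
        < 1 / 2 ^ Suc k"
      using \<alpha> unfolding is_name_def by blast
    then have "sup_norm (spectrum a) (f - generated_point (C_presentation (spectrum a)) ?n) < 1 / 2 ^ Suc k"
      by (simp add: C_presentation_def)
    then have "norm (functional_calculus a f - ?y) < 1 / 2 ^ Suc k"
      using functional_calculus_approx[OF fC pp] by (rule le_less_trans[rotated])
    moreover have "norm (?y - generated_point P (T ?n (Suc k))) < 1 / 2 ^ Suc k" by (rule T)
    ultimately have "norm (functional_calculus a f - generated_point P (T ?n (Suc k)))
        < 1 / 2 ^ Suc k + 1 / 2 ^ Suc k"
      by (rule norm_diff_triangle_less)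
    then show "nrm P (functional_calculus a f - generated_point P (T ?n (Suc k))) < 1 / 2 ^ k"
      by (simp add: P)
  qed
  with p show ?thesis
    unfolding computable_map_def
    by (intro exI[of _ p] ballI allI impI exI[of _ "\<lambda>k. T (_ (Suc k)) (Suc k)"] conjI)
qed

section \<open>The spectrum is computably compact\<close>

text \<open>The Gaussian rational whose real part is the integer with code \<open>x\<close>: the code of the integer
  \<open>1\<close> is \<open>2\<close>, and \<open>0\<close> is a code of the rational number \<open>0\<close>.\<close>

definition rat_code :: "nat \<Rightarrow> nat" where "rat_code x = pair (pair x 2) 0"

text \<open>Codes of \<open>a - \<lambda>\<close> and \<open>C - (a - \<lambda>)\<^sup>* (a - \<lambda>)\<close> for the Gaussian rational \<open>\<lambda>\<close> coded by
  \<open>c\<close>. The letters \<open>0\<close> and \<open>2\<close> are the two indeterminates, which stand for the unit and for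
  \<open>a\<close>; the integers \<open>1\<close>, \<open>-1\<close> and \<open>C\<close> have the codes \<open>2\<close>, \<open>1\<close> and \<open>2 * C\<close>.\<close>

definition translate_code :: "nat \<Rightarrow> nat" where
  "translate_code c = cons_code (pair (rat_code 2) (pair 2 0))
     (monomial_times (rat_code (Suc 0)) 0 (cons_code (pair c (pair 0 0)) 0))"

definition distance_code :: "nat \<Rightarrow> nat \<Rightarrow> nat" where
  "distance_code C c = rev_append_code (cons_code (pair (rat_code (2 * C)) (pair 0 0)) 0)
     (monomial_times (rat_code (Suc 0)) 0 (poly_times (poly_star (translate_code c)) (translate_code c)))"

lemma gaussian_value_rat_code:
  "gaussian_value (rat_code (2 * n)) = of_nat n" "gaussian_value (rat_code (Suc 0)) = -1"
proof -
  have "nat_to_rat_surj (pair (2 * n) 2) = of_nat n" "nat_to_rat_surj (pair (Suc 0) 2) = -1"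
    by (simp_all add: nat_to_rat_surj_eq int_decode_if Fract_of_int_quotient)
  then show "gaussian_value (rat_code (2 * n)) = of_nat n" "gaussian_value (rat_code (Suc 0)) = -1"
    by (simp_all add: gaussian_value_eq rat_code_def complex_eq_iff)
qed

lemma word_value_letter: "word_value v (Suc (pair l 0)) = letter_code_value v l"
  by (simp add: word_value_def list_decode_Suc)

lemma word_value_0: "word_value v 0 = 1"
  by (simp add: word_value_def)

lemma poly_code_value_translate:
  "poly_code_value (two_values 1 a) (translate_code c) = a - scaleC (gaussian_value c) 1"
  using gaussian_value_rat_code(1)[of 1]
  by (simp add: translate_code_def monomial_code_value_def word_value_letter word_value_0
      poly_code_value_monomial_times gaussian_value_rat_code letter_code_value_def letter_decode_if
      two_values_def scaleC_algebra)

lemma poly_code_value_distance: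
  "poly_code_value (two_values 1 a) (distance_code C c) = scaleC (of_nat C) 1 -
     star (a - scaleC (gaussian_value c) 1) * (a - scaleC (gaussian_value c) 1)"
  unfolding distance_code_def poly_code_value_rev_append poly_code_value_monomial_times
    poly_code_value_times poly_code_value_star poly_code_value_translate poly_code_value_cons
    monomial_code_value_def prod_encode_inverse fst_conv snd_conv gaussian_value_rat_code
    word_value_letter word_value_0
  by (simp add: letter_code_value_def letter_decode_if two_values_def scaleC_minus_left scaleC_one)

lemma computable_distance_code [computable]:
  "computable n A \<Longrightarrow> computable n B \<Longrightarrow> computable n (\<lambda>xs. distance_code (A xs) (B xs))"
  unfolding distance_code_def translate_code_def rat_code_def by (intro computable)

text \<open>The function \<open>C - \<bar>z - \<lambda>\<bar>\<^sup>2\<close> of this element is nonnegative on the spectrum if \<open>C\<close> is large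
  enough, and its maximum is attained at the points closest to \<open>\<lambda>\<close>.\<close>

lemma (in normal_element_calculus) norm_distance_element:
  fixes l :: complex and C :: nat
  defines "x \<equiv> scaleC (of_nat C) 1 - star (a - scaleC l 1) * (a - scaleC l 1)"
  assumes C: "\<And>z. z \<in> spectrum a \<Longrightarrow> (cmod (z - l))\<^sup>2 \<le> real C"
  shows "\<And>z. z \<in> spectrum a \<Longrightarrow> real C - (cmod (z - l))\<^sup>2 \<le> norm x"
    and "\<exists>z\<in>spectrum a. norm x = real C - (cmod (z - l))\<^sup>2"
proof -
  let ?K = "spectrum a"
  define f where "f = scaleC (of_nat C) (C_one ?K) -
    star (C_id ?K - scaleC l (C_one ?K)) * (C_id ?K - scaleC l (C_one ?K))"
  have p: "poly_pair a f x"
    unfolding f_def x_def by (intro poly_pair.intros poly_pair_diff)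
  note fC = poly_pair_C_functions[OF p]
  have val: "cmod (f z) = real C - (cmod (z - l))\<^sup>2" if z: "z \<in> ?K" for z
  proof -
    have "f z = of_nat C - cnj (z - l) * (z - l)"
      using z by (simp add: f_def fun_diff_def times_fun_def scaleC_fun_def star_fun_def C_one_def
          C_id_def scaleC_complex_def star_complex_def)
    also have "cnj (z - l) * (z - l) = of_real ((cmod (z - l))\<^sup>2)"
      by (metis complex_norm_square mult.commute)
    finally have "f z = of_real (real C - (cmod (z - l))\<^sup>2)" by simp
    then show ?thesis using C[OF z] by (simp only: norm_of_real)
  qed
  show "real C - (cmod (z - l))\<^sup>2 \<le> norm x" if "z \<in> ?K" for z
    using sup_norm_upper[OF compact_spectrum fC that] val[OF that] by (simp add: poly_pair_norm[OF p])
  show "\<exists>z\<in>?K. norm x = real C - (cmod (z - l))\<^sup>2"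
    using sup_norm_attained[OF compact_spectrum spectrum_nonempty fC] val
    by (auto simp: poly_pair_norm[OF p])
qed

text \<open>A test for \<open>t / s < x / y\<close>, where \<open>x / y\<close> is the rational number coded by \<open>q\<close>. For positive
  \<open>t / s\<close> the numerator and the denominator must have the same sign, and then their absolute values
  are compared. The denominator zero has to be excluded.\<close>

definition rat_code_greater :: "nat \<Rightarrow> nat \<Rightarrow> nat \<Rightarrow> bool" where
  "rat_code_greater q t s \<longleftrightarrow> pfst q mod 2 = psnd q mod 2 \<and> 0 < psnd q \<and>
     t * ((psnd q + 1) div 2) < (pfst q + 1) div 2 * s"

lemma rat_code_greater_iff:
  assumes t: "0 < t" and s: "0 < s"
  shows "rat_code_greater q t s \<longleftrightarrow> real t / real s < real_of_rat (nat_to_rat_surj q)"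
proof -
  define x where "x = int_decode (pfst q)"
  define y where "y = int_decode (psnd q)"
  define X where "X = (pfst q + 1) div 2"
  define Y where "Y = (psnd q + 1) div 2"
  have r: "real_of_rat (nat_to_rat_surj q) = x / y"
    by (simp add: nat_to_rat_surj_eq x_def y_def Fract_of_int_quotient of_rat_divide)
  have val: "int_decode n = (if even n then int ((n + 1) div 2) else - int ((n + 1) div 2))" for n
    by (auto simp: int_decode_if elim!: evenE oddE)
  have x: "x = (if even (pfst q) then int X else - int X)"
    and y: "y = (if even (psnd q) then int Y else - int Y)"
    unfolding x_def y_def X_def Y_def by (rule val)+
  have Y0: "Y = 0 \<longleftrightarrow> psnd q = 0" unfolding Y_def by presburger
  have pos: "0 < real t / real s" using t s by simp
  show ?thesis
  proof (cases "pfst q mod 2 = psnd q mod 2 \<and> 0 < psnd q")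
    case True
    then have par: "even (pfst q) = even (psnd q)" by presburger
    have "0 < Y" using True Y0 by simp
    have "x / y = real X / real Y" using par by (simp add: x y)
    moreover have "real t / real s < real X / real Y \<longleftrightarrow> t * Y < X * s"
      using \<open>0 < Y\<close> s
      by (simp add: divide_less_eq less_divide_eq mult.commute flip: of_nat_mult)
    ultimately show ?thesis using True by (simp add: rat_code_greater_def r X_def Y_def)
  next
    case False
    have "real_of_int x / real_of_int y \<le> 0"
    proof (cases "psnd q = 0")
      case True
      then have "Y = 0" using Y0 by blast
      then show ?thesis by (simp add: y)
    next
      case neq: False
      with False have "even (pfst q) \<noteq> even (psnd q)" by presburger
      then show ?thesis by (auto simp: x y divide_nonpos_nonneg divide_nonneg_nonpos)
    qed
    then show ?thesis using False pos by (auto simp: rat_code_greater_def r)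
  qed
qed

lemma decidable_rat_code_greater [computable]:
  "computable n A \<Longrightarrow> computable n B \<Longrightarrow> computable n C \<Longrightarrow>
    decidable n (\<lambda>xs. rat_code_greater (A xs) (B xs) (C xs))"
  unfolding rat_code_greater_def by (intro computable)

primrec filter_code :: "(nat \<Rightarrow> nat \<Rightarrow> bool) \<Rightarrow> nat \<Rightarrow> nat \<Rightarrow> nat" where
  "filter_code Q 0 k = 0"
| "filter_code Q (Suc c) k = (if Q c k then cons_code c (filter_code Q c k) else filter_code Q c k)"

lemma set_filter_code: "set (list_decode (filter_code Q b k)) = {c. c < b \<and> Q c k}"
  by (induction b) (auto simp: less_Suc_eq)

lemma computable_filter_code:
  assumes Q: "decidable 3 (\<lambda>xs. Q (xs ! 0) (xs ! 2))"
  shows "computable2 (filter_code Q)"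
  by (rule computable2_rec[where b = "\<lambda>k. 0" and g = "\<lambda>c y k. if Q c k then cons_code c y else y"])
    (rule computable Q | simp)+

lemma pair_mono: "x \<le> x' \<Longrightarrow> y \<le> y' \<Longrightarrow> pair x y \<le> pair x' y'"
  unfolding prod_encode_def case_prod_conv by (intro add_mono triangle_mono)

lemma int_encode_le: "int_encode i \<le> 2 * nat \<bar>i\<bar>"
  by (auto simp: int_encode_def sum_encode_def)

lemma four_power: "(4::real) ^ k = (2 ^ k)\<^sup>2"
  by (simp add: power2_eq_square flip: power_mult_distrib)

text \<open>The bound exceeds the codes of all points with coordinates \<open>m / 2\<^sup>k\<^sup>+\<^sup>1\<close>, where
  \<open>\<bar>m\<bar> \<le> R * 2\<^sup>k\<^sup>+\<^sup>1 + 1\<close>. All smaller codes are searched, so that the grid itself need not be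
  enumerated.\<close>

definition grid_bound :: "nat \<Rightarrow> nat \<Rightarrow> nat" where
  "grid_bound R k = (let x = pair (2 * (R * 2 ^ (k + 1) + 1)) (2 * 2 ^ (k + 1)) in Suc (pair x x))"

text \<open>Rounding both coordinates of \<open>z\<close> down to multiples of \<open>2\<^sup>-\<^sup>(\<^sup>k\<^sup>+\<^sup>1\<^sup>)\<close> moves it by at most
  the diagonal of a square of the grid.\<close>

lemma grid_point_exists:
  assumes z: "cmod z \<le> real R"
  shows "\<exists>c<grid_bound R k. (cmod (z - gaussian_value c))\<^sup>2 \<le> 2 / 4 ^ (k + 1)"
proof -
  define D where "D = (2::nat) ^ (k + 1)"
  define code where "code r = pair (int_encode \<lfloor>r * real D\<rfloor>) (2 * D)" for r
  have D: "0 < D" by (simp add: D_def)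
  have D2: "int_decode (2 * D) = int D" by (simp add: int_decode_if)
  have val: "real_of_rat (nat_to_rat_surj (code r)) = \<lfloor>r * real D\<rfloor> / real D" for r
    by (simp add: code_def nat_to_rat_surj_eq D2 Fract_of_int_quotient of_rat_divide)
  have near: "(r - \<lfloor>r * real D\<rfloor> / real D)\<^sup>2 \<le> 1 / 4 ^ (k + 1)" for r
  proof -
    have "r - \<lfloor>r * real D\<rfloor> / real D = (r * real D - \<lfloor>r * real D\<rfloor>) / real D"
      using D by (simp add: field_simps)
    moreover have "0 \<le> r * real D - \<lfloor>r * real D\<rfloor>" "r * real D - \<lfloor>r * real D\<rfloor> \<le> 1" by linarith+
    ultimately have "(r - \<lfloor>r * real D\<rfloor> / real D)\<^sup>2 \<le> (1 / real D)\<^sup>2"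
      using D by (intro power_mono) (simp_all add: divide_right_mono)
    also have "(1 / real D)\<^sup>2 = 1 / 4 ^ (k + 1)"
      unfolding four_power by (simp add: D_def power_divide)
    finally show ?thesis .
  qed
  have bound: "code r \<le> pair (2 * (R * D + 1)) (2 * D)" if r: "\<bar>r\<bar> \<le> real R" for r
  proof -
    have "\<bar>r * real D\<bar> \<le> real (R * D)" using r by (simp add: abs_mult mult_right_mono)
    then have "\<bar>\<lfloor>r * real D\<rfloor>\<bar> \<le> int (R * D) + 1" by linarith
    then have "nat \<bar>\<lfloor>r * real D\<rfloor>\<bar> \<le> R * D + 1" by linarith
    then have "int_encode \<lfloor>r * real D\<rfloor> \<le> 2 * (R * D + 1)"
      by (rule order.trans[OF int_encode_le mult_le_mono2])
    then show ?thesis unfolding code_def by (intro pair_mono) auto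
  qed
  define c where "c = pair (code (Re z)) (code (Im z))"
  have "c < grid_bound R k"
    unfolding grid_bound_def Let_def less_Suc_eq_le c_def D_def[symmetric]
    using z abs_Re_le_cmod[of z] abs_Im_le_cmod[of z] by (intro pair_mono bound) linarith+
  moreover have "(cmod (z - gaussian_value c))\<^sup>2 \<le> 1 / 4 ^ (k + 1) + 1 / 4 ^ (k + 1)"
    unfolding cmod_power2 using near[of "Re z"] near[of "Im z"]
    by (intro add_mono) (simp_all add: gaussian_value_eq c_def val)
  ultimately show ?thesis by auto
qed

text \<open>With \<open>d\<close> the distance of a Gaussian rational from the spectrum, the norm \<open>C - d\<^sup>2\<close> is computed with
  error less than \<open>1/2\<close> in units of \<open>4\<^sup>-\<^sup>(\<^sup>k\<^sup>+\<^sup>1\<^sup>)\<close>, and the point is accepted if the result says that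
  \<open>d\<^sup>2 < 3\<close> in these units. An accepted point has \<open>d\<^sup>2 < 4\<close>, that is, \<open>d < 2\<^sup>-\<^sup>k\<close>, as required. All points
  with \<open>d\<^sup>2 \<le> 2\<close> are accepted, and every point of the spectrum has a grid point at such a distance.\<close>

theorem spectrum_computably_compact:
  fixes P :: "'a::unital_cstar_algebra presentation"
  assumes P: "points P = UNIV" "nrm P = norm" and comp: "computable_presentation P"
    and one: "computable_point P 1" and n: "normal_element a" and a: "computable_point P a"
  shows "computably_compact (spectrum a)"
proof -
  interpret normal_element_calculus a by standard (rule n)
  obtain T where T: "computable2 T" "\<And>n k. T n k \<in> codes P"
    "\<And>n k. norm (poly_code_value (two_values 1 a) n - generated_point P (T n k)) < 1 / 2 ^ k"
    using computable_poly_approximation[OF P one a] by blast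
  obtain p where "\<forall>n\<in>codes P. \<forall>k. \<exists>q. computes0 p [n, k] q \<and>
      \<bar>norm (generated_point P n) - of_rat (nat_to_rat_surj q)\<bar> < 1 / 2 ^ k"
    using comp unfolding computable_presentation_def P(2) by blast
  then obtain N where N: "\<And>n k. n \<in> codes P \<Longrightarrow> computes0 p [n, k] (N n k)"
    "\<And>n k. n \<in> codes P \<Longrightarrow> \<bar>norm (generated_point P n) - of_rat (nat_to_rat_surj (N n k))\<bar> < 1 / 2 ^ k"
    by metis
  obtain R :: nat where R: "norm a \<le> real R" using real_arch_simple by blast
  \<comment> \<open>\<open>R + 2 c\<close> bounds the distance of the point with code \<open>c\<close> from spectral values, and the summand
    \<open>1\<close> keeps the threshold \<open>4\<^sup>k\<^sup>+\<^sup>1 C - 3\<close> positive.\<close>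
  define C where "C c = (R + 2 * c) ^ 2 + 1" for c
  \<comment> \<open>Two errors of \<open>2\<^sup>-\<^sup>(\<^sup>2\<^sup>k\<^sup>+\<^sup>4\<^sup>)\<close> add up to half of \<open>4\<^sup>-\<^sup>(\<^sup>k\<^sup>+\<^sup>1\<^sup>)\<close>.\<close>
  define r where "r c k = N (T (distance_code (C c) c) (2 * k + 4)) (2 * k + 4)" for c k
  define Q where "Q c k \<longleftrightarrow> rat_code_greater (r c k) (4 ^ (k + 1) * C c - 3) (4 ^ (k + 1))" for c k
  define L where "L k = filter_code Q (grid_bound R k) k" for k
  have "decidable 3 (\<lambda>xs. Q (xs ! 0) (xs ! 2))"
    unfolding Q_def r_def C_def
    by (rule computable computable_partial_app2[of "codes P" p N] N(1) T(2) computable_app2[OF T(1)] | simp)+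
  note cQ = computable_filter_code[OF this]
  have "computable1 L"
    unfolding L_def grid_bound_def Let_def by (rule computable computable_app2[OF cQ] | simp)+
  then obtain s where s: "\<And>k. computes0 s [k] (L k)" using computable_computes0D by blast
  have zR: "cmod z \<le> real R" if "z \<in> spectrum a" for z
    using spectrum_norm_le[OF that] R by simp
  let ?x = "\<lambda>c. scaleC (of_nat (C c)) 1 -
    star (a - scaleC (gaussian_value c) 1) * (a - scaleC (gaussian_value c) 1)"
  have Cz: "(cmod (z - gaussian_value c))\<^sup>2 \<le> real (C c)" if z: "z \<in> spectrum a" for z c
  proof -
    have "cmod (z - gaussian_value c) \<le> real R + 2 * real c"
      using norm_triangle_ineq4[of z "gaussian_value c"] zR[OF z] cmod_gaussian_value_le[of c] by linarith
    then have "(cmod (z - gaussian_value c))\<^sup>2 \<le> (real R + 2 * real c)\<^sup>2" by (rule power_mono) simp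
    moreover have "real (C c) = (real R + 2 * real c)\<^sup>2 + 1" by (simp add: C_def)
    ultimately show ?thesis by linarith
  qed
  have r: "\<bar>norm (?x c) - of_rat (nat_to_rat_surj (r c k))\<bar> < 1 / 2 / 4 ^ (k + 1)" for c k
  proof -
    let ?g = "generated_point P (T (distance_code (C c) c) (2 * k + 4))"
    have "\<bar>norm (?x c) - norm ?g\<bar> < 1 / 2 ^ (2 * k + 4)"
      using T(3)[of "distance_code (C c) c" "2 * k + 4"]
        norm_triangle_ineq3[of "?x c" ?g] unfolding poly_code_value_distance by linarith
    moreover have "\<bar>norm ?g - of_rat (nat_to_rat_surj (r c k))\<bar> < 1 / 2 ^ (2 * k + 4)"
      unfolding r_def by (rule N(2)[OF T(2)])
    moreover have "1 / 2 ^ (2 * k + 4) + 1 / 2 ^ (2 * k + 4) = (1 / 2 / 4 ^ (k + 1) :: real)"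
      by (simp add: power_add power_mult)
    ultimately show ?thesis by linarith
  qed
  have Q: "Q c k \<longleftrightarrow> real (C c) - 3 / 4 ^ (k + 1) < of_rat (nat_to_rat_surj (r c k))" for c k
  proof -
    have ge: "4 \<le> 4 ^ (k + 1) * C c"
      using mult_le_mono[of 4 "4 ^ (k + 1)" 1 "C c"] by (simp add: C_def)
    have "real (s * C c - 3) / real s = real (C c) - 3 / real s" if "0 < s" "4 \<le> s * C c" for s
      using that by (simp add: of_nat_diff diff_divide_distrib)
    from this[of "4 ^ (k + 1)"] ge
    have "real (4 ^ (k + 1) * C c - 3) / real (4 ^ (k + 1)) = real (C c) - 3 / 4 ^ (k + 1)"
      by simp
    moreover have "Q c k \<longleftrightarrow> real (4 ^ (k + 1) * C c - 3) / real (4 ^ (k + 1)) <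
        real_of_rat (nat_to_rat_surj (r c k))"
      unfolding Q_def
    proof (rule rat_code_greater_iff)
      show "0 < 4 ^ (k + 1) * C c - 3" using ge by linarith
    qed simp
    ultimately show ?thesis by (simp only:)
  qed
  have acc: "\<exists>z\<in>spectrum a. (cmod (z - gaussian_value c))\<^sup>2 < (1 / 2 ^ k)\<^sup>2" if "Q c k" for c k
  proof -
    obtain z where z: "z \<in> spectrum a" "norm (?x c) = real (C c) - (cmod (z - gaussian_value c))\<^sup>2"
      using norm_distance_element(2)[OF Cz] by blast
    have "(cmod (z - gaussian_value c))\<^sup>2 < 3 / 4 ^ (k + 1) + 1 / 2 / 4 ^ (k + 1)"
      using that[unfolded Q] r[of c k] z(2) by linarith
    also have "\<dots> < 4 / 4 ^ (k + 1)" by (simp add: field_simps)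
    also have "\<dots> = (1 / 2 ^ k)\<^sup>2" by (simp add: power_divide four_power)
    finally show ?thesis using z(1) by blast
  qed
  have cover: "Q c k" if z: "z \<in> spectrum a" "(cmod (z - gaussian_value c))\<^sup>2 \<le> 2 / 4 ^ (k + 1)" for z c k
  proof -
    have "real (C c) - (cmod (z - gaussian_value c))\<^sup>2 \<le> norm (?x c)"
      by (rule norm_distance_element(1)[OF Cz z(1)])
    moreover have "1 / 2 / 4 ^ (k + 1) + 2 / 4 ^ (k + 1) < (3 / 4 ^ (k + 1) :: real)" by (simp add: field_simps)
    ultimately show ?thesis unfolding Q using r[of c k] z(2) by linarith
  qed
  show ?thesis
    unfolding computably_compact_def Let_def gaussian_value_def[symmetric]
  proof (intro conjI exI[of _ s] allI)
    show "compact (spectrum a)" by (rule compact_spectrum)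
    fix k
    show "\<exists>n. computes0 s [k] n \<and> spectrum a \<subseteq> (\<Union>c\<in>set (list_decode n). ball (gaussian_value c) (1 / 2 ^ k)) \<and>
      (\<forall>c\<in>set (list_decode n). ball (gaussian_value c) (1 / 2 ^ k) \<inter> spectrum a \<noteq> {})"
    proof (intro exI[of _ "L k"] conjI s subsetI ballI)
      fix z assume z: "z \<in> spectrum a"
      obtain c where c: "c < grid_bound R k" "(cmod (z - gaussian_value c))\<^sup>2 \<le> 2 / 4 ^ (k + 1)"
        using grid_point_exists[OF zR[OF z]] by blast
      note c(2)
      also have "2 / 4 ^ (k + 1) < (4 / 4 ^ (k + 1) :: real)" by (intro divide_strict_right_mono) simp_all
      also have "4 / 4 ^ (k + 1) = (1 / 2 ^ k :: real)\<^sup>2"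
        by (simp add: power_divide four_power)
      finally have "cmod (z - gaussian_value c) < 1 / 2 ^ k" by (rule power2_less_imp_less) simp
      then have "z \<in> ball (gaussian_value c) (1 / 2 ^ k)" by (simp add: dist_norm norm_minus_commute)
      moreover have "c \<in> set (list_decode (L k))"
        unfolding L_def set_filter_code using c(1) cover[OF z c(2)] by simp
      ultimately show "z \<in> (\<Union>c\<in>set (list_decode (L k)). ball (gaussian_value c) (1 / 2 ^ k))" by blast
    next
      fix c assume "c \<in> set (list_decode (L k))"
      then have "Q c k" unfolding L_def set_filter_code by simp
      then obtain z where z: "z \<in> spectrum a" "(cmod (z - gaussian_value c))\<^sup>2 < (1 / 2 ^ k)\<^sup>2"
        using acc by blast
      from z(2) have "cmod (z - gaussian_value c) < 1 / 2 ^ k" by (rule power2_less_imp_less) simp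
      then have "z \<in> ball (gaussian_value c) (1 / 2 ^ k)" by (simp add: dist_norm norm_minus_commute)
      with z(1) show "ball (gaussian_value c) (1 / 2 ^ k) \<inter> spectrum a \<noteq> {}" by blast
    qed
  qed
qed

theorem theorem1p1:
  fixes P :: "'a::unital_cstar_algebra presentation" and a :: 'a
  assumes "cstar_presentation P"
    and "computable_presentation P"
    and "computable_point P 1"
    and "normal_element a"
    and "computable_point P a"
  shows "computably_compact (spectrum a) \<and>
    computable_map (C_presentation (spectrum a)) P (functional_calculus a)"
  using assms spectrum_computably_compact computable_functional_calculus
  unfolding cstar_presentation_def by blast

end
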